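(* Let $\Gamma$ be a countable amenable group with a sofic approximation $\Sigma$, and let $\pi\colon X\to Y$ be a factor map between dynamical systems $\Gamma\curvearrowright X$ and $\Gamma\curvearrowright Y$. Let $\rho_X$ be a dynamically generating continuous pseudometric on $X$. Then $$\mathrm{mdim}_{\Sigma,\mathrm M}(X|Y,\rho_X)=\mathrm{mdim}_{\mathrm M}(X|Y,\rho_X).$$
   Context: $\Gamma$ is a countable discrete group; $\mathcal F(\Gamma)$ is the collection of nonempty finite subsets of $\Gamma$. A dynamical system $\Gamma\curvearrowright X$ is a continuous action on a compact metrizable space $X$; a factor map is a surjective continuous $\Gamma$-equivariant map. $[d]=\{1,\dots,d\}$. A pseudometric $\rho$ on $X$ is dynamically generating if $\sup_{s\in\Gamma}\rho(sx,sx')>0$ for all distinct $x,x'\in X$. Sofic approximation: a sequence of maps $\Sigma=\{\sigma_i\colon\Gamma\to\mathrm{Sym}(d_i)\}_{i\in\mathbb N}$ (not necessarily homomorphisms; write $\sigma_{i,s}=\sigma_i(s)$) with (1) $|\{v\in[d_i]:\sigma_{i,s}\sigma_{i,t}(v)=\sigma_{i,st}(v)\}|/d_i\to1$ for all $s,t\in\Gamma$; (2) $|\{v\in[d_i]:\sigma_{i,s}(v)\ne\sigma_{i,t}(v)\}|/d_i\to1$ for all distinct $s,t$; (3) $d_i\to\infty$. For a continuous pseudometric $\rho$ on $Z$ and $\varphi,\psi\in Z^{[d]}$: $\rho_{2}(\varphi,\psi)=\big(\frac1d\sum_{v}\rho(\varphi(v),\psi(v))^2\big)^{1/2}$, $\rho_{\infty}(\varphi,\psi)=\max_v\rho(\varphi(v),\psi(v))$;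 these are written $\rho_{X,2},\rho_{X,\infty}$ for $\rho=\rho_X$, etc. For $F\in\mathcal F(\Gamma)$, $\delta>0$, $\sigma\colon\Gamma\to\mathrm{Sym}(d)$, $$\mathrm{Map}(\rho_X,F,\delta,\sigma)=\{\varphi\colon[d]\to X:\ \rho_{X,2}(s\varphi,\varphi\circ\sigma(s))\le\delta\ \text{for all } s\in F\},\quad (s\varphi)(v)=s(\varphi(v)).$$ Conditional sofic metric mean dimension: for $\mathcal K\subseteq X^{[d]}$ and $\varepsilon,\theta>0$, $N_\varepsilon(\mathcal K,\theta,\rho_{X,\infty}|\rho_{Y,\infty})$ is the maximal cardinality of a subset $\mathcal E\subseteq\mathcal K$ such that $\rho_{Y,\infty}(\pi\circ\varphi,\pi\circ\varphi')\le\theta$ and $\rho_{X,\infty}(\varphi,\varphi')\ge\varepsilon$ for all distinct $\varphi,\varphi'\in\mathcal E$. Set $$h_\Sigma^\varepsilon(\rho_X|\rho_Y)=\inf_{\theta>0}\inf_{F\in\mathcal F(\Gamma)}\inf_{\delta>0}\limsup_{i\to\infty}\tfrac1{d_i}\log N_\varepsilon(\mathrm{Map}(\rho_X,F,\delta,\sigma_i),\theta,\rho_{X,\infty}|\rho_{Y,\infty})$$ ($-\infty$ for the $\limsup$ if the $\mathrm{Map}$ sets are empty for all large $i$), and $$\mathrm{mdim}_{\Sigma,\mathrm M}(X|Y,\rho_X)=\liminf_{\varepsilon\to0}\frac{h_\Sigma^\varepsilon(\rho_X|\rho_Y)}{\log(1/\varepsilon)}$$ for any dynamically generating continuous pseudometric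 $\rho_Y$ on $Y$ (the value does not depend on $\rho_Y$). Conditional metric mean dimension (amenable $\Gamma$): $\Gamma$ is amenable if for all $K\in\mathcal F(\Gamma),\delta>0$ there is $F\in\mathcal F(\Gamma)$ with $|KF\setminus F|<\delta|F|$. For a real function $\phi$ on $\mathcal F(\Gamma)$, $\limsup_F\phi(F)=\inf_{K\in\mathcal F(\Gamma),\delta>0}\sup\{\phi(F):F\in\mathcal F(\Gamma),\ |KF\setminus F|<\delta|F|\}$. For $F\in\mathcal F(\Gamma)$, $\rho_{X,F}(x,x')=\max_{s\in F}\rho_X(sx,sx')$. For a closed set $K$ with a continuous pseudometric $\rho$, $N_\varepsilon(K,\rho)$ is the maximal cardinality of a subset of $K$ whose distinct points satisfy $\rho(z_1,z_2)\ge\varepsilon$. Then $$\mathrm{mdim}_{\mathrm M}(X|Y,\rho_X)=\liminf_{\varepsilon\to0}\frac1{\log(1/\varepsilon)}\limsup_F\frac{\max_{y\in Y}\log N_\varepsilon(\pi^{-1}(y),\rho_{X,F})}{|F|}.$$ *)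

theory Defs
  imports "HOL-Analysis.Analysis" "HOL-Algebra.Group_Action" "HOL-Algebra.Coset"
begin

subsection \<open>Dynamical systems and pseudometrics\<close>

text \<open>The library's group actions are homomorphisms into \<open>BijGroup\<close>, so \<open>act s\<close> is
  \<open>undefined\<close> outside the space; it is only ever evaluated on the space.\<close>

definition dynamical_system ::
  "('g, 'm) monoid_scheme \<Rightarrow> 'x topology \<Rightarrow> ('g \<Rightarrow> 'x \<Rightarrow> 'x) \<Rightarrow> bool" where
  "dynamical_system G X act \<longleftrightarrow>
     compact_space X \<and> metrizable_space X \<and>
     group_action G (topspace X) act \<and>
     (\<forall>s\<in>carrier G. continuous_map X X (act s))"

definition factor_map ::
  "('g, 'm) monoid_scheme \<Rightarrow> 'x topology \<Rightarrow> ('g \<Rightarrow> 'x \<Rightarrow> 'x) \<Rightarrow>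
   'y topology \<Rightarrow> ('g \<Rightarrow> 'y \<Rightarrow> 'y) \<Rightarrow> ('x \<Rightarrow> 'y) \<Rightarrow> bool" where
  "factor_map G X actX Y actY \<pi> \<longleftrightarrow>
     continuous_map X Y \<pi> \<and> \<pi> ` topspace X = topspace Y \<and>
     (\<forall>s\<in>carrier G. \<forall>x\<in>topspace X. \<pi> (actX s x) = actY s (\<pi> x))"

definition continuous_pseudometric :: "'x topology \<Rightarrow> ('x \<Rightarrow> 'x \<Rightarrow> real) \<Rightarrow> bool" where
  "continuous_pseudometric X \<rho> \<longleftrightarrow>
     (\<forall>x\<in>topspace X. \<rho> x x = 0) \<and>
     (\<forall>x\<in>topspace X. \<forall>y\<in>topspace X. 0 \<le> \<rho> x y \<and> \<rho> x y = \<rho> y x) \<and>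
     (\<forall>x\<in>topspace X. \<forall>y\<in>topspace X. \<forall>z\<in>topspace X. \<rho> x z \<le> \<rho> x y + \<rho> y z) \<and>
     continuous_map (prod_topology X X) euclideanreal (\<lambda>(x, y). \<rho> x y)"

definition dynamically_generating ::
  "('g, 'm) monoid_scheme \<Rightarrow> 'x topology \<Rightarrow> ('g \<Rightarrow> 'x \<Rightarrow> 'x) \<Rightarrow> ('x \<Rightarrow> 'x \<Rightarrow> real) \<Rightarrow> bool" where
  "dynamically_generating G X act \<rho> \<longleftrightarrow>
     (\<forall>x\<in>topspace X. \<forall>x'\<in>topspace X. x \<noteq> x' \<longrightarrow>
        0 < (SUP s\<in>carrier G. ereal (\<rho> (act s x) (act s x'))))"

subsection \<open>Amenable groups and sofic approximations\<close>

definition fin_subsets :: "('g, 'm) monoid_scheme \<Rightarrow> 'g set set" where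
  "fin_subsets G = {F. F \<subseteq> carrier G \<and> finite F \<and> F \<noteq> {}}"

definition almost_invariant ::
  "('g, 'm) monoid_scheme \<Rightarrow> 'g set \<Rightarrow> real \<Rightarrow> 'g set set" where
  "almost_invariant G K \<delta> =
     {F \<in> fin_subsets G. real (card ((K <#>\<^bsub>G\<^esub> F) - F)) < \<delta> * real (card F)}"

definition amenable_group :: "('g, 'm) monoid_scheme \<Rightarrow> bool" where
  "amenable_group G \<longleftrightarrow>
     group G \<and> (\<forall>K\<in>fin_subsets G. \<forall>\<delta>>0. almost_invariant G K \<delta> \<noteq> {})"

definition limsup_fin :: "('g, 'm) monoid_scheme \<Rightarrow> ('g set \<Rightarrow> ereal) \<Rightarrow> ereal" where
  "limsup_fin G \<phi> =
     (INF K\<in>fin_subsets G. INF \<delta>\<in>{0<..}. SUP F\<in>almost_invariant G K \<delta>. \<phi> F)"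

definition sofic_approximation ::
  "('g, 'm) monoid_scheme \<Rightarrow> (nat \<Rightarrow> nat) \<Rightarrow> (nat \<Rightarrow> 'g \<Rightarrow> nat \<Rightarrow> nat) \<Rightarrow> bool" where
  "sofic_approximation G d \<sigma> \<longleftrightarrow>
     (\<forall>i. \<forall>s\<in>carrier G. \<sigma> i s permutes {1..d i}) \<and>
     (\<forall>s\<in>carrier G. \<forall>t\<in>carrier G.
        (\<lambda>i. real (card {v\<in>{1..d i}. \<sigma> i s (\<sigma> i t v) = \<sigma> i (s \<otimes>\<^bsub>G\<^esub> t) v}) / real (d i))
          \<longlonglongrightarrow> 1) \<and>
     (\<forall>s\<in>carrier G. \<forall>t\<in>carrier G. s \<noteq> t \<longrightarrow>
        (\<lambda>i. real (card {v\<in>{1..d i}. \<sigma> i s v \<noteq> \<sigma> i t v}) / real (d i)) \<longlonglongrightarrow> 1) \<and>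
     filterlim d at_top sequentially"

subsection \<open>Maximal cardinalities and their logarithms\<close>

text \<open>A maximal cardinality is the supremum of the cardinalities of the finite sets of the
  given kind; the supremum is attained as soon as it is finite.\<close>

definition max_card :: "('a set \<Rightarrow> bool) \<Rightarrow> enat" where
  "max_card P = (SUP E\<in>{E. finite E \<and> P E}. enat (card E))"

text \<open>The value of \<open>elog\<close> at \<open>0\<close> implements the convention on empty sets of maps: a limit
  superior is \<open>- \<infinity>\<close> if they are empty for all large indices.\<close>

definition elog :: "enat \<Rightarrow> ereal" where
  "elog n = (case n of enat k \<Rightarrow> if k = 0 then - \<infinity> else ereal (ln (real k)) | \<infinity> \<Rightarrow> \<infinity>)"

subsection \<open>Conditional sofic metric mean dimension\<close>

definition rho_two :: "nat \<Rightarrow> ('x \<Rightarrow> 'x \<Rightarrow> real) \<Rightarrow> (nat \<Rightarrow> 'x) \<Rightarrow> (nat \<Rightarrow> 'x) \<Rightarrow> real" where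
  "rho_two d \<rho> \<phi> \<psi> = sqrt (1 / real d * (\<Sum>v\<in>{1..d}. (\<rho> (\<phi> v) (\<psi> v))\<^sup>2))"

definition rho_infty :: "nat \<Rightarrow> ('x \<Rightarrow> 'x \<Rightarrow> real) \<Rightarrow> (nat \<Rightarrow> 'x) \<Rightarrow> (nat \<Rightarrow> 'x) \<Rightarrow> real" where
  "rho_infty d \<rho> \<phi> \<psi> = (MAX v\<in>{1..d}. \<rho> (\<phi> v) (\<psi> v))"

definition sofic_Map ::
  "'x topology \<Rightarrow> ('g \<Rightarrow> 'x \<Rightarrow> 'x) \<Rightarrow> ('x \<Rightarrow> 'x \<Rightarrow> real) \<Rightarrow> 'g set \<Rightarrow> real \<Rightarrow>
   nat \<Rightarrow> ('g \<Rightarrow> nat \<Rightarrow> nat) \<Rightarrow> (nat \<Rightarrow> 'x) set" where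
  "sofic_Map X act \<rho> F \<delta> d \<sigma> =
     {\<phi> \<in> {1..d} \<rightarrow>\<^sub>E topspace X. \<forall>s\<in>F. rho_two d \<rho> (\<lambda>v. act s (\<phi> v)) (\<phi> \<circ> \<sigma> s) \<le> \<delta>}"

definition N_cond ::
  "nat \<Rightarrow> ('x \<Rightarrow> 'y) \<Rightarrow> real \<Rightarrow> (nat \<Rightarrow> 'x) set \<Rightarrow> real \<Rightarrow>
   ('x \<Rightarrow> 'x \<Rightarrow> real) \<Rightarrow> ('y \<Rightarrow> 'y \<Rightarrow> real) \<Rightarrow> enat" where
  "N_cond d \<pi> \<epsilon> \<K> \<theta> \<rho>X \<rho>Y =
     max_card (\<lambda>\<E>. \<E> \<subseteq> \<K> \<and> (\<forall>\<phi>\<in>\<E>. \<forall>\<phi>'\<in>\<E>. \<phi> \<noteq> \<phi>' \<longrightarrow>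
        rho_infty d \<rho>Y (\<pi> \<circ> \<phi>) (\<pi> \<circ> \<phi>') \<le> \<theta> \<and> \<epsilon> \<le> rho_infty d \<rho>X \<phi> \<phi>'))"

definition h_sofic ::
  "('g, 'm) monoid_scheme \<Rightarrow> (nat \<Rightarrow> nat) \<Rightarrow> (nat \<Rightarrow> 'g \<Rightarrow> nat \<Rightarrow> nat) \<Rightarrow>
   'x topology \<Rightarrow> ('g \<Rightarrow> 'x \<Rightarrow> 'x) \<Rightarrow> ('x \<Rightarrow> 'y) \<Rightarrow>
   ('x \<Rightarrow> 'x \<Rightarrow> real) \<Rightarrow> ('y \<Rightarrow> 'y \<Rightarrow> real) \<Rightarrow> real \<Rightarrow> ereal" where
  "h_sofic G d \<sigma> X act \<pi> \<rho>X \<rho>Y \<epsilon> =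
     (INF \<theta>\<in>{0<..}. INF F\<in>fin_subsets G. INF \<delta>\<in>{0<..}.
        limsup (\<lambda>i. elog (N_cond (d i) \<pi> \<epsilon> (sofic_Map X act \<rho>X F \<delta> (d i) (\<sigma> i)) \<theta> \<rho>X \<rho>Y)
                      / ereal (real (d i))))"

definition mdim_sofic ::
  "('g, 'm) monoid_scheme \<Rightarrow> (nat \<Rightarrow> nat) \<Rightarrow> (nat \<Rightarrow> 'g \<Rightarrow> nat \<Rightarrow> nat) \<Rightarrow>
   'x topology \<Rightarrow> ('g \<Rightarrow> 'x \<Rightarrow> 'x) \<Rightarrow> ('x \<Rightarrow> 'y) \<Rightarrow>
   ('x \<Rightarrow> 'x \<Rightarrow> real) \<Rightarrow> ('y \<Rightarrow> 'y \<Rightarrow> real) \<Rightarrow> ereal" where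
  "mdim_sofic G d \<sigma> X act \<pi> \<rho>X \<rho>Y =
     Liminf (at_right 0) (\<lambda>\<epsilon>. h_sofic G d \<sigma> X act \<pi> \<rho>X \<rho>Y \<epsilon> / ereal (ln (1 / \<epsilon>)))"

subsection \<open>Conditional metric mean dimension\<close>

definition rho_F :: "('g \<Rightarrow> 'x \<Rightarrow> 'x) \<Rightarrow> ('x \<Rightarrow> 'x \<Rightarrow> real) \<Rightarrow> 'g set \<Rightarrow> 'x \<Rightarrow> 'x \<Rightarrow> real" where
  "rho_F act \<rho> F x x' = (MAX s\<in>F. \<rho> (act s x) (act s x'))"

definition N_sep :: "real \<Rightarrow> 'x set \<Rightarrow> ('x \<Rightarrow> 'x \<Rightarrow> real) \<Rightarrow> enat" where
  "N_sep \<epsilon> K \<rho> =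
     max_card (\<lambda>E. E \<subseteq> K \<and> (\<forall>z\<^sub>1\<in>E. \<forall>z\<^sub>2\<in>E. z\<^sub>1 \<noteq> z\<^sub>2 \<longrightarrow> \<epsilon> \<le> \<rho> z\<^sub>1 z\<^sub>2))"

definition mdim_cond ::
  "('g, 'm) monoid_scheme \<Rightarrow> 'x topology \<Rightarrow> ('g \<Rightarrow> 'x \<Rightarrow> 'x) \<Rightarrow> 'y topology \<Rightarrow> ('x \<Rightarrow> 'y) \<Rightarrow>
   ('x \<Rightarrow> 'x \<Rightarrow> real) \<Rightarrow> ereal" where
  "mdim_cond G X act Y \<pi> \<rho> =
     Liminf (at_right 0) (\<lambda>\<epsilon>.
       limsup_fin G (\<lambda>F.
         (SUP y\<in>topspace Y. elog (N_sep \<epsilon> {x \<in> topspace X. \<pi> x = y} (rho_F act \<rho> F)))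
           / ereal (real (card F)))
       / ereal (ln (1 / \<epsilon>)))"

end

theory Submission
  imports Defs
begin

text \<open>By the Ornstein--Weiss argument almost all of \<open>{1..d}\<close> is quasi-tiled by sofic translates of
  finitely many almost invariant sets \<open>F\<close>, chosen such that each one is very invariant under the earlier
  ones and laid down in the reverse order.

  Upper bound: a sofic model is almost equivariant at all but few tile centres \<open>c\<close>, hence it is determined up to
  \<open>\<epsilon>\<close> on the tile by an approximation of \<open>\<phi> c\<close> with respect to \<open>\<rho>\<^sub>F\<close>. If two models are close over \<open>Y\<close>, then the points \<open>\<phi> c\<close> lie
  in a small neighbourhood of one fibre, which by compactness needs no more balls than a fibre does.
  The exceptional centres depend on the model, but they number at most a small multiple of \<open>d\<close>, so the choice of
  this set contributes only a factor \<open>exp (\<kappa> d)\<close>. This gives \<open>h\<^sub>\<Sigma>\<close> at \<open>\<epsilon>\<close> at most the amenable rate at \<open>\<epsilon> / 4\<close>.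

  Lower bound: choose the shapes among almost invariant sets \<open>F\<close> with a large separated set in some fibre,
  and pick a point of that set independently for each tile. Models made in this way agree over \<open>Y\<close>. This gives
  \<open>h\<^sub>\<Sigma>\<close> at \<open>\<epsilon>\<close> at least the amenable rate at \<open>\<epsilon>\<close>. The factor 4 is absorbed by \<open>ln (1 / \<epsilon>)\<close>.\<close>

subsection \<open>Quasi-tilings of sofic approximations\<close>

text \<open>A tile is a translate of its shape \<open>F\<close> to its centre \<open>c\<close>, of which only the points \<open>\<sigma> s c\<close> with
  \<open>s\<close> in the part are kept: the kept regions are disjoint, the full translates need not be. In a
  quasi-tiling the full translates are nevertheless covered, so that the covered set inherits the
  approximate invariance of the shapes.\<close>

datatype ('g, 'v) tile = Tile (shape: "'g set") (centre: 'v) (part: "'g set")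

definition region :: "('g \<Rightarrow> 'v \<Rightarrow> 'v) \<Rightarrow> ('g, 'v) tile \<Rightarrow> 'v set" where
  "region \<sigma> t = (\<lambda>s. \<sigma> s (centre t)) ` part t"

definition covered :: "('g \<Rightarrow> 'v \<Rightarrow> 'v) \<Rightarrow> ('g, 'v) tile set \<Rightarrow> 'v set" where
  "covered \<sigma> T = (\<Union>t\<in>T. region \<sigma> t)"

definition quasi_tiling ::
  "real \<Rightarrow> ('g \<Rightarrow> 'v \<Rightarrow> 'v) \<Rightarrow> 'v set \<Rightarrow> ('g, 'v) tile set \<Rightarrow> bool" where
  "quasi_tiling \<eta> \<sigma> B T \<longleftrightarrow>
     finite T \<and> disjoint_family_on (region \<sigma>) T \<and>
     (\<forall>t\<in>T. finite (shape t) \<and> centre t \<in> B \<and> part t \<subseteq> shape t \<and>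
        (1 - \<eta>) * card (shape t) \<le> card (part t) \<and>
        inj_on (\<lambda>s. \<sigma> s (centre t)) (shape t) \<and>
        (\<forall>s\<in>shape t. \<sigma> s (centre t) \<in> covered \<sigma> T))"

definition good_centres ::
  "('g, 'm) monoid_scheme \<Rightarrow> nat \<Rightarrow> ('g \<Rightarrow> nat \<Rightarrow> nat) \<Rightarrow> 'g set \<Rightarrow> nat set" where
  "good_centres G d \<sigma> L =
     {c\<in>{1..d}. (\<forall>s\<in>L. \<forall>t\<in>L. \<sigma> s (\<sigma> t c) = \<sigma> (s \<otimes>\<^bsub>G\<^esub> t) c) \<and> inj_on (\<lambda>s. \<sigma> s c) L}"

lemma quasi_tilingD:
  assumes "quasi_tiling \<eta> \<sigma> B T"
  shows "finite T" "disjoint_family_on (region \<sigma>) T"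
    "\<And>t. t \<in> T \<Longrightarrow> finite (shape t)" "\<And>t. t \<in> T \<Longrightarrow> centre t \<in> B"
    "\<And>t. t \<in> T \<Longrightarrow> part t \<subseteq> shape t"
    "\<And>t. t \<in> T \<Longrightarrow> (1 - \<eta>) * card (shape t) \<le> card (part t)"
    "\<And>t. t \<in> T \<Longrightarrow> inj_on (\<lambda>s. \<sigma> s (centre t)) (shape t)"
    "\<And>t s. t \<in> T \<Longrightarrow> s \<in> shape t \<Longrightarrow> \<sigma> s (centre t) \<in> covered \<sigma> T"
  using assms unfolding quasi_tiling_def by blast+

lemma card_region:
  assumes "quasi_tiling \<eta> \<sigma> B T" "t \<in> T"
  shows "card (region \<sigma> t) = card (part t)"
  unfolding region_def
  by (intro card_image inj_on_subset[OF quasi_tilingD(7)[OF assms] quasi_tilingD(5)[OF assms]])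

lemma finite_region:
  assumes "quasi_tiling \<eta> \<sigma> B T" "t \<in> T"
  shows "finite (region \<sigma> t)"
  unfolding region_def
  using quasi_tilingD(3,5)[OF assms] finite_subset by blast

lemma finite_covered:
  assumes "quasi_tiling \<eta> \<sigma> B T"
  shows "finite (covered \<sigma> T)"
  unfolding covered_def using finite_region[OF assms] quasi_tilingD(1)[OF assms] by blast

lemma card_covered:
  assumes "quasi_tiling \<eta> \<sigma> B T"
  shows "card (covered \<sigma> T) = (\<Sum>t\<in>T. card (part t))"
proof -
  have "card (covered \<sigma> T) = (\<Sum>t\<in>T. card (region \<sigma> t))"
    unfolding covered_def using quasi_tilingD(1,2)[OF assms] finite_region[OF assms]
    by (intro card_UN_disjoint) (auto simp: disjoint_family_on_def)
  then show ?thesis using card_region[OF assms] by simp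
qed

lemma sum_card_shape_le:
  assumes "quasi_tiling \<eta> \<sigma> B T"
  shows "(1 - \<eta>) * (\<Sum>t\<in>T. real (card (shape t))) \<le> card (covered \<sigma> T)"
  unfolding card_covered[OF assms] sum_distrib_left of_nat_sum
  using quasi_tilingD(6)[OF assms] by (intro sum_mono)

text \<open>Every point of \<open>B\<close> is tried once as a centre; the new tile keeps the part of the shape
  that is not covered yet, unless this part is too small.\<close>

lemma greedy_tiling:
  assumes "finite B'" "B' \<subseteq> B" "quasi_tiling \<eta> \<sigma> B T" "finite F" "0 < \<eta>" "\<eta> \<le> 1/2"
    and inj: "\<And>c. c \<in> B \<Longrightarrow> inj_on (\<lambda>s. \<sigma> s c) F"
  shows "\<exists>T'. quasi_tiling \<eta> \<sigma> B T' \<and> covered \<sigma> T \<subseteq> covered \<sigma> T' \<and>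
           shape ` T' \<subseteq> insert F (shape ` T) \<and>
           (\<forall>c\<in>B'. \<eta> * card F \<le> card {s\<in>F. \<sigma> s c \<in> covered \<sigma> T'})"
  using assms(1,2)
proof (induction B' rule: finite_induct)
  case empty
  then show ?case using assms(3) by (intro exI[of _ T]) auto
next
  case (insert c B')
  then obtain T1 where T1: "quasi_tiling \<eta> \<sigma> B T1" "covered \<sigma> T \<subseteq> covered \<sigma> T1"
     "shape ` T1 \<subseteq> insert F (shape ` T)"
     "\<And>c. c \<in> B' \<Longrightarrow> \<eta> * card F \<le> card {s\<in>F. \<sigma> s c \<in> covered \<sigma> T1}"
    by auto
  define P where "P = {s\<in>F. \<sigma> s c \<notin> covered \<sigma> T1}"
  have FP: "card F = card P + card {s\<in>F. \<sigma> s c \<in> covered \<sigma> T1}"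
    unfolding P_def using \<open>finite F\<close>
    by (subst card_Un_disjoint[symmetric]) (auto intro: arg_cong[where f = card])
  show ?case
  proof (cases "(1 - \<eta>) * card F \<le> card P")
    case False
    then have "\<eta> * card F \<le> card {s\<in>F. \<sigma> s c \<in> covered \<sigma> T1}"
      using FP by (simp add: algebra_simps)
    then show ?thesis using T1 by (intro exI[of _ T1]) auto
  next
    case True
    define t where "t = Tile F c P"
    have tsel: "shape t = F" "centre t = c" "part t = P" by (auto simp: t_def)
    have cov: "covered \<sigma> (insert t T1) = covered \<sigma> T1 \<union> region \<sigma> t"
      by (auto simp: covered_def)
    have disj: "region \<sigma> t \<inter> region \<sigma> u = {}" if "u \<in> T1" for u
      using that by (auto simp: region_def tsel P_def covered_def)
    have Fc: "\<sigma> s c \<in> covered \<sigma> (insert t T1)" if "s \<in> F" for s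
      using that by (auto simp: cov region_def tsel P_def)
    have "c \<in> B" using insert.prems by auto
    have "quasi_tiling \<eta> \<sigma> B (insert t T1)"
      unfolding quasi_tiling_def
    proof (intro conjI ballI)
      show "finite (insert t T1)" using quasi_tilingD(1)[OF T1(1)] by simp
      show "disjoint_family_on (region \<sigma>) (insert t T1)"
        using quasi_tilingD(2)[OF T1(1)] disj
        unfolding disjoint_family_on_def by blast
    next
      fix u assume "u \<in> insert t T1"
      then have u: "u = t \<or> u \<in> T1" by auto
      show "finite (shape u)" "centre u \<in> B" "part u \<subseteq> shape u"
        "(1 - \<eta>) * card (shape u) \<le> card (part u)"
        "inj_on (\<lambda>s. \<sigma> s (centre u)) (shape u)"
        using u quasi_tilingD(3)[OF T1(1), of u] \<open>finite F\<close> apply (metis tsel(1))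
        using u quasi_tilingD(4)[OF T1(1), of u] \<open>c \<in> B\<close> apply (metis tsel(2))
        using u quasi_tilingD(5)[OF T1(1), of u] apply (auto simp: tsel P_def)[1]
        using u quasi_tilingD(6)[OF T1(1), of u] True apply (metis tsel(1,3))
        using u quasi_tilingD(7)[OF T1(1), of u] inj[OF \<open>c \<in> B\<close>] apply (metis tsel(1,2))
        done
      fix s assume "s \<in> shape u"
      then show "\<sigma> s (centre u) \<in> covered \<sigma> (insert t T1)"
        using u quasi_tilingD(8)[OF T1(1), of u s] Fc tsel cov by (metis UnCI)
    qed
    moreover have "\<eta> * card F \<le> card {s\<in>F. \<sigma> s c' \<in> covered \<sigma> (insert t T1)}"
      if "c' \<in> insert c B'" for c'
    proof (cases "c' = c")
      case True
      then have "{s\<in>F. \<sigma> s c' \<in> covered \<sigma> (insert t T1)} = F" using Fc by auto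
      then show ?thesis using \<open>\<eta> \<le> 1/2\<close> by (simp add: mult_left_le_one_le \<open>0 < \<eta>\<close> less_imp_le)
    next
      case False
      then have "\<eta> * card F \<le> card {s\<in>F. \<sigma> s c' \<in> covered \<sigma> T1}" using T1(4) that by auto
      also have "\<dots> \<le> card {s\<in>F. \<sigma> s c' \<in> covered \<sigma> (insert t T1)}"
        using \<open>finite F\<close> by (intro of_nat_mono card_mono) (auto simp: cov)
      finally show ?thesis .
    qed
    ultimately show ?thesis using T1(2,3) 
      by (intro exI[of _ "insert t T1"]) (auto simp: cov tsel)
  qed
qed

lemma card_shift_diff:
  assumes "finite V" "A \<subseteq> V" "p permutes V"
  shows "card {c\<in>V. p c \<in> A \<and> c \<notin> A} = card {c\<in>A. p c \<notin> A}"
proof -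
  have fA: "finite A" using assms finite_subset by auto
  have inj: "inj_on p V" using permutes_inj_on[OF assms(3)] .
  have "p ` {c\<in>V. p c \<in> A} = A"
    using assms(2) permutes_image[OF assms(3)] by auto
  moreover have "inj_on p {c\<in>V. p c \<in> A}" using inj by (rule inj_on_subset) auto
  ultimately have "card {c\<in>V. p c \<in> A} = card A" by (metis card_image)
  moreover have "card {c\<in>V. p c \<in> A} = card {c\<in>V. p c \<in> A \<and> c \<notin> A} + card {c\<in>A. p c \<in> A}"
    using assms fA by (subst card_Un_disjoint[symmetric]) (auto intro!: arg_cong[where f = card])
  moreover have "card A = card {c\<in>A. p c \<notin> A} + card {c\<in>A. p c \<in> A}"
    using fA by (subst card_Un_disjoint[symmetric]) (auto intro!: arg_cong[where f = card])
  ultimately show ?thesis by linarith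
qed

lemma tiling_step:
  fixes d :: nat and \<beta> \<gamma> :: real and G (structure)
  assumes T: "quasi_tiling \<eta> \<sigma> (good_centres G d \<sigma> L) T"
    and B: "real (card ({1..d} - good_centres G d \<sigma> L)) \<le> \<beta> * d"
    and F: "finite F" "F \<noteq> {}" "F \<subseteq> L" and \<eta>: "0 < \<eta>" "\<eta> \<le> 1/2" and \<gamma>: "0 \<le> \<gamma>"
    and perm: "\<And>s. s \<in> L \<Longrightarrow> \<sigma> s permutes {1..d}"
    and shL: "\<And>t. t \<in> T \<Longrightarrow> shape t \<subseteq> L"
    and inv: "\<And>t s. t \<in> T \<Longrightarrow> s \<in> F \<Longrightarrow>
      card F * card {u\<in>shape t. s \<otimes> u \<notin> shape t} \<le> \<gamma> * card (shape t)"
  shows "\<exists>T'. quasi_tiling \<eta> \<sigma> (good_centres G d \<sigma> L) T' \<and> 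
           shape ` T' \<subseteq> insert F (shape ` T) \<and>
           real d - card (covered \<sigma> T') \<le> (1 - \<eta>) * (real d - card (covered \<sigma> T)) + \<eta> * ((\<beta> + 2 * \<gamma>) * d)"
proof -
  define B where "B = good_centres G d \<sigma> L"
  have Bsub: "B \<subseteq> {1..d}" by (auto simp: B_def good_centres_def)
  then have finB: "finite B" using finite_subset by blast
  have injB: "inj_on (\<lambda>s. \<sigma> s c) F" if "c \<in> B" for c
    using that F(3) inj_on_subset unfolding B_def good_centres_def by blast
  note TB = T[folded B_def]
  obtain T' where T': "quasi_tiling \<eta> \<sigma> B T'" "covered \<sigma> T \<subseteq> covered \<sigma> T'"
      "shape ` T' \<subseteq> insert F (shape ` T)"
      "\<And>c. c \<in> B \<Longrightarrow> \<eta> * card F \<le> card {s\<in>F. \<sigma> s c \<in> covered \<sigma> T'}"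
    using greedy_tiling[OF finB subset_refl TB F(1) \<eta> injB] by auto
  define A where "A = covered \<sigma> T"
  define A' where "A' = covered \<sigma> T'"
  have AV: "A \<subseteq> {1..d}"
  proof
    fix v assume "v \<in> A"
    then obtain t s where "t \<in> T" "s \<in> part t" "v = \<sigma> s (centre t)"
      by (auto simp: A_def covered_def region_def)
    then show "v \<in> {1..d}"
      using quasi_tilingD(4,5)[OF TB] Bsub perm shL permutes_in_image by (metis in_mono)
  qed
  have fA: "finite A" "finite A'" unfolding A_def A'_def
    using finite_covered TB T'(1) by blast+
  have shsum: "(\<Sum>t\<in>T. real (card (shape t))) \<le> 2 * real d"
  proof -
    have "1/2 * (\<Sum>t\<in>T. real (card (shape t))) \<le> (1 - \<eta>) * (\<Sum>t\<in>T. real (card (shape t)))"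
      using \<eta> by (intro mult_right_mono sum_nonneg) auto
    also have "\<dots> \<le> card A" unfolding A_def using sum_card_shape_le[OF TB] .
    also have "card A \<le> real d" using card_mono[OF _ AV] by simp
    finally show ?thesis by simp
  qed
  have bd: "card F * card {c\<in>{1..d}. \<sigma> s c \<in> A \<and> c \<notin> A} \<le> \<gamma> * (2 * real d)" if s: "s \<in> F" for s
  proof -
    have "{c\<in>A. \<sigma> s c \<notin> A} \<subseteq> (\<Union>t\<in>T. (\<lambda>u. \<sigma> u (centre t)) ` {u\<in>shape t. s \<otimes> u \<notin> shape t})"
    proof
      fix c assume c: "c \<in> {c\<in>A. \<sigma> s c \<notin> A}"
      then obtain t u where tu: "t \<in> T" "u \<in> part t" "c = \<sigma> u (centre t)"
        by (auto simp: A_def covered_def region_def)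
      have u: "u \<in> shape t" using tu quasi_tilingD(5)[OF TB] by auto
      have "centre t \<in> B" using tu quasi_tilingD(4)[OF TB] by auto
      then have "\<sigma> s c = \<sigma> (s \<otimes> u) (centre t)"
        using u shL[OF tu(1)] s F(3) tu(3) unfolding B_def good_centres_def by auto
      then have "s \<otimes> u \<notin> shape t"
        using c quasi_tilingD(8)[OF TB tu(1), of "s \<otimes> u"] unfolding A_def by auto
      then show "c \<in> (\<Union>t\<in>T. (\<lambda>u. \<sigma> u (centre t)) ` {u\<in>shape t. s \<otimes> u \<notin> shape t})"
        using tu u by auto
    qed
    then have "card {c\<in>A. \<sigma> s c \<notin> A} \<le> card (\<Union>t\<in>T. (\<lambda>u. \<sigma> u (centre t)) ` {u\<in>shape t. s \<otimes> u \<notin> shape t})"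
      using quasi_tilingD(1,3)[OF TB] by (intro card_mono) auto
    also have "\<dots> \<le> (\<Sum>t\<in>T. card ((\<lambda>u. \<sigma> u (centre t)) ` {u\<in>shape t. s \<otimes> u \<notin> shape t}))"
      using quasi_tilingD(1)[OF TB] by (rule card_UN_le)
    also have "\<dots> \<le> (\<Sum>t\<in>T. card {u\<in>shape t. s \<otimes> u \<notin> shape t})"
      using quasi_tilingD(3)[OF TB] by (intro sum_mono card_image_le) auto
    finally have "card F * card {c\<in>A. \<sigma> s c \<notin> A} \<le> (\<Sum>t\<in>T. card F * card {u\<in>shape t. s \<otimes> u \<notin> shape t})"
      unfolding sum_distrib_left[symmetric] by simp
    then have "real (card F * card {c\<in>A. \<sigma> s c \<notin> A}) \<le> real (\<Sum>t\<in>T. card F * card {u\<in>shape t. s \<otimes> u \<notin> shape t})"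
      by (rule of_nat_mono)
    also have "\<dots> = (\<Sum>t\<in>T. real (card F * card {u\<in>shape t. s \<otimes> u \<notin> shape t}))" by simp
    also have "\<dots> \<le> (\<Sum>t\<in>T. \<gamma> * card (shape t))"
      using inv[OF _ s] by (intro sum_mono) 
    also have "\<dots> \<le> \<gamma> * (2 * real d)"
      unfolding sum_distrib_left[symmetric] using shsum \<gamma> by (rule mult_left_mono)
    finally show ?thesis using card_shift_diff[OF _ AV perm[of s]] s F(3) by auto
  qed
  define B0 where "B0 = {c\<in>B. \<forall>s\<in>F. \<sigma> s c \<notin> A}"
  define S where "S = (\<Union>s\<in>F. {c\<in>{1..d}. \<sigma> s c \<in> A \<and> c \<notin> A})"
  have "card F * card S \<le> card F * (\<Sum>s\<in>F. card {c\<in>{1..d}. \<sigma> s c \<in> A \<and> c \<notin> A})"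
    unfolding S_def using F(1) by (intro mult_left_mono card_UN_le) auto
  then have "real (card F * card S) \<le> real (card F * (\<Sum>s\<in>F. card {c\<in>{1..d}. \<sigma> s c \<in> A \<and> c \<notin> A}))"
    by (rule of_nat_mono)
  also have "\<dots> = (\<Sum>s\<in>F. real (card F * card {c\<in>{1..d}. \<sigma> s c \<in> A \<and> c \<notin> A}))"
    by (simp add: sum_distrib_left)
  also have "\<dots> \<le> (\<Sum>s\<in>F. \<gamma> * (2 * real d))" by (intro sum_mono bd)
  also have "\<dots> = card F * (2 * \<gamma> * d)" by simp
  finally have S: "card S \<le> 2 * \<gamma> * d" using F by (simp add: card_gt_0_iff)
  have "{1..d} \<subseteq> ({1..d} - B) \<union> A \<union> S \<union> B0"
    unfolding B0_def S_def by auto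
  then have "card {1..d} \<le> card (({1..d} - B) \<union> A \<union> S \<union> B0)"
    using fA finB by (intro card_mono) (auto simp: S_def B0_def F(1))
  also have "\<dots> \<le> card ({1..d} - B) + card A + card S + card B0"
    by (meson add_mono card_Un_le le_refl order_trans)
  finally have "real d \<le> card ({1..d} - B) + card A + card S + card B0" by simp
  then have B0: "real d - card A - (\<beta> + 2 * \<gamma>) * d \<le> card B0"
    using S B[folded B_def] by (simp add: algebra_simps)
  have finB0: "finite B0" unfolding B0_def using finB by auto
  have "card B0 * (\<eta> * card F) = (\<Sum>c\<in>B0. \<eta> * card F)" by simp
  also have "\<dots> \<le> (\<Sum>c\<in>B0. real (card {s\<in>F. \<sigma> s c \<in> A' - A}))"
  proof (intro sum_mono)
    fix c assume "c \<in> B0"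
    then have "{s\<in>F. \<sigma> s c \<in> A' - A} = {s\<in>F. \<sigma> s c \<in> A'}" "c \<in> B" by (auto simp: B0_def)
    then show "\<eta> * card F \<le> real (card {s\<in>F. \<sigma> s c \<in> A' - A})"
      using T'(4) A'_def by auto
  qed
  also have "\<dots> = real (\<Sum>c\<in>B0. card {s\<in>F. \<sigma> s c \<in> A' - A})" by simp
  also have "(\<Sum>c\<in>B0. card {s\<in>F. \<sigma> s c \<in> A' - A}) = (\<Sum>s\<in>F. card {c\<in>B0. \<sigma> s c \<in> A' - A})"
    by (rule sum_multicount_gen[OF finB0 F(1)]) simp
  also have "real (\<Sum>s\<in>F. card {c\<in>B0. \<sigma> s c \<in> A' - A}) \<le> real (\<Sum>s\<in>F. card (A' - A))"
  proof (intro of_nat_mono sum_mono)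
    fix s assume s: "s \<in> F"
    have "inj_on (\<sigma> s) {c\<in>B0. \<sigma> s c \<in> A' - A}"
      using permutes_inj[OF perm] s F(3) by (meson in_mono inj_on_subset subset_UNIV)
    then show "card {c\<in>B0. \<sigma> s c \<in> A' - A} \<le> card (A' - A)"
      using fA by (intro card_inj_on_le[of "\<sigma> s"]) auto
  qed
  also have "\<dots> = card F * card (A' - A)" by simp
  finally have "card F * (\<eta> * card B0) \<le> card F * real (card (A' - A))" by (simp add: mult_ac)
  then have "\<eta> * card B0 \<le> card (A' - A)" using F by (simp add: card_gt_0_iff)
  moreover have "card (A' - A) = real (card A') - card A"
    using T'(2) fA by (simp add: card_Diff_subset A_def A'_def of_nat_diff card_mono)
  moreover have "\<eta> * (real d - card A - (\<beta> + 2 * \<gamma>) * d) \<le> \<eta> * card B0"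
    using B0 \<eta> by (intro mult_left_mono) auto
  ultimately have "real d - card A' \<le> real d - card A - \<eta> * (real d - card A - (\<beta> + 2 * \<gamma>) * d)"
    by linarith
  also have "\<dots> = (1 - \<eta>) * (real d - card A) + \<eta> * ((\<beta> + 2 * \<gamma>) * d)"
    by (simp add: algebra_simps)
  finally show ?thesis using T' unfolding A'_def A_def B_def by blast
qed

lemma finite_set_mult:
  assumes "finite K" "finite F"
  shows "finite (K <#>\<^bsub>G\<^esub> F)"
  using assms unfolding set_mult_def by auto

lemma almost_invariant_mono:
  assumes "K \<subseteq> K'" "\<delta>' \<le> \<delta>" "finite K'"
  shows "almost_invariant G K' \<delta>' \<subseteq> almost_invariant G K \<delta>"
proof
  fix F assume F: "F \<in> almost_invariant G K' \<delta>'"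
  then have "finite F" by (auto simp: almost_invariant_def fin_subsets_def)
  have "(K <#>\<^bsub>G\<^esub> F) - F \<subseteq> (K' <#>\<^bsub>G\<^esub> F) - F"
    using assms(1) by (auto simp: set_mult_def)
  then have "card ((K <#>\<^bsub>G\<^esub> F) - F) \<le> card ((K' <#>\<^bsub>G\<^esub> F) - F)"
    using assms(3) \<open>finite F\<close> by (intro card_mono) (auto intro: finite_set_mult)
  moreover have "\<delta>' * card F \<le> \<delta> * card F" using assms(2) by (intro mult_right_mono) auto
  ultimately show "F \<in> almost_invariant G K \<delta>"
    using F by (auto simp: almost_invariant_def)
qed

lemma card_escape_le:
  fixes G (structure)
  assumes "group G" "K \<in> fin_subsets G" "s \<in> K" "F \<in> fin_subsets G"
  shows "card {u\<in>F. s \<otimes> u \<notin> F} \<le> card ((K <#> F) - F)"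
proof (rule card_inj_on_le[of "(\<otimes>) s"])
  interpret group G by fact
  show "inj_on ((\<otimes>) s) {u\<in>F. s \<otimes> u \<notin> F}"
    using assms by (intro inj_onI) (auto simp: fin_subsets_def subset_iff)
  show "(\<otimes>) s ` {u\<in>F. s \<otimes> u \<notin> F} \<subseteq> (K <#> F) - F"
    using assms by (auto simp: set_mult_def)
  show "finite ((K <#> F) - F)"
    using assms by (auto simp: fin_subsets_def intro: finite_set_mult)
qed

fun invariant_chain :: "('g, 'm) monoid_scheme \<Rightarrow> real \<Rightarrow> 'g set list \<Rightarrow> bool" where
  "invariant_chain G \<gamma> [] = True"
| "invariant_chain G \<gamma> (F # Fs) =
     ((\<forall>F'\<in>set Fs. \<forall>s\<in>F'. real (card F' * card {u\<in>F. s \<otimes>\<^bsub>G\<^esub> u \<notin> F}) \<le> \<gamma> * real (card F))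
      \<and> invariant_chain G \<gamma> Fs)"

lemma invariant_chain_exists:
  assumes "group G" "\<gamma> > 0"
    and cof: "\<And>K \<delta>. K \<in> fin_subsets G \<Longrightarrow> \<delta> > 0 \<Longrightarrow> \<F> \<inter> almost_invariant G K \<delta> \<noteq> {}"
  shows "\<exists>Fs. length Fs = n \<and> set Fs \<subseteq> \<F> \<inter> fin_subsets G \<and> invariant_chain G \<gamma> Fs"
proof (induction n)
  case 0
  show ?case by simp
next
  case (Suc n)
  interpret group G by fact
  obtain Fs where Fs: "length Fs = n" "set Fs \<subseteq> \<F> \<inter> fin_subsets G" "invariant_chain G \<gamma> Fs"
    using Suc by auto
  define K where "K = insert \<one>\<^bsub>G\<^esub> (\<Union>(set Fs))"
  define N where "N = (\<Sum>F\<in>set Fs. card F) + 1"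
  have \<gamma>N: "0 < \<gamma> / N" unfolding N_def using \<open>\<gamma> > 0\<close> by (intro divide_pos_pos) linarith+
  have K: "K \<in> fin_subsets G" using Fs(2) by (auto simp: K_def fin_subsets_def)
  obtain F where F: "F \<in> \<F>" "F \<in> almost_invariant G K (\<gamma> / N)"
    using cof[OF K \<gamma>N] by blast
  have F': "F \<in> fin_subsets G" "card ((K <#>\<^bsub>G\<^esub> F) - F) < \<gamma> / N * card F"
    using F(2) by (auto simp: almost_invariant_def)
  have "card F' * card {u\<in>F. s \<otimes>\<^bsub>G\<^esub> u \<notin> F} \<le> \<gamma> * card F" if "F' \<in> set Fs" "s \<in> F'" for F' s
  proof -
    have "card F' \<le> N" using that by (simp add: N_def member_le_sum le_SucI)
    moreover have "card {u\<in>F. s \<otimes>\<^bsub>G\<^esub> u \<notin> F} \<le> card ((K <#>\<^bsub>G\<^esub> F) - F)"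
      using that K F' by (intro card_escape_le[OF assms(1)]) (auto simp: K_def)
    ultimately have "real (card F' * card {u\<in>F. s \<otimes>\<^bsub>G\<^esub> u \<notin> F}) \<le> N * card ((K <#>\<^bsub>G\<^esub> F) - F)"
      by (intro of_nat_mono mult_mono) auto
    also have "\<dots> \<le> N * (\<gamma> / N * card F)"
      using F'(2) by (simp only: of_nat_mult) (intro mult_left_mono, auto)
    also have "\<dots> = \<gamma> * card F" using \<gamma>N by auto
    finally show ?thesis .
  qed
  then show ?case using Fs F(1) F'(1) by (intro exI[of _ "F # Fs"]) auto
qed

lemma chain_tiling:
  fixes d :: nat and \<beta> \<gamma> :: real and G (structure)
  assumes B: "real (card ({1..d} - good_centres G d \<sigma> L)) \<le> \<beta> * d"
    and \<eta>: "0 < \<eta>" "\<eta> \<le> 1/2" and \<gamma>: "0 \<le> \<gamma>"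
    and perm: "\<And>s. s \<in> L \<Longrightarrow> \<sigma> s permutes {1..d}"
    and "invariant_chain G \<gamma> Fs" "\<And>F. F \<in> set Fs \<Longrightarrow> finite F \<and> F \<noteq> {} \<and> F \<subseteq> L"
    and "quasi_tiling \<eta> \<sigma> (good_centres G d \<sigma> L) T" "\<And>t. t \<in> T \<Longrightarrow> shape t \<subseteq> L"
    and "\<And>t F s. t \<in> T \<Longrightarrow> F \<in> set Fs \<Longrightarrow> s \<in> F \<Longrightarrow>
      card F * card {u\<in>shape t. s \<otimes> u \<notin> shape t} \<le> \<gamma> * card (shape t)"
  shows "\<exists>T'. quasi_tiling \<eta> \<sigma> (good_centres G d \<sigma> L) T' \<and>
           shape ` T' \<subseteq> set Fs \<union> shape ` T \<and>
           real d - card (covered \<sigma> T') \<le> (1 - \<eta>) ^ length Fs * (real d - card (covered \<sigma> T))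
             + (1 - (1 - \<eta>) ^ length Fs) * ((\<beta> + 2 * \<gamma>) * d)"
  using assms(6-)
proof (induction Fs arbitrary: T)
  case Nil
  then show ?case by (intro exI[of _ T]) auto
next
  case (Cons F Fs)
  have F: "finite F" "F \<noteq> {}" "F \<subseteq> L" using Cons.prems(2) by auto
  obtain T1 where T1: "quasi_tiling \<eta> \<sigma> (good_centres G d \<sigma> L) T1"
      "shape ` T1 \<subseteq> insert F (shape ` T)"
      "real d - card (covered \<sigma> T1) \<le> (1 - \<eta>) * (real d - card (covered \<sigma> T)) + \<eta> * ((\<beta> + 2 * \<gamma>) * d)"
    using tiling_step[OF Cons.prems(3) B F \<eta> \<gamma> perm Cons.prems(4) Cons.prems(5)] by auto
  have sh: "shape t = F \<or> (\<exists>t'\<in>T. shape t = shape t')" if "t \<in> T1" for t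
    using T1(2) that by auto
  have "\<exists>T'. quasi_tiling \<eta> \<sigma> (good_centres G d \<sigma> L) T' \<and>
           shape ` T' \<subseteq> set Fs \<union> shape ` T1 \<and>
           real d - card (covered \<sigma> T') \<le> (1 - \<eta>) ^ length Fs * (real d - card (covered \<sigma> T1))
             + (1 - (1 - \<eta>) ^ length Fs) * ((\<beta> + 2 * \<gamma>) * d)"
  proof (rule Cons.IH[OF _ _ T1(1)])
    show "invariant_chain G \<gamma> Fs" using Cons.prems(1) by simp
    show "finite F' \<and> F' \<noteq> {} \<and> F' \<subseteq> L" if "F' \<in> set Fs" for F' using Cons.prems(2) that by simp
    show "shape t \<subseteq> L" if "t \<in> T1" for t using sh[OF that] F Cons.prems(4) by auto
    show "card F' * card {u\<in>shape t. s \<otimes> u \<notin> shape t} \<le> \<gamma> * card (shape t)"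
      if t: "t \<in> T1" and "F' \<in> set Fs" "s \<in> F'" for t F' s
      using sh[OF t]
    proof
      assume "shape t = F"
      then show ?thesis using Cons.prems(1) that by simp
    next
      assume "\<exists>t'\<in>T. shape t = shape t'"
      then obtain t' where "t' \<in> T" "shape t = shape t'" by blast
      then show ?thesis using Cons.prems(5)[of t' F' s] that by simp
    qed
  qed
  then obtain T' where T': "quasi_tiling \<eta> \<sigma> (good_centres G d \<sigma> L) T'"
      "shape ` T' \<subseteq> set Fs \<union> shape ` T1"
      "real d - card (covered \<sigma> T') \<le> (1 - \<eta>) ^ length Fs * (real d - card (covered \<sigma> T1))
         + (1 - (1 - \<eta>) ^ length Fs) * ((\<beta> + 2 * \<gamma>) * d)" by blast
  have "(1 - \<eta>) ^ length Fs * (real d - card (covered \<sigma> T1)) \<le>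
      (1 - \<eta>) ^ length Fs * ((1 - \<eta>) * (real d - card (covered \<sigma> T)) + \<eta> * ((\<beta> + 2 * \<gamma>) * d))"
    using T1(3) \<eta> by (intro mult_left_mono) auto
  then have "real d - card (covered \<sigma> T') \<le> (1 - \<eta>) ^ length (F # Fs) * (real d - card (covered \<sigma> T))
         + (1 - (1 - \<eta>) ^ length (F # Fs)) * ((\<beta> + 2 * \<gamma>) * d)"
    using T'(3) by (simp add: algebra_simps)
  then show ?case using T' T1(2) by (intro exI[of _ T']) auto
qed

lemma eventually_card_complement_le:
  fixes d :: "nat \<Rightarrow> nat" and \<beta> :: real
  assumes "(\<lambda>i. real (card {v\<in>{1..d i}. P i v}) / real (d i)) \<longlonglongrightarrow> 1"
    and "filterlim d at_top sequentially" "0 < \<beta>"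
  shows "\<forall>\<^sub>F i in sequentially. real (card {v\<in>{1..d i}. \<not> P i v}) \<le> \<beta> * d i"
proof -
  have "\<forall>\<^sub>F i in sequentially. 1 \<le> d i" using assms(2) by (simp add: filterlim_at_top)
  moreover have "\<forall>\<^sub>F i in sequentially. 1 - \<beta> < real (card {v\<in>{1..d i}. P i v}) / real (d i)"
    using order_tendstoD(1)[OF assms(1), of "1 - \<beta>"] assms(3) by simp
  ultimately show ?thesis
  proof eventually_elim
    case (elim i)
    have "{1..d i} = {v\<in>{1..d i}. P i v} \<union> {v\<in>{1..d i}. \<not> P i v}" by auto
    then have "card {1..d i} = card {v\<in>{1..d i}. P i v} + card {v\<in>{1..d i}. \<not> P i v}"
      by (metis (no_types, lifting) card_Un_disjoint finite_Un finite_atLeastAtMost disjoint_iff mem_Collect_eq)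
    then have "real (d i) = real (card {v\<in>{1..d i}. P i v}) + real (card {v\<in>{1..d i}. \<not> P i v})"
      by simp
    then show ?case using elim by (simp add: field_simps)
  qed
qed

lemma sofic_good_centres:
  fixes \<beta> :: real
  assumes "sofic_approximation G d \<sigma>" "group G" "finite L" "L \<subseteq> carrier G" "0 < \<beta>"
  shows "\<forall>\<^sub>F i in sequentially.
    real (card ({1..d i} - good_centres G (d i) (\<sigma> i) L)) \<le> \<beta> * d i"
proof -
  define N where "N = 2 * card (L \<times> L) + 1"
  have d: "filterlim d at_top sequentially" using assms(1) by (simp add: sofic_approximation_def)
  define P where "P p i v \<longleftrightarrow> \<sigma> i (fst p) (\<sigma> i (snd p) v) = \<sigma> i (fst p \<otimes>\<^bsub>G\<^esub> snd p) v" for p i v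
  define Q where "Q p i v \<longleftrightarrow> fst p = snd p \<or> \<sigma> i (fst p) v \<noteq> \<sigma> i (snd p) v" for p i v
  have \<beta>N: "0 < \<beta> / N" using assms(5) by (simp add: N_def)
  have "\<forall>\<^sub>F i in sequentially. \<forall>p\<in>L \<times> L. real (card {v\<in>{1..d i}. \<not> P p i v}) \<le> \<beta> / N * d i"
  proof (intro eventually_ball_finite ballI)
    fix p assume "p \<in> L \<times> L"
    then have "fst p \<in> carrier G" "snd p \<in> carrier G" using assms(4) by auto
    then show "\<forall>\<^sub>F i in sequentially. real (card {v\<in>{1..d i}. \<not> P p i v}) \<le> \<beta> / N * d i"
      using assms(1) unfolding sofic_approximation_def P_def
      by (intro eventually_card_complement_le[OF _ d \<beta>N]) blast
  qed (use assms in auto)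
  moreover have "\<forall>\<^sub>F i in sequentially. \<forall>p\<in>L \<times> L. real (card {v\<in>{1..d i}. \<not> Q p i v}) \<le> \<beta> / N * d i"
  proof (intro eventually_ball_finite ballI)
    fix p assume p: "p \<in> L \<times> L"
    show "\<forall>\<^sub>F i in sequentially. real (card {v\<in>{1..d i}. \<not> Q p i v}) \<le> \<beta> / N * d i"
    proof (cases "fst p = snd p")
      case True
      have "0 \<le> \<beta> / N * d i" for i using \<beta>N by (intro mult_nonneg_nonneg) auto
      with True show ?thesis by (intro always_eventually allI) (simp add: Q_def)
    next
      case False
      moreover have "fst p \<in> carrier G" "snd p \<in> carrier G" using p assms(4) by auto
      ultimately have "(\<lambda>i. real (card {v\<in>{1..d i}. Q p i v}) / real (d i)) \<longlonglongrightarrow> 1"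
        using assms(1) unfolding sofic_approximation_def Q_def by simp
      then show ?thesis by (rule eventually_card_complement_le[OF _ d \<beta>N])
    qed
  qed (use assms in auto)
  ultimately show ?thesis
  proof eventually_elim
    case (elim i)
    have "{1..d i} - good_centres G (d i) (\<sigma> i) L \<subseteq>
        (\<Union>p\<in>L \<times> L. {v\<in>{1..d i}. \<not> P p i v}) \<union> (\<Union>p\<in>L \<times> L. {v\<in>{1..d i}. \<not> Q p i v})"
      unfolding good_centres_def inj_on_def P_def Q_def by fastforce
    then have "card ({1..d i} - good_centres G (d i) (\<sigma> i) L) \<le>
        card ((\<Union>p\<in>L \<times> L. {v\<in>{1..d i}. \<not> P p i v}) \<union> (\<Union>p\<in>L \<times> L. {v\<in>{1..d i}. \<not> Q p i v}))"
      using assms(3) by (intro card_mono) auto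
    also have "\<dots> \<le> (\<Sum>p\<in>L \<times> L. card {v\<in>{1..d i}. \<not> P p i v}) + (\<Sum>p\<in>L \<times> L. card {v\<in>{1..d i}. \<not> Q p i v})"
      using assms(3) by (intro order_trans[OF card_Un_le] add_mono card_UN_le) auto
    finally have "real (card ({1..d i} - good_centres G (d i) (\<sigma> i) L)) \<le>
        real ((\<Sum>p\<in>L \<times> L. card {v\<in>{1..d i}. \<not> P p i v}) + (\<Sum>p\<in>L \<times> L. card {v\<in>{1..d i}. \<not> Q p i v}))"
      by (rule of_nat_mono)
    also have "\<dots> = (\<Sum>p\<in>L \<times> L. real (card {v\<in>{1..d i}. \<not> P p i v})) + (\<Sum>p\<in>L \<times> L. real (card {v\<in>{1..d i}. \<not> Q p i v}))"
      by simp
    also have "\<dots> \<le> (\<Sum>p\<in>L \<times> L. \<beta> / N * d i) + (\<Sum>p\<in>L \<times> L. \<beta> / N * d i)"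
      using elim by (intro add_mono sum_mono) auto
    also have "\<dots> = 2 * real (card (L \<times> L)) * (\<beta> / N * d i)" by simp
    also have "\<dots> \<le> N * (\<beta> / N * d i)"
    proof (rule mult_right_mono)
      show "2 * real (card (L \<times> L)) \<le> N" by (simp add: N_def)
      show "0 \<le> \<beta> / N * d i" using \<beta>N by (intro mult_nonneg_nonneg) auto
    qed
    also have "\<dots> = \<beta> * d i" using \<beta>N by auto
    finally show ?case .
  qed
qed

lemma sofic_quasi_tiling:
  fixes \<zeta> :: real
  assumes "group G" "sofic_approximation G d \<sigma>"
    and cof: "\<And>K \<delta>. K \<in> fin_subsets G \<Longrightarrow> \<delta> > 0 \<Longrightarrow> \<F> \<inter> almost_invariant G K \<delta> \<noteq> {}"
    and \<eta>: "0 < \<eta>" "\<eta> \<le> 1/2" and "0 < \<zeta>"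
  obtains FF where "finite FF" "FF \<subseteq> \<F> \<inter> fin_subsets G"
    "\<And>L. finite L \<Longrightarrow> L \<subseteq> carrier G \<Longrightarrow> \<Union>FF \<subseteq> L \<Longrightarrow>
      \<forall>\<^sub>F i in sequentially. \<exists>T. quasi_tiling \<eta> (\<sigma> i) (good_centres G (d i) (\<sigma> i) L) T \<and>
        shape ` T \<subseteq> FF \<and> real (d i) - card (covered (\<sigma> i) T) \<le> \<zeta> * d i"
proof -
  obtain n where n: "(1 - \<eta>) ^ n < \<zeta> / 3"
    using real_arch_pow_inv[of "\<zeta> / 3" "1 - \<eta>"] \<eta> \<open>0 < \<zeta>\<close> by auto
  obtain Fs where Fs: "length Fs = n" "set Fs \<subseteq> \<F> \<inter> fin_subsets G" "invariant_chain G (\<zeta> / 6) Fs"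
    using invariant_chain_exists[OF assms(1) _ cof, of "\<zeta> / 6" n] \<open>0 < \<zeta>\<close> by auto
  show ?thesis
  proof (rule that[of "set Fs"])
    fix L assume L: "finite L" "L \<subseteq> carrier G" "\<Union>(set Fs) \<subseteq> L"
    show "\<forall>\<^sub>F i in sequentially. \<exists>T. quasi_tiling \<eta> (\<sigma> i) (good_centres G (d i) (\<sigma> i) L) T \<and>
        shape ` T \<subseteq> set Fs \<and> real (d i) - card (covered (\<sigma> i) T) \<le> \<zeta> * d i"
      using sofic_good_centres[OF assms(2,1) L(1,2), of "\<zeta> / 3"] \<open>0 < \<zeta>\<close>
    proof (rule eventually_mono[OF meta_mp])
      fix i assume B: "real (card ({1..d i} - good_centres G (d i) (\<sigma> i) L)) \<le> \<zeta> / 3 * d i"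
      have "\<exists>T'. quasi_tiling \<eta> (\<sigma> i) (good_centres G (d i) (\<sigma> i) L) T' \<and>
           shape ` T' \<subseteq> set Fs \<union> shape ` ({} :: ('a, nat) tile set) \<and>
           real (d i) - card (covered (\<sigma> i) T') \<le> (1 - \<eta>) ^ length Fs * (real (d i) - card (covered (\<sigma> i) ({} :: ('a, nat) tile set)))
             + (1 - (1 - \<eta>) ^ length Fs) * ((\<zeta> / 3 + 2 * (\<zeta> / 6)) * d i)"
      proof (rule chain_tiling[OF B \<eta> _ _ Fs(3)])
        show "0 \<le> \<zeta> / 6" using \<open>0 < \<zeta>\<close> by simp
        show "\<sigma> i s permutes {1..d i}" if "s \<in> L" for s
          using that L(2) assms(2) by (auto simp: sofic_approximation_def)
        show "finite F \<and> F \<noteq> {} \<and> F \<subseteq> L" if "F \<in> set Fs" for F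
          using that Fs(2) L(3) by (auto simp: fin_subsets_def)
      qed (auto simp: quasi_tiling_def disjoint_family_on_def)
      then obtain T where T: "quasi_tiling \<eta> (\<sigma> i) (good_centres G (d i) (\<sigma> i) L) T" "shape ` T \<subseteq> set Fs"
        "real (d i) - card (covered (\<sigma> i) T) \<le> (1 - \<eta>) ^ n * (real (d i))
             + (1 - (1 - \<eta>) ^ n) * ((\<zeta> / 3 + 2 * (\<zeta> / 6)) * d i)"
        using Fs(1) by (auto simp: covered_def)
      have "(1 - (1 - \<eta>) ^ n) * ((\<zeta> / 3 + 2 * (\<zeta> / 6)) * d i) \<le> 1 * ((\<zeta> / 3 + 2 * (\<zeta> / 6)) * d i)"
        using \<eta> \<open>0 < \<zeta>\<close> by (intro mult_right_mono) auto
      moreover have eqd: "\<zeta> * d i = \<zeta> / 3 * d i + 1 * ((\<zeta> / 3 + 2 * (\<zeta> / 6)) * d i)"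
        by (simp add: field_simps)
      moreover have "(1 - \<eta>) ^ n * d i \<le> \<zeta> / 3 * d i" using n by (intro mult_right_mono) auto
      ultimately have "real (d i) - card (covered (\<sigma> i) T) \<le> \<zeta> * d i"
        using T(3) eqd by linarith
      then show "\<exists>T. quasi_tiling \<eta> (\<sigma> i) (good_centres G (d i) (\<sigma> i) L) T \<and>
        shape ` T \<subseteq> set Fs \<and> real (d i) - card (covered (\<sigma> i) T) \<le> \<zeta> * d i"
        using T by blast
    qed auto
  qed (use Fs in auto)
qed

subsection \<open>Counting and compactness\<close>

lemma elog_max_card_le_iff:
  "elog (max_card P) \<le> ereal c \<longleftrightarrow> (\<forall>E. finite E \<longrightarrow> P E \<longrightarrow> card E \<le> exp c)"
proof
  assume L: "elog (max_card P) \<le> ereal c"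
  show "\<forall>E. finite E \<longrightarrow> P E \<longrightarrow> card E \<le> exp c"
  proof (intro allI impI)
    fix E assume "finite E" "P E"
    then have le: "enat (card E) \<le> max_card P" unfolding max_card_def by (intro SUP_upper) auto
    obtain k where k: "max_card P = enat k" using L by (cases "max_card P") (auto simp: elog_def)
    show "card E \<le> exp c"
    proof (cases "card E = 0")
      case False
      then have "card E \<le> k" "k > 0" using le k by auto
      moreover have "ln k \<le> c" using L k \<open>k > 0\<close> by (simp add: elog_def)
      then have "k \<le> exp c" using \<open>k > 0\<close> by (metis exp_le_cancel_iff exp_ln of_nat_0_less_iff)
      ultimately show ?thesis using order_trans of_nat_le_iff by blast
    qed simp
  qed
next
  assume R: "\<forall>E. finite E \<longrightarrow> P E \<longrightarrow> card E \<le> exp c"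
  have "max_card P \<le> enat (nat \<lfloor>exp c\<rfloor>)"
    unfolding max_card_def
  proof (rule SUP_least)
    fix E assume "E \<in> {E. finite E \<and> P E}"
    then have "real (card E) \<le> exp c" using R by auto
    then have "int (card E) \<le> \<lfloor>exp c\<rfloor>" by (simp add: le_floor_iff)
    then show "enat (card E) \<le> enat (nat \<lfloor>exp c\<rfloor>)" by simp
  qed
  then obtain k where k: "max_card P = enat k" "k \<le> nat \<lfloor>exp c\<rfloor>"
    by (cases "max_card P") auto
  show "elog (max_card P) \<le> ereal c"
  proof (cases "k = 0")
    case False
    have "real k \<le> exp c" using k(2) by (simp add: le_nat_iff le_floor_iff)
    then have "ln k \<le> c" using False by (metis exp_gt_zero ln_exp ln_le_cancel_iff neq0_conv of_nat_0_less_iff)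
    then show ?thesis using k False by (simp add: elog_def)
  qed (simp add: k elog_def)
qed

lemma elog_max_card_ge:
  assumes "finite E" "P E" "exp c \<le> card E"
  shows "ereal c \<le> elog (max_card P)"
proof (rule ccontr)
  assume "\<not> ereal c \<le> elog (max_card P)"
  then have "elog (max_card P) < ereal c" by simp
  then obtain b where b: "elog (max_card P) < ereal b" "b < c"
    by (metis ereal_dense2 less_ereal.simps(1))
  then have "card E \<le> exp b" using assms elog_max_card_le_iff[of P b] by (simp add: less_imp_le)
  also have "\<dots> < exp c" using b by simp
  finally show False using assms by simp
qed

lemma less_elog_max_card:
  assumes "ereal c < elog (max_card P)"
  shows "\<exists>E. finite E \<and> P E \<and> exp c < card E"
proof (rule ccontr)
  assume "\<not> ?thesis"
  then have "elog (max_card P) \<le> ereal c"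
    unfolding elog_max_card_le_iff using not_le by blast
  then show False using assms by simp
qed

lemma compact_uniformly_positive:
  assumes "compactin Z K" "\<And>i. i \<in> I \<Longrightarrow> continuous_map Z euclideanreal (f i)"
    and "\<And>z. z \<in> K \<Longrightarrow> \<exists>i\<in>I. 0 < f i z"
  shows "\<exists>J \<theta>. finite J \<and> J \<subseteq> I \<and> (0::real) < \<theta> \<and> (\<forall>z\<in>K. \<exists>i\<in>J. \<theta> < f i z)"
proof -
  define U where "U = (\<lambda>(i, n). {z\<in>topspace Z. f i z \<in> {1 / real (Suc n)<..}})"
  have "openin Z u" if "u \<in> U ` (I \<times> UNIV)" for u
    using that assms(2) unfolding U_def
    by (auto simp del: greaterThan_iff intro!: openin_continuous_map_preimage)
  moreover have "K \<subseteq> \<Union>(U ` (I \<times> UNIV))"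
  proof
    fix z assume z: "z \<in> K"
    then obtain i where i: "i \<in> I" "0 < f i z" using assms(3) by auto
    then obtain n where "1 / real (Suc n) < f i z" using nat_approx_posE by blast
    moreover have "z \<in> topspace Z" using z assms(1) compactin_subset_topspace by blast
    ultimately show "z \<in> \<Union>(U ` (I \<times> UNIV))" using i by (auto simp: U_def)
  qed
  ultimately obtain \<F> where \<F>: "finite \<F>" "\<F> \<subseteq> U ` (I \<times> UNIV)" "K \<subseteq> \<Union>\<F>"
    using compactinD[OF assms(1), of "U ` (I \<times> UNIV)"] by auto
  then obtain S where S: "S \<subseteq> I \<times> UNIV" "finite S" "\<F> = U ` S"
    using finite_subset_image[OF \<F>(1,2)] by auto
  define N where "N = Max (insert 0 (snd ` S))"
  show ?thesis
  proof (intro exI conjI ballI)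
    show "finite (fst ` S)" "fst ` S \<subseteq> I" using S by auto
    show "0 < 1 / real (Suc N)" by simp
    fix z assume "z \<in> K"
    then obtain i n where "(i, n) \<in> S" "1 / real (Suc n) < f i z" using \<F>(3) S by (auto simp: U_def)
    moreover have "n \<le> N" unfolding N_def using \<open>(i, n) \<in> S\<close> S by (intro Max_ge) force+
    then have "1 / real (Suc N) \<le> 1 / real (Suc n)" by (intro divide_left_mono) auto
    ultimately show "\<exists>i\<in>fst ` S. 1 / real (Suc N) < f i z" by force
  qed
qed

lemma continuous_pseudometricD:
  assumes "continuous_pseudometric X \<rho>"
  shows "\<And>x. x \<in> topspace X \<Longrightarrow> \<rho> x x = 0"
    "\<And>x y. x \<in> topspace X \<Longrightarrow> y \<in> topspace X \<Longrightarrow> 0 \<le> \<rho> x y"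
    "\<And>x y. x \<in> topspace X \<Longrightarrow> y \<in> topspace X \<Longrightarrow> \<rho> x y = \<rho> y x"
    "\<And>x y z. x \<in> topspace X \<Longrightarrow> y \<in> topspace X \<Longrightarrow> z \<in> topspace X \<Longrightarrow> \<rho> x z \<le> \<rho> x y + \<rho> y z"
  using assms unfolding continuous_pseudometric_def by blast+

lemma continuous_map_pseudometric:
  assumes "continuous_pseudometric X \<rho>" "continuous_map Z X f" "continuous_map Z X g"
  shows "continuous_map Z euclideanreal (\<lambda>z. \<rho> (f z) (g z))"
proof -
  have "continuous_map Z (prod_topology X X) (\<lambda>z. (f z, g z))"
    using assms(2,3) by (simp add: continuous_map_pairwise o_def)
  then have "continuous_map Z euclideanreal ((\<lambda>(x, y). \<rho> x y) \<circ> (\<lambda>z. (f z, g z)))"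
    using assms(1) unfolding continuous_pseudometric_def by (metis continuous_map_compose)
  then show ?thesis by (simp add: o_def)
qed

lemma pseudometric_net:
  assumes "compact_space X" "continuous_pseudometric X \<rho>" "0 < \<epsilon>"
  obtains P where "finite P" "P \<subseteq> topspace X" "\<And>x. x \<in> topspace X \<Longrightarrow> \<exists>p\<in>P. \<rho> p x < \<epsilon>"
proof -
  define U where "U = (\<lambda>p. {x\<in>topspace X. \<rho> p x \<in> {..<\<epsilon>}})"
  have "openin X u" if "u \<in> U ` topspace X" for u
    using that unfolding U_def
    by (auto simp del: lessThan_iff intro!: openin_continuous_map_preimage
        continuous_map_pseudometric[OF assms(2)])
  moreover have "topspace X \<subseteq> \<Union>(U ` topspace X)"
    using assms(3) continuous_pseudometricD(1)[OF assms(2)] by (auto simp: U_def)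
  ultimately obtain \<F> where "finite \<F>" "\<F> \<subseteq> U ` topspace X" "topspace X \<subseteq> \<Union>\<F>"
    using compactinD[of X "topspace X" "U ` topspace X"] assms(1) unfolding compact_space_def by auto
  then obtain P where "P \<subseteq> topspace X" "finite P" "\<F> = U ` P"
    using finite_subset_image by metis
  then show ?thesis using \<open>topspace X \<subseteq> \<Union>\<F>\<close> by (intro that[of P]) (auto simp: U_def)
qed

lemma pseudometric_bounded:
  assumes "compact_space X" "continuous_pseudometric X \<rho>"
  obtains D where "\<And>x y. x \<in> topspace X \<Longrightarrow> y \<in> topspace X \<Longrightarrow> \<rho> x y \<le> D"
proof -
  have "compactin (prod_topology X X) (topspace (prod_topology X X))"
    using assms(1) compact_space_prod_topology[of X X] unfolding compact_space_def by blast
  then have "compact ((\<lambda>(x, y). \<rho> x y) ` topspace (prod_topology X X))"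
    using image_compactin assms(2) unfolding continuous_pseudometric_def
    by (metis compactin_euclidean_iff)
  then have "bounded ((\<lambda>(x, y). \<rho> x y) ` topspace (prod_topology X X))"
    by (rule compact_imp_bounded)
  then obtain D where "\<And>z. z \<in> (\<lambda>(x, y). \<rho> x y) ` topspace (prod_topology X X) \<Longrightarrow> norm z \<le> D"
    unfolding bounded_iff by blast
  then have "norm (\<rho> x y) \<le> D" if "x \<in> topspace X" "y \<in> topspace X" for x y
    using that by force
  then have "\<rho> x y \<le> D" if "x \<in> topspace X" "y \<in> topspace X" for x y
    using that by (metis abs_le_iff real_norm_def)
  then show ?thesis by (rule that)
qed

lemma separated_net:
  assumes "elog (N_sep \<epsilon> K \<rho>) \<le> ereal c"
    and sym: "\<And>x y. x \<in> K \<Longrightarrow> y \<in> K \<Longrightarrow> \<rho> x y = \<rho> y x"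
  obtains P where "finite P" "P \<subseteq> K" "card P \<le> exp c" "\<And>x. x \<in> K \<Longrightarrow> x \<notin> P \<Longrightarrow> \<exists>p\<in>P. \<rho> p x < \<epsilon>"
proof -
  define S where "S E \<longleftrightarrow> E \<subseteq> K \<and> (\<forall>z\<^sub>1\<in>E. \<forall>z\<^sub>2\<in>E. z\<^sub>1 \<noteq> z\<^sub>2 \<longrightarrow> \<epsilon> \<le> \<rho> z\<^sub>1 z\<^sub>2)" for E
  have le: "card E \<le> exp c" if "finite E" "S E" for E
  proof -
    have "\<forall>E. finite E \<longrightarrow> S E \<longrightarrow> card E \<le> exp c"
      using assms(1) unfolding N_sep_def elog_max_card_le_iff S_def .
    then show ?thesis using that by simp
  qed
  then have le': "card E \<le> nat \<lfloor>exp c\<rfloor>" if "finite E" "S E" for E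
    using that by (simp add: le_nat_iff le_floor_iff)
  have "finite {} \<and> S {}" by (simp add: S_def)
  then have "\<exists>P. (finite P \<and> S P) \<and> (\<forall>E. finite E \<and> S E \<longrightarrow> card E \<le> card P)"
    by (rule ex_has_greatest_nat[where b = "Suc (nat \<lfloor>exp c\<rfloor>)"]) (use le' in \<open>auto simp: less_Suc_eq_le\<close>)
  then obtain P where P: "finite P \<and> S P" "\<And>E. finite E \<and> S E \<Longrightarrow> card E \<le> card P"
    by blast
  show ?thesis
  proof (rule that[of P])
    fix x assume x: "x \<in> K" "x \<notin> P"
    show "\<exists>p\<in>P. \<rho> p x < \<epsilon>"
    proof (rule ccontr)
      assume "\<not> (\<exists>p\<in>P. \<rho> p x < \<epsilon>)"
      then have ge: "\<epsilon> \<le> \<rho> p x" "\<epsilon> \<le> \<rho> x p" if "p \<in> P" for p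
        using that P(1) x(1) sym[of p x] by (auto simp: S_def not_less subset_iff)
      have "S (insert x P)" unfolding S_def
      proof (intro conjI ballI impI)
        show "insert x P \<subseteq> K" using P(1) x(1) by (simp add: S_def)
        fix z1 z2 assume z: "z1 \<in> insert x P" "z2 \<in> insert x P" "z1 \<noteq> z2"
        show "\<epsilon> \<le> \<rho> z1 z2"
        proof (cases "z1 = x \<or> z2 = x")
          case True
          then show ?thesis using z ge by blast
        next
          case False
          then show ?thesis using z P(1) by (simp add: S_def)
        qed
      qed
      then show False using P(2)[of "insert x P"] P(1) x by auto
    qed
  qed (use P le in \<open>auto simp: S_def\<close>)
qed

lemma card_small_subsets_le:
  fixes \<kappa> :: real
  assumes "0 < \<kappa>"
  obtains \<beta>0 where "0 < \<beta>0"
    "\<And>\<beta> d. \<beta> \<le> \<beta>0 \<Longrightarrow> card {B. B \<subseteq> {1..d} \<and> real (card B) \<le> \<beta> * real d} \<le> exp (\<kappa> * real d)"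
proof -
  define x where "x = min (\<kappa> / 2) (1 / 2)"
  have x: "0 < x" "x < 1" "x \<le> \<kappa> / 2" using assms by (auto simp: x_def min_def)
  define \<beta>0 where "\<beta>0 = \<kappa> / 2 / (- ln x)"
  have lnx: "- ln x > 0" using x by simp
  show ?thesis
  proof (rule that[of \<beta>0])
    show "0 < \<beta>0" unfolding \<beta>0_def using assms lnx by (intro divide_pos_pos) auto
    fix \<beta> and d :: nat assume \<beta>: "\<beta> \<le> \<beta>0"
    let ?S = "{B. B \<subseteq> {1..d} \<and> real (card B) \<le> \<beta> * d}"
    have "exp (- (\<kappa> / 2 * d)) \<le> x ^ card B" if "B \<in> ?S" for B
    proof -
      have "real (card B) \<le> \<beta>0 * d" using that mult_right_mono[OF \<beta>, of "real d"] by auto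
      then have "real (card B) * (- ln x) \<le> \<beta>0 * d * (- ln x)" using lnx by (intro mult_right_mono) auto
      also have "\<dots> = \<kappa> / 2 * d" using lnx by (simp add: \<beta>0_def)
      finally have "- (\<kappa> / 2 * d) \<le> real (card B) * ln x" by simp
      then have "exp (- (\<kappa> / 2 * d)) \<le> exp (real (card B) * ln x)" by simp
      also have "\<dots> = x ^ card B" using x by (simp add: exp_of_nat_mult)
      finally show ?thesis .
    qed
    then have "(\<Sum>B\<in>?S. exp (- (\<kappa> / 2 * d))) \<le> (\<Sum>B\<in>?S. x ^ card B)" by (intro sum_mono)
    also have "\<dots> \<le> (\<Sum>B\<in>Pow {1..d}. x ^ card B)" using x by (intro sum_mono2) auto
    also have "\<dots> = (\<Sum>B\<in>Pow {1..d}. (\<Prod>i\<in>B. x) * (\<Prod>i\<in>{1..d} - B. 1))" by simp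
    also have "\<dots> = (\<Prod>i\<in>{1..d}. x + 1)" by (subst prod_add) auto
    also have "\<dots> = (1 + x) ^ d" by (simp add: add.commute)
    also have "\<dots> \<le> exp x ^ d" using x exp_ge_add_one_self[of x] by (intro power_mono) auto
    also have "\<dots> = exp (d * x)" by (simp add: exp_of_nat_mult)
    also have "\<dots> \<le> exp (\<kappa> / 2 * d)" using mult_right_mono[OF x(3), of "real d"] by (simp add: mult.commute)
    finally have "card ?S * exp (- (\<kappa> / 2 * d)) \<le> exp (\<kappa> / 2 * d)" by simp
    then have "card ?S \<le> exp (\<kappa> / 2 * d) * exp (\<kappa> / 2 * d)"
      by (simp add: exp_minus field_simps)
    then show "card ?S \<le> exp (\<kappa> * d)" by (simp flip: exp_add)
  qed
qed

lemma rho_infty_le_iff: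
  assumes "0 < d"
  shows "rho_infty d \<rho> \<phi> \<psi> \<le> \<theta> \<longleftrightarrow> (\<forall>v\<in>{1..d}. \<rho> (\<phi> v) (\<psi> v) \<le> \<theta>)"
  unfolding rho_infty_def using assms by (subst Max_le_iff) auto

lemma rho_infty_ge_iff:
  assumes "0 < d"
  shows "\<theta> \<le> rho_infty d \<rho> \<phi> \<psi> \<longleftrightarrow> (\<exists>v\<in>{1..d}. \<theta> \<le> \<rho> (\<phi> v) (\<psi> v))"
  unfolding rho_infty_def using assms by (subst Max_ge_iff) auto

lemma rho_two_exceptional:
  fixes \<delta> \<tau> :: real
  assumes "rho_two d \<rho> \<phi> \<psi> \<le> \<delta>" "0 < \<tau>" "\<And>v. v \<in> {1..d} \<Longrightarrow> 0 \<le> \<rho> (\<phi> v) (\<psi> v)"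
  shows "card {v\<in>{1..d}. \<tau> < \<rho> (\<phi> v) (\<psi> v)} * \<tau>\<^sup>2 \<le> \<delta>\<^sup>2 * d"
proof (cases "d = 0")
  case False
  have "1 / real d * (\<Sum>v\<in>{1..d}. (\<rho> (\<phi> v) (\<psi> v))\<^sup>2) \<le> \<delta>\<^sup>2"
    using assms(1) unfolding rho_two_def by (rule sqrt_le_D)
  then have le: "(\<Sum>v\<in>{1..d}. (\<rho> (\<phi> v) (\<psi> v))\<^sup>2) \<le> \<delta>\<^sup>2 * d" using False by (simp add: field_simps)
  have "card {v\<in>{1..d}. \<tau> < \<rho> (\<phi> v) (\<psi> v)} * \<tau>\<^sup>2 = (\<Sum>v\<in>{v\<in>{1..d}. \<tau> < \<rho> (\<phi> v) (\<psi> v)}. \<tau>\<^sup>2)" by simp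
  also have "\<dots> \<le> (\<Sum>v\<in>{v\<in>{1..d}. \<tau> < \<rho> (\<phi> v) (\<psi> v)}. (\<rho> (\<phi> v) (\<psi> v))\<^sup>2)"
    using assms(2) by (intro sum_mono power_mono) auto
  also have "\<dots> \<le> (\<Sum>v\<in>{1..d}. (\<rho> (\<phi> v) (\<psi> v))\<^sup>2)" by (intro sum_mono2) auto
  finally show ?thesis using le by simp
qed simp

subsection \<open>Factor maps\<close>

locale factor_setting =
  fixes G :: "('g, 'm) monoid_scheme" (structure)
    and X :: "'x topology" and actX :: "'g \<Rightarrow> 'x \<Rightarrow> 'x"
    and Y :: "'y topology" and actY :: "'g \<Rightarrow> 'y \<Rightarrow> 'y"
    and \<pi> :: "'x \<Rightarrow> 'y"
    and \<rho>X :: "'x \<Rightarrow> 'x \<Rightarrow> real" and \<rho>Y :: "'y \<Rightarrow> 'y \<Rightarrow> real"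
  assumes grp: "group G"
    and dynX: "dynamical_system G X actX" and dynY: "dynamical_system G Y actY"
    and factor: "factor_map G X actX Y actY \<pi>"
    and psX: "continuous_pseudometric X \<rho>X" and genX: "dynamically_generating G X actX \<rho>X"
    and psY: "continuous_pseudometric Y \<rho>Y" and genY: "dynamically_generating G Y actY \<rho>Y"
begin

definition fibre_dist :: "'x \<Rightarrow> 'x \<Rightarrow> real" where
  "fibre_dist x x' = \<rho>Y (\<pi> x) (\<pi> x')"

lemma compact: "compact_space X"
  using dynX by (simp add: dynamical_system_def)

lemma act_closed: "s \<in> carrier G \<Longrightarrow> x \<in> topspace X \<Longrightarrow> actX s x \<in> topspace X"
  using dynX group_action.element_image unfolding dynamical_system_def by metis

lemma act_mult:
  "s \<in> carrier G \<Longrightarrow> t \<in> carrier G \<Longrightarrow> x \<in> topspace X \<Longrightarrow> actX (s \<otimes> t) x = actX s (actX t x)"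
  using dynX group_action.composition_rule unfolding dynamical_system_def by metis

lemma act_continuous: "s \<in> carrier G \<Longrightarrow> continuous_map X X (actX s)"
  using dynX by (simp add: dynamical_system_def)

lemma \<pi>_closed: "x \<in> topspace X \<Longrightarrow> \<pi> x \<in> topspace Y"
  using factor by (auto simp: factor_map_def)

lemma \<pi>_act: "s \<in> carrier G \<Longrightarrow> x \<in> topspace X \<Longrightarrow> \<pi> (actX s x) = actY s (\<pi> x)"
  using factor by (simp add: factor_map_def)

lemma fibre_dist_pseudometric: "continuous_pseudometric X fibre_dist"
proof -
  have "continuous_map X Y \<pi>" using factor by (simp add: factor_map_def)
  then have "continuous_map (prod_topology X X) Y (\<lambda>z. \<pi> (fst z))"
    "continuous_map (prod_topology X X) Y (\<lambda>z. \<pi> (snd z))"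
    by (metis (no_types, lifting) continuous_map_compose continuous_map_fst continuous_map_snd
        comp_def continuous_map_eq)+
  then have "continuous_map (prod_topology X X) euclideanreal (\<lambda>z. \<rho>Y (\<pi> (fst z)) (\<pi> (snd z)))"
    by (rule continuous_map_pseudometric[OF psY])
  then show ?thesis
    using continuous_pseudometricD[OF psY] \<pi>_closed
    unfolding continuous_pseudometric_def fibre_dist_def case_prod_unfold by auto
qed

lemmas rhoX = continuous_pseudometricD[OF psX]
lemmas fdist = continuous_pseudometricD[OF fibre_dist_pseudometric]

lemma separating_element:
  assumes "x \<in> topspace X" "x' \<in> topspace X" "x \<noteq> x'"
  shows "\<exists>s\<in>carrier G. 0 < \<rho>X (actX s x) (actX s x')"
  using genX assms unfolding dynamically_generating_def less_SUP_iff by (auto simp: zero_ereal_def)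

lemma fibre_separating_element:
  assumes "x \<in> topspace X" "x' \<in> topspace X" "\<pi> x \<noteq> \<pi> x'"
  shows "\<exists>s\<in>carrier G. 0 < fibre_dist (actX s x) (actX s x')"
  using genY assms \<pi>_closed unfolding dynamically_generating_def less_SUP_iff
  by (auto simp: zero_ereal_def fibre_dist_def \<pi>_act)

lemma fibre_dist_modulus:
  assumes "0 < \<theta>"
  obtains E \<tau> where "finite E" "E \<subseteq> carrier G" "0 < \<tau>"
    "\<And>x x'. x \<in> topspace X \<Longrightarrow> x' \<in> topspace X \<Longrightarrow>
       (\<And>u. u \<in> E \<Longrightarrow> \<rho>X (actX u x) (actX u x') \<le> \<tau>) \<Longrightarrow> fibre_dist x x' \<le> \<theta>"
proof -
  let ?Z = "prod_topology X X"
  define K where "K = {z\<in>topspace ?Z. (case z of (x, x') \<Rightarrow> fibre_dist x x') \<in> {\<theta>..}}"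
  have "closedin ?Z K" unfolding K_def
    using fibre_dist_pseudometric unfolding continuous_pseudometric_def
    by (intro closedin_continuous_map_preimage) auto
  then have "compactin ?Z K"
    using closedin_compact_space[of ?Z K] compact compact_space_prod_topology by auto
  moreover have "continuous_map ?Z euclideanreal (\<lambda>z. \<rho>X (actX u (fst z)) (actX u (snd z)))"
    if "u \<in> carrier G" for u
    using act_continuous[OF that]
    by (intro continuous_map_pseudometric[OF psX])
      (auto intro: continuous_map_compose[unfolded comp_def] continuous_map_fst continuous_map_snd)
  moreover have "\<exists>u\<in>carrier G. 0 < \<rho>X (actX u (fst z)) (actX u (snd z))" if "z \<in> K" for z
    using that assms fdist(1) by (intro separating_element) (auto simp: K_def)
  ultimately obtain J \<tau> where J: "finite J" "J \<subseteq> carrier G" "0 < \<tau>"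
      "\<forall>z\<in>K. \<exists>u\<in>J. \<tau> < \<rho>X (actX u (fst z)) (actX u (snd z))"
    using compact_uniformly_positive[of ?Z K "carrier G" "\<lambda>u z. \<rho>X (actX u (fst z)) (actX u (snd z))"]
    by blast
  show ?thesis
  proof (rule that[OF J(1-3)])
    fix x x' assume x: "x \<in> topspace X" "x' \<in> topspace X"
      and le: "\<And>u. u \<in> J \<Longrightarrow> \<rho>X (actX u x) (actX u x') \<le> \<tau>"
    show "fibre_dist x x' \<le> \<theta>"
    proof (rule ccontr)
      assume "\<not> fibre_dist x x' \<le> \<theta>"
      then have "(x, x') \<in> K" using x by (auto simp: K_def)
      then show False using J(4) le by fastforce
    qed
  qed
qed

abbreviation fibre :: "'y \<Rightarrow> 'x set" where
  "fibre y \<equiv> {x \<in> topspace X. \<pi> x = y}"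

lemma rho_F_less_iff:
  assumes "finite F" "F \<noteq> {}"
  shows "rho_F actX \<rho>X F x x' < \<epsilon> \<longleftrightarrow> (\<forall>s\<in>F. \<rho>X (actX s x) (actX s x') < \<epsilon>)"
  using assms by (auto simp: rho_F_def)

lemma rho_F_ge_iff:
  assumes "finite F" "F \<noteq> {}"
  shows "\<epsilon> \<le> rho_F actX \<rho>X F x x' \<longleftrightarrow> (\<exists>s\<in>F. \<epsilon> \<le> \<rho>X (actX s x) (actX s x'))"
  using rho_F_less_iff[OF assms] by (meson linorder_not_less)

lemma fibre_neighbourhood_net:
  assumes F: "F \<in> fin_subsets G" and "0 < \<epsilon>"
    and N: "\<And>y. y \<in> topspace Y \<Longrightarrow> elog (N_sep \<epsilon> (fibre y) (rho_F actX \<rho>X F)) \<le> ereal c"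
  obtains E \<theta> where "finite E" "E \<subseteq> carrier G" "0 < \<theta>"
    "\<And>x0. x0 \<in> topspace X \<Longrightarrow> \<exists>P. finite P \<and> P \<subseteq> topspace X \<and> card P \<le> exp c \<and>
       (\<forall>x\<in>topspace X. (\<forall>t\<in>E. fibre_dist (actX t x0) (actX t x) \<le> \<theta>) \<longrightarrow>
          (\<exists>p\<in>P. \<forall>s\<in>F. \<rho>X (actX s p) (actX s x) < \<epsilon>))"
proof -
  have F': "finite F" "F \<noteq> {}" "F \<subseteq> carrier G" using F by (auto simp: fin_subsets_def)
  define good where "good x0 E \<theta> P \<longleftrightarrow> finite E \<and> E \<subseteq> carrier G \<and> 0 < \<theta> \<and>
       finite P \<and> P \<subseteq> topspace X \<and> card P \<le> exp c \<and>
       (\<forall>x\<in>topspace X. (\<forall>t\<in>E. fibre_dist (actX t x0) (actX t x) \<le> \<theta>) \<longrightarrow>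
          (\<exists>p\<in>P. \<forall>s\<in>F. \<rho>X (actX s p) (actX s x) < \<epsilon>))" for x0 E \<theta> P
  have "\<exists>E \<theta> P. good x0 E \<theta> P" if x0: "x0 \<in> topspace X" for x0
  proof -
    have sym: "rho_F actX \<rho>X F x y = rho_F actX \<rho>X F y x" if "x \<in> topspace X" "y \<in> topspace X" for x y
      unfolding rho_F_def using that F' act_closed rhoX(3)
      by (intro arg_cong[where f = Max] image_cong) auto
    have sym': "rho_F actX \<rho>X F x y = rho_F actX \<rho>X F y x"
      if "x \<in> fibre (\<pi> x0)" "y \<in> fibre (\<pi> x0)" for x y using that sym by blast
    obtain P where P: "finite P" "P \<subseteq> fibre (\<pi> x0)" "card P \<le> exp c"
      "\<And>x. x \<in> fibre (\<pi> x0) \<Longrightarrow> x \<notin> P \<Longrightarrow> \<exists>p\<in>P. rho_F actX \<rho>X F p x < \<epsilon>"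
      using separated_net[OF N[OF \<pi>_closed[OF x0]] sym'] by blast
    define U where "U = (\<Union>p\<in>P. \<Inter>s\<in>F. {x\<in>topspace X. \<rho>X (actX s p) (actX s x) \<in> {..<\<epsilon>}})"
    have op: "openin X {x\<in>topspace X. \<rho>X (actX s p) (actX s x) \<in> {..<\<epsilon>}}" if "s \<in> F" "p \<in> P" for s p
    proof -
      have "s \<in> carrier G" "p \<in> topspace X" using that F'(3) P(2) by auto
      then show ?thesis
        using act_closed act_continuous
        by (intro openin_continuous_map_preimage[where Y = euclideanreal] continuous_map_pseudometric[OF psX])
          (simp_all add: open_lessThan)
    qed
    have "openin X U" unfolding U_def
      using F'(1,2) op by (intro openin_clauses(3) openin_INT2) blast+
    then have "compactin X (topspace X - U)"
      using compact by (intro closedin_compact_space) auto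
    moreover have "continuous_map X euclideanreal (\<lambda>z. fibre_dist (actX t x0) (actX t z))"
      if "t \<in> carrier G" for t
      using that act_closed act_continuous x0
      by (intro continuous_map_pseudometric[OF fibre_dist_pseudometric]) auto
    moreover have "\<exists>t\<in>carrier G. 0 < fibre_dist (actX t x0) (actX t z)" if z: "z \<in> topspace X - U" for z
    proof (rule fibre_separating_element)
      show "\<pi> x0 \<noteq> \<pi> z"
      proof
        assume "\<pi> x0 = \<pi> z"
        then have z': "z \<in> fibre (\<pi> x0)" using z by auto
        have "\<exists>p\<in>P. \<forall>s\<in>F. \<rho>X (actX s p) (actX s z) < \<epsilon>"
        proof (cases "z \<in> P")
          case True
          then show ?thesis using z \<open>0 < \<epsilon>\<close> rhoX(1) act_closed F'(3)
            by (intro bexI[of _ z] ballI) (auto simp: subset_iff)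
        next
          case False
          then show ?thesis using P(4)[OF z'] rho_F_less_iff[OF F'(1,2)] by blast
        qed
        then show False using z by (auto simp: U_def)
      qed
    qed (use x0 z in auto)
    ultimately obtain E \<theta> where E: "finite E" "E \<subseteq> carrier G" "0 < \<theta>"
        "\<forall>z\<in>topspace X - U. \<exists>t\<in>E. \<theta> < fibre_dist (actX t x0) (actX t z)"
      using compact_uniformly_positive[of X "topspace X - U" "carrier G" "\<lambda>t z. fibre_dist (actX t x0) (actX t z)"]
      by blast
    have "good x0 E \<theta> P"
      unfolding good_def
    proof (intro conjI ballI impI)
      fix x assume "x \<in> topspace X" "\<forall>t\<in>E. fibre_dist (actX t x0) (actX t x) \<le> \<theta>"
      then have "x \<in> U" using E(4) by force
      then show "\<exists>p\<in>P. \<forall>s\<in>F. \<rho>X (actX s p) (actX s x) < \<epsilon>" using F'(2) by (auto simp: U_def)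
    qed (use E P in auto)
    then show ?thesis by blast
  qed
  then obtain E \<theta> P where good: "\<And>x0. x0 \<in> topspace X \<Longrightarrow> good x0 (E x0) (\<theta> x0) (P x0)" by metis
  define V where "V x0 = topspace X \<inter> (\<Inter>t\<in>E x0. {x\<in>topspace X. fibre_dist (actX t x0) (actX t x) \<in> {..<\<theta> x0 / 2}})" for x0
  have "openin X v" if v: "v \<in> V ` topspace X" for v
  proof -
    obtain x0 where x0: "x0 \<in> topspace X" "v = V x0" using v by auto
    have E0: "finite (E x0)" "E x0 \<subseteq> carrier G" using good[OF x0(1)] by (auto simp: good_def)
    have "openin X {x\<in>topspace X. fibre_dist (actX t x0) (actX t x) \<in> {..<\<theta> x0 / 2}}" if "t \<in> E x0" for t
    proof -
      have "t \<in> carrier G" using that E0 by auto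
      then show ?thesis
        using x0(1) act_closed act_continuous
        by (intro openin_continuous_map_preimage[where Y = euclideanreal] continuous_map_pseudometric[OF fibre_dist_pseudometric])
          (simp_all add: open_lessThan)
    qed
    then show ?thesis unfolding x0(2) V_def using E0(1)
      by (subst Int_commute) (intro openin_INT)
  qed
  moreover have "topspace X \<subseteq> \<Union>(V ` topspace X)"
  proof
    fix x assume x: "x \<in> topspace X"
    then have "x \<in> V x" using good[OF x] fdist(1) act_closed by (auto simp: V_def good_def subset_iff)
    then show "x \<in> \<Union>(V ` topspace X)" using x by auto
  qed
  ultimately obtain \<F> where "finite \<F>" "\<F> \<subseteq> V ` topspace X" "topspace X \<subseteq> \<Union>\<F>"
    using compactinD[of X "topspace X" "V ` topspace X"] compact unfolding compact_space_def by auto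
  then obtain S where S: "S \<subseteq> topspace X" "finite S" "topspace X \<subseteq> \<Union>(V ` S)"
    using finite_subset_image by metis
  define \<theta>0 where "\<theta>0 = Min (insert 1 ((\<lambda>x. \<theta> x / 2) ` S))"
  have \<theta>0: "\<theta>0 \<le> \<theta> x / 2" if "x \<in> S" for x
    unfolding \<theta>0_def using that S(2) by (intro Min_le) auto
  show ?thesis
  proof (rule that[of "\<Union>(E ` S)" \<theta>0])
    show "finite (\<Union>(E ` S))" "\<Union>(E ` S) \<subseteq> carrier G" using S(1,2) good by (auto simp: good_def subset_iff)
    show "0 < \<theta>0" unfolding \<theta>0_def using S(1,2) good by (subst Min_gr_iff) (auto simp: good_def subset_iff)
    fix x0 assume x0: "x0 \<in> topspace X"
    then obtain x1 where x1: "x1 \<in> S" "x0 \<in> V x1" using S(3) by auto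
    then have x1X: "x1 \<in> topspace X" using S(1) by auto
    have g: "good x1 (E x1) (\<theta> x1) (P x1)" using good[OF x1X] .
    show "\<exists>P. finite P \<and> P \<subseteq> topspace X \<and> card P \<le> exp c \<and>
       (\<forall>x\<in>topspace X. (\<forall>t\<in>\<Union>(E ` S). fibre_dist (actX t x0) (actX t x) \<le> \<theta>0) \<longrightarrow>
          (\<exists>p\<in>P. \<forall>s\<in>F. \<rho>X (actX s p) (actX s x) < \<epsilon>))"
    proof (intro exI[of _ "P x1"] conjI ballI impI)
      fix x assume x: "x \<in> topspace X" and le: "\<forall>t\<in>\<Union>(E ` S). fibre_dist (actX t x0) (actX t x) \<le> \<theta>0"
      have "fibre_dist (actX t x1) (actX t x) \<le> \<theta> x1" if t: "t \<in> E x1" for t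
      proof -
        have tG: "t \<in> carrier G" using g t by (auto simp: good_def)
        have "fibre_dist (actX t x1) (actX t x) \<le>
            fibre_dist (actX t x1) (actX t x0) + fibre_dist (actX t x0) (actX t x)"
          using tG x x0 x1X act_closed by (intro fdist(4)) auto
        moreover have "fibre_dist (actX t x1) (actX t x0) < \<theta> x1 / 2" using x1(2) t by (auto simp: V_def)
        moreover have "fibre_dist (actX t x0) (actX t x) \<le> \<theta> x1 / 2"
          using le t x1(1) \<theta>0[OF x1(1)] by force
        ultimately show ?thesis by linarith
      qed
      then show "\<exists>p\<in>P x1. \<forall>s\<in>F. \<rho>X (actX s p) (actX s x) < \<epsilon>"
        using g x by (auto simp: good_def)
    qed (use g in \<open>auto simp: good_def\<close>)
  qed
qed

subsection \<open>Upper bound\<close>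

definition exceptional :: "nat \<Rightarrow> ('g \<Rightarrow> nat \<Rightarrow> nat) \<Rightarrow> 'g set \<Rightarrow> real \<Rightarrow> (nat \<Rightarrow> 'x) \<Rightarrow> nat set" where
  "exceptional d \<sigma> L \<tau> \<phi> = {v\<in>{1..d}. \<exists>s\<in>L. \<tau> < \<rho>X (actX s (\<phi> v)) (\<phi> (\<sigma> s v))}"

definition exceptional_nbhd :: "nat \<Rightarrow> ('g \<Rightarrow> nat \<Rightarrow> nat) \<Rightarrow> 'g set \<Rightarrow> real \<Rightarrow> (nat \<Rightarrow> 'x) \<Rightarrow> nat set" where
  "exceptional_nbhd d \<sigma> L \<tau> \<phi> = exceptional d \<sigma> L \<tau> \<phi> \<union>
     (\<Union>t\<in>L. {c\<in>{1..d}. \<sigma> t c \<in> exceptional d \<sigma> L \<tau> \<phi>})"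

lemma card_exceptional_nbhd:
  fixes \<delta> \<tau> :: real
  assumes "\<phi> \<in> sofic_Map X actX \<rho>X L \<delta> d \<sigma>" "finite L" "L \<subseteq> carrier G" "0 < \<tau>"
    and perm: "\<And>s. s \<in> L \<Longrightarrow> \<sigma> s permutes {1..d}"
  shows "card (exceptional_nbhd d \<sigma> L \<tau> \<phi>) * \<tau>\<^sup>2 \<le> (card L + 1) * (card L * (\<delta>\<^sup>2 * d))"
proof -
  let ?B = "exceptional d \<sigma> L \<tau> \<phi>"
  have \<phi>: "\<phi> v \<in> topspace X" if "v \<in> {1..d}" for v
    using assms(1) that by (auto simp: sofic_Map_def)
  have \<sigma>: "\<sigma> s v \<in> {1..d}" if "s \<in> L" "v \<in> {1..d}" for s v
    using that permutes_in_image[OF perm] by auto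
  have finB: "finite ?B" by (simp add: exceptional_def)
  have "?B = (\<Union>s\<in>L. {v\<in>{1..d}. \<tau> < \<rho>X (actX s (\<phi> v)) ((\<phi> \<circ> \<sigma> s) v)})"
    by (auto simp: exceptional_def)
  then have "card ?B \<le> (\<Sum>s\<in>L. card {v\<in>{1..d}. \<tau> < \<rho>X (actX s (\<phi> v)) ((\<phi> \<circ> \<sigma> s) v)})"
    using card_UN_le[OF assms(2)] by simp
  then have "real (card ?B) \<le> real (\<Sum>s\<in>L. card {v\<in>{1..d}. \<tau> < \<rho>X (actX s (\<phi> v)) ((\<phi> \<circ> \<sigma> s) v)})"
    by (rule of_nat_mono)
  then have "card ?B * \<tau>\<^sup>2 \<le> real (\<Sum>s\<in>L. card {v\<in>{1..d}. \<tau> < \<rho>X (actX s (\<phi> v)) ((\<phi> \<circ> \<sigma> s) v)}) * \<tau>\<^sup>2"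
    by (intro mult_right_mono) auto
  also have "\<dots> = (\<Sum>s\<in>L. card {v\<in>{1..d}. \<tau> < \<rho>X (actX s (\<phi> v)) ((\<phi> \<circ> \<sigma> s) v)} * \<tau>\<^sup>2)"
    by (simp add: sum_distrib_right)
  also have "\<dots> \<le> (\<Sum>s\<in>L. \<delta>\<^sup>2 * d)"
  proof (intro sum_mono)
    fix s assume s: "s \<in> L"
    then have rt: "rho_two d \<rho>X (\<lambda>v. actX s (\<phi> v)) (\<phi> \<circ> \<sigma> s) \<le> \<delta>"
      using assms(1) by (auto simp: sofic_Map_def)
    have "0 \<le> \<rho>X (actX s (\<phi> v)) ((\<phi> \<circ> \<sigma> s) v)" if "v \<in> {1..d}" for v
      using s assms(3) \<phi> \<sigma>[OF s that] act_closed that by (intro rhoX(2)) auto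
    with rt show "card {v\<in>{1..d}. \<tau> < \<rho>X (actX s (\<phi> v)) ((\<phi> \<circ> \<sigma> s) v)} * \<tau>\<^sup>2 \<le> \<delta>\<^sup>2 * d"
      using rho_two_exceptional[of d \<rho>X "\<lambda>v. actX s (\<phi> v)" "\<phi> \<circ> \<sigma> s" \<delta> \<tau>] assms(4) by simp
  qed
  finally have B: "card ?B * \<tau>\<^sup>2 \<le> card L * (\<delta>\<^sup>2 * d)" by simp
  have pre: "card {c\<in>{1..d}. \<sigma> t c \<in> ?B} \<le> card ?B" if "t \<in> L" for t
    using permutes_inj_on[OF perm[OF that], of "{c\<in>{1..d}. \<sigma> t c \<in> ?B}"] finB
    by (intro card_inj_on_le[of "\<sigma> t"]) auto
  have "card (exceptional_nbhd d \<sigma> L \<tau> \<phi>) \<le> card ?B + (\<Sum>t\<in>L. card {c\<in>{1..d}. \<sigma> t c \<in> ?B})"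
    unfolding exceptional_nbhd_def
    by (intro order_trans[OF card_Un_le] add_left_mono card_UN_le assms(2))
  also have "\<dots> \<le> card ?B + (\<Sum>t\<in>L. card ?B)" using pre by (intro add_left_mono sum_mono)
  also have "\<dots> = (card L + 1) * card ?B" by simp
  finally have "real (card (exceptional_nbhd d \<sigma> L \<tau> \<phi>)) \<le> real ((card L + 1) * card ?B)"
    by (rule of_nat_mono)
  then have "card (exceptional_nbhd d \<sigma> L \<tau> \<phi>) * \<tau>\<^sup>2 \<le> real ((card L + 1) * card ?B) * \<tau>\<^sup>2"
    by (intro mult_right_mono) auto
  also have "\<dots> = real (card L + 1) * (card ?B * \<tau>\<^sup>2)" by (simp only: of_nat_mult mult.assoc)
  also have "\<dots> \<le> real (card L + 1) * (card L * (\<delta>\<^sup>2 * d))" using B by (intro mult_left_mono) auto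
  finally show ?thesis by simp
qed

text \<open>The maps of \<open>E\<close> are told apart by the names of their values at the centres of the tiles
  that are not exceptional, and at all points outside these tiles.\<close>

lemma card_separated_maps_le:
  fixes \<epsilon> \<theta> \<tau> a :: real
  assumes "0 < d" and L: "finite L" "L \<subseteq> carrier G" "E1 \<subseteq> L" "E2 \<subseteq> L"
      "\<And>u t. u \<in> E2 \<Longrightarrow> t \<in> E1 \<Longrightarrow> u \<otimes> t \<in> L" "\<And>F. F \<in> FF \<Longrightarrow> F \<subseteq> L"
    and perm: "\<And>s. s \<in> L \<Longrightarrow> \<sigma> s permutes {1..d}"
    and T: "quasi_tiling \<eta> \<sigma> (good_centres G d \<sigma> L) T" "shape ` T \<subseteq> FF"
    and net: "\<And>F x0. F \<in> FF \<Longrightarrow> x0 \<in> topspace X \<Longrightarrow> \<exists>P. finite P \<and> P \<subseteq> topspace X \<and> card P \<le> exp (a * card F) \<and>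
       (\<forall>x\<in>topspace X. (\<forall>t\<in>E1. fibre_dist (actX t x0) (actX t x) \<le> 3 * \<theta>) \<longrightarrow>
          (\<exists>p\<in>P. \<forall>s\<in>F. \<rho>X (actX s p) (actX s x) < \<epsilon> / 4))"
    and modulus: "\<And>x x'. x \<in> topspace X \<Longrightarrow> x' \<in> topspace X \<Longrightarrow>
       (\<And>u. u \<in> E2 \<Longrightarrow> \<rho>X (actX u x) (actX u x') \<le> 2 * \<tau>) \<Longrightarrow> fibre_dist x x' \<le> \<theta>"
    and \<tau>: "\<tau> \<le> \<epsilon> / 4" and a: "0 \<le> a"
    and Q: "finite Q" "Q \<subseteq> topspace X" "\<And>x. x \<in> topspace X \<Longrightarrow> \<exists>q\<in>Q. \<rho>X q x < \<epsilon> / 4"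
      "1 \<le> m" "card Q \<le> m"
    and E: "finite E" "E \<subseteq> {1..d} \<rightarrow>\<^sub>E topspace X"
      "\<And>\<phi> \<phi>'. \<phi> \<in> E \<Longrightarrow> \<phi>' \<in> E \<Longrightarrow> \<phi> \<noteq> \<phi>' \<Longrightarrow> rho_infty d fibre_dist \<phi> \<phi>' \<le> \<theta> \<and> \<epsilon> \<le> rho_infty d \<rho>X \<phi> \<phi>'"
    and B: "B \<subseteq> {1..d}" "\<And>\<phi>. \<phi> \<in> E \<Longrightarrow> exceptional_nbhd d \<sigma> L \<tau> \<phi> \<subseteq> B"
    and \<theta>: "0 < \<theta>"
  shows "card E \<le> exp (a * (\<Sum>t\<in>T. real (card (shape t)))) *
     real m ^ (card ({1..d} - covered \<sigma> T) + card B * card L)"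
proof (cases "E = {}")
  case False
  then obtain \<phi>0 where \<phi>0: "\<phi>0 \<in> E" by auto
  have val: "\<phi> v \<in> topspace X" if "\<phi> \<in> E" "v \<in> {1..d}" for \<phi> v
    using PiE_mem[OF subsetD[OF E(2) that(1)] that(2)] .
  have \<sigma>: "\<sigma> s v \<in> {1..d}" if "s \<in> L" "v \<in> {1..d}" for s v
    using that permutes_in_image[OF perm] by auto
  have Lc: "s \<in> carrier G" if "s \<in> L" for s using L(2) that by auto
  have ae: "\<rho>X (actX s (\<phi> c)) (\<phi> (\<sigma> s c)) \<le> \<tau>" if "\<phi> \<in> E" "c \<in> {1..d} - B" "s \<in> L" for \<phi> c s
  proof (rule ccontr)
    assume "\<not> ?thesis"
    then have "\<tau> < \<rho>X (actX s (\<phi> c)) (\<phi> (\<sigma> s c))" by simp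
    then have "c \<in> exceptional_nbhd d \<sigma> L \<tau> \<phi>"
      using that by (auto simp: exceptional_nbhd_def exceptional_def)
    then show False using B(2)[OF that(1)] that by auto
  qed
  have ae2: "\<rho>X (actX u (\<phi> (\<sigma> t c))) (\<phi> (\<sigma> u (\<sigma> t c))) \<le> \<tau>"
    if "\<phi> \<in> E" "c \<in> {1..d} - B" "t \<in> L" "u \<in> L" for \<phi> c t u
  proof (rule ccontr)
    assume "\<not> ?thesis"
    then have "\<tau> < \<rho>X (actX u (\<phi> (\<sigma> t c))) (\<phi> (\<sigma> u (\<sigma> t c)))" by simp
    then have "\<sigma> t c \<in> exceptional d \<sigma> L \<tau> \<phi>"
      using that \<sigma>[of t c] by (auto simp: exceptional_def)
    then have "c \<in> exceptional_nbhd d \<sigma> L \<tau> \<phi>" using that by (auto simp: exceptional_nbhd_def)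
    then show False using B(2)[OF that(1)] that by auto
  qed
  have "rho_infty d fibre_dist \<phi> \<phi>' \<le> \<theta>" if "\<phi> \<in> E" "\<phi>' \<in> E" for \<phi> \<phi>'
  proof (cases "\<phi> = \<phi>'")
    case True
    then show ?thesis using \<theta> val[OF that(1)] fdist(1) by (simp add: rho_infty_le_iff[OF \<open>0 < d\<close>])
  qed (use E(3) that in auto)
  then have fclose: "fibre_dist (\<phi> v) (\<phi>' v) \<le> \<theta>" if "\<phi> \<in> E" "\<phi>' \<in> E" "v \<in> {1..d}" for \<phi> \<phi>' v
    using that rho_infty_le_iff[OF \<open>0 < d\<close>] by blast
  define T0 where "T0 = {t\<in>T. centre t \<notin> B}"
  have finT: "finite T" "finite T0" using quasi_tilingD(1)[OF T(1)] by (auto simp: T0_def)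
  have cen: "centre t \<in> good_centres G d \<sigma> L" "centre t \<in> {1..d} - B" "shape t \<in> FF" "t \<in> T" if "t \<in> T0" for t
    using that quasi_tilingD(4)[OF T(1)] T(2) by (auto simp: T0_def good_centres_def)
  have fc: "fibre_dist (actX t (\<phi> c)) (\<phi> (\<sigma> t c)) \<le> \<theta>"
    if \<phi>: "\<phi> \<in> E" and c: "c \<in> good_centres G d \<sigma> L" "c \<in> {1..d} - B" and t: "t \<in> E1" for \<phi> c t
  proof (rule modulus)
    have tL: "t \<in> L" using t L(3) by auto
    have c': "c \<in> {1..d}" using c by auto
    show X1: "actX t (\<phi> c) \<in> topspace X" "\<phi> (\<sigma> t c) \<in> topspace X"
      using val[OF \<phi>] act_closed Lc[OF tL] \<sigma>[OF tL] c' by auto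
    fix u assume u: "u \<in> E2"
    then have uL: "u \<in> L" "u \<otimes> t \<in> L" using L(4,5) t by auto
    have 1: "\<rho>X (actX u (actX t (\<phi> c))) (\<phi> (\<sigma> (u \<otimes> t) c)) \<le> \<tau>"
      using ae[OF \<phi> c(2) uL(2)] act_mult[OF Lc[OF uL(1)] Lc[OF tL] val[OF \<phi> c']] by simp
    have "\<sigma> u (\<sigma> t c) = \<sigma> (u \<otimes> t) c" using c(1) uL(1) tL by (auto simp: good_centres_def)
    then have 2: "\<rho>X (actX u (\<phi> (\<sigma> t c))) (\<phi> (\<sigma> (u \<otimes> t) c)) \<le> \<tau>"
      using ae2[OF \<phi> c(2) tL uL(1)] by simp
    have p: "actX u (actX t (\<phi> c)) \<in> topspace X" "actX u (\<phi> (\<sigma> t c)) \<in> topspace X"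
      "\<phi> (\<sigma> (u \<otimes> t) c) \<in> topspace X"
      using X1 act_closed[OF Lc[OF uL(1)]] val[OF \<phi>] \<sigma>[OF uL(2) c'] by auto
    show "\<rho>X (actX u (actX t (\<phi> c))) (actX u (\<phi> (\<sigma> t c))) \<le> 2 * \<tau>"
      using 1 2 rhoX(4)[OF p(1,3,2)] rhoX(3)[OF p(2,3)] by linarith
  qed
  have "\<exists>P. finite P \<and> P \<subseteq> topspace X \<and> card P \<le> exp (a * card (shape t)) \<and>
      (\<forall>\<phi>\<in>E. \<exists>p\<in>P. \<forall>s\<in>shape t. \<rho>X (actX s p) (actX s (\<phi> (centre t))) < \<epsilon> / 4)" if t: "t \<in> T0" for t
  proof -
    have c: "centre t \<in> {1..d}" using cen(2)[OF t] by auto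
    obtain P where P: "finite P" "P \<subseteq> topspace X" "card P \<le> exp (a * card (shape t))"
       "\<And>x. x \<in> topspace X \<Longrightarrow> (\<And>t'. t' \<in> E1 \<Longrightarrow> fibre_dist (actX t' (\<phi>0 (centre t))) (actX t' x) \<le> 3 * \<theta>) \<Longrightarrow>
          (\<exists>p\<in>P. \<forall>s\<in>shape t. \<rho>X (actX s p) (actX s x) < \<epsilon> / 4)"
      using net[OF cen(3)[OF t] val[OF \<phi>0 c]] by metis
    have "\<exists>p\<in>P. \<forall>s\<in>shape t. \<rho>X (actX s p) (actX s (\<phi> (centre t))) < \<epsilon> / 4" if \<phi>: "\<phi> \<in> E" for \<phi>
    proof (rule P(4)[OF val[OF \<phi> c]])
      fix t' assume t': "t' \<in> E1"
      then have t'L: "t' \<in> L" using L(3) by auto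
      let ?a = "actX t' (\<phi>0 (centre t))" and ?b = "\<phi>0 (\<sigma> t' (centre t))"
        and ?c = "\<phi> (\<sigma> t' (centre t))" and ?d = "actX t' (\<phi> (centre t))"
      have p: "?a \<in> topspace X" "?b \<in> topspace X" "?c \<in> topspace X" "?d \<in> topspace X"
        using val \<phi> \<phi>0 c \<sigma>[OF t'L c] act_closed[OF Lc[OF t'L]] by auto
      have "fibre_dist ?a ?b \<le> \<theta>" "fibre_dist ?d ?c \<le> \<theta>"
        using fc[OF _ cen(1,2)[OF t] t'] \<phi> \<phi>0 by auto
      moreover have "fibre_dist ?b ?c \<le> \<theta>" using fclose[OF \<phi>0 \<phi> \<sigma>[OF t'L c]] .
      ultimately show "fibre_dist ?a ?d \<le> 3 * \<theta>"
        using fdist(4)[OF p(1,2,4)] fdist(4)[OF p(2,3,4)] fdist(3)[OF p(3,4)] by linarith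
    qed
    then show ?thesis using P by blast
  qed
  then obtain P where P: "\<And>t. t \<in> T0 \<Longrightarrow> finite (P t)" "\<And>t. t \<in> T0 \<Longrightarrow> P t \<subseteq> topspace X"
      "\<And>t. t \<in> T0 \<Longrightarrow> card (P t) \<le> exp (a * card (shape t))"
      "\<And>t \<phi>. t \<in> T0 \<Longrightarrow> \<phi> \<in> E \<Longrightarrow>
         \<exists>p\<in>P t. \<forall>s\<in>shape t. \<rho>X (actX s p) (actX s (\<phi> (centre t))) < \<epsilon> / 4"
    by metis
  obtain nm1 where nm1: "\<And>t \<phi>. t \<in> T0 \<Longrightarrow> \<phi> \<in> E \<Longrightarrow> nm1 t \<phi> \<in> P t"
      "\<And>t \<phi> s. t \<in> T0 \<Longrightarrow> \<phi> \<in> E \<Longrightarrow> s \<in> shape t \<Longrightarrow> \<rho>X (actX s (nm1 t \<phi>)) (actX s (\<phi> (centre t))) < \<epsilon> / 4"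
    using P(4) by metis
  obtain nm2 where nm2: "\<And>x. x \<in> topspace X \<Longrightarrow> nm2 x \<in> Q" "\<And>x. x \<in> topspace X \<Longrightarrow> \<rho>X (nm2 x) x < \<epsilon> / 4"
    using Q(3) by metis
  define W where "W = {1..d} - (\<Union>t\<in>T0. region \<sigma> t)"
  define \<Phi> where "\<Phi> \<phi> = (\<lambda>t\<in>T0. nm1 t \<phi>, \<lambda>v\<in>W. nm2 (\<phi> v))" for \<phi>
  have inj: "inj_on \<Phi> E"
  proof (rule inj_onI, rule ccontr)
    fix \<phi> \<phi>' assume \<phi>: "\<phi> \<in> E" "\<phi>' \<in> E" and eq: "\<Phi> \<phi> = \<Phi> \<phi>'" and "\<phi> \<noteq> \<phi>'"
    then obtain v where v: "v \<in> {1..d}" "\<epsilon> \<le> \<rho>X (\<phi> v) (\<phi>' v)"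
      using E(3) rho_infty_ge_iff[OF \<open>0 < d\<close>] by metis
    have eq1: "nm1 t \<phi> = nm1 t \<phi>'" if "t \<in> T0" for t
      using eq that unfolding \<Phi>_def by (metis fst_conv restrict_apply')
    have eq2: "nm2 (\<phi> v) = nm2 (\<phi>' v)" if "v \<in> W" for v
      using eq that unfolding \<Phi>_def by (metis snd_conv restrict_apply')
    have pv: "\<phi> v \<in> topspace X" "\<phi>' v \<in> topspace X" using val \<phi> v(1) by auto
    show False
    proof (cases "v \<in> W")
      case True
      have q: "nm2 (\<phi> v) \<in> topspace X" using nm2(1)[OF pv(1)] Q(2) by auto
      have "\<rho>X (nm2 (\<phi> v)) (\<phi> v) < \<epsilon> / 4" "\<rho>X (nm2 (\<phi> v)) (\<phi>' v) < \<epsilon> / 4"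
        using nm2(2)[OF pv(1)] nm2(2)[OF pv(2)] eq2[OF True] by auto
      moreover have "0 \<le> \<rho>X (nm2 (\<phi> v)) (\<phi> v)" using rhoX(2)[OF q pv(1)] .
      ultimately show False
        using v(2) rhoX(4)[OF pv(1) q pv(2)] rhoX(3)[OF q pv(1)] by linarith
    next
      case False
      then obtain t s where t: "t \<in> T0" "s \<in> part t" "v = \<sigma> s (centre t)"
        using v(1) by (auto simp: W_def region_def)
      have s: "s \<in> shape t" using quasi_tilingD(5)[OF T(1) cen(4)[OF t(1)]] t(2) by auto
      have sL: "s \<in> L" using s L(6)[OF cen(3)[OF t(1)]] by auto
      have c: "centre t \<in> {1..d}" using cen(2)[OF t(1)] by auto
      let ?n = "actX s (nm1 t \<phi>)" and ?x = "actX s (\<phi> (centre t))" and ?x' = "actX s (\<phi>' (centre t))"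
      have p: "?n \<in> topspace X" "?x \<in> topspace X" "?x' \<in> topspace X"
        using act_closed[OF Lc[OF sL]] nm1(1)[OF t(1) \<phi>(1)] P(2)[OF t(1)] val \<phi> c by auto
      have "\<rho>X ?n ?x < \<epsilon> / 4" "\<rho>X ?n ?x' < \<epsilon> / 4"
        using nm1(2)[OF t(1) \<phi>(1) s] nm1(2)[OF t(1) \<phi>(2) s] eq1[OF t(1)] by auto
      moreover have "\<rho>X ?x (\<phi> v) \<le> \<tau>" "\<rho>X ?x' (\<phi>' v) \<le> \<tau>"
        using ae[OF _ cen(2)[OF t(1)] sL] \<phi> t(3) by auto
      ultimately show False
        using v(2) \<tau> rhoX(4)[OF pv(1) p(2) pv(2)] rhoX(4)[OF p(2) p(3) pv(2)] rhoX(4)[OF p(2,1,3)]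
          rhoX(3)[OF pv(1) p(2)] rhoX(3)[OF p(2,1)] by linarith
    qed
  qed
  have finW: "finite W" by (simp add: W_def)
  let ?C = "PiE T0 P \<times> PiE W (\<lambda>_. Q)"
  have "\<Phi> ` E \<subseteq> ?C"
  proof (rule image_subsetI)
    fix \<phi> assume "\<phi> \<in> E"
    then show "\<Phi> \<phi> \<in> ?C" using nm1(1) nm2(1) val by (auto simp: \<Phi>_def W_def)
  qed
  moreover have "finite ?C" using finT finW P(1) Q(1) by (intro finite_cartesian_product finite_PiE)
  ultimately have "card E \<le> card ?C" by (rule card_inj_on_le[OF inj])
  also have "\<dots> = (\<Prod>t\<in>T0. card (P t)) * card Q ^ card W"
    using finT finW by (simp add: card_cartesian_product card_PiE)
  finally have "real (card E) \<le> real ((\<Prod>t\<in>T0. card (P t)) * card Q ^ card W)" by (rule of_nat_mono)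
  also have "\<dots> = (\<Prod>t\<in>T0. real (card (P t))) * real (card Q) ^ card W" by simp
  also have "\<dots> \<le> exp (a * (\<Sum>t\<in>T. real (card (shape t)))) *
     real m ^ (card ({1..d} - covered \<sigma> T) + card B * card L)"
  proof (rule mult_mono)
    have "(\<Prod>t\<in>T0. real (card (P t))) \<le> (\<Prod>t\<in>T0. exp (a * card (shape t)))"
      using P(3) by (intro prod_mono) auto
    also have "\<dots> = exp (\<Sum>t\<in>T0. a * card (shape t))" using finT by (simp add: exp_sum)
    also have "\<dots> \<le> exp (\<Sum>t\<in>T. a * card (shape t))"
      unfolding exp_le_cancel_iff using finT a by (intro sum_mono2) (auto simp: T0_def)
    finally show "(\<Prod>t\<in>T0. real (card (P t))) \<le> exp (a * (\<Sum>t\<in>T. real (card (shape t))))"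
      by (simp add: sum_distrib_left)
    have "W \<subseteq> ({1..d} - covered \<sigma> T) \<union> (\<lambda>(c, s). \<sigma> s c) ` (B \<times> L)"
    proof
      fix v assume v: "v \<in> W"
      show "v \<in> ({1..d} - covered \<sigma> T) \<union> (\<lambda>(c, s). \<sigma> s c) ` (B \<times> L)"
      proof (cases "v \<in> covered \<sigma> T")
        case True
        then obtain t s where t: "t \<in> T" "s \<in> part t" "v = \<sigma> s (centre t)"
          by (auto simp: covered_def region_def)
        have "t \<notin> T0" using v t by (auto simp: W_def region_def)
        moreover have "s \<in> L" using t quasi_tilingD(5)[OF T(1) t(1)] T(2) L(6) by blast
        ultimately show ?thesis using t by (auto simp: T0_def)
      qed (use v in \<open>auto simp: W_def\<close>)
    qed
    then have "card W \<le> card (({1..d} - covered \<sigma> T) \<union> (\<lambda>(c, s). \<sigma> s c) ` (B \<times> L))"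
      using B(1) L(1) finite_subset[OF B(1)] by (intro card_mono) auto
    also have "\<dots> \<le> card ({1..d} - covered \<sigma> T) + card (B \<times> L)"
      using B(1) L(1) finite_subset[OF B(1)]
      by (intro order_trans[OF card_Un_le] add_left_mono card_image_le) auto
    finally have W: "card W \<le> card ({1..d} - covered \<sigma> T) + card B * card L"
      by (simp add: card_cartesian_product)
    have "real (card Q) ^ card W \<le> real m ^ card W" using Q(5) by (intro power_mono) auto
    also have "\<dots> \<le> real m ^ (card ({1..d} - covered \<sigma> T) + card B * card L)"
      using W Q(4) by (intro power_increasing) auto
    finally show "real (card Q) ^ card W \<le> real m ^ (card ({1..d} - covered \<sigma> T) + card B * card L)" .
  qed auto
  finally show ?thesis .
qed simp

lemma h_sofic_le:
  fixes a \<epsilon> \<delta> \<kappa> :: real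
  assumes sofic: "sofic_approximation G d \<sigma>" and amenable: "amenable_group G"
    and pos: "0 < \<epsilon>" "0 \<le> a" "0 < \<delta>" "0 < \<kappa>" and K: "K \<in> fin_subsets G"
    and N: "\<And>F y. F \<in> almost_invariant G K \<delta> \<Longrightarrow> y \<in> topspace Y \<Longrightarrow>
       elog (N_sep (\<epsilon> / 4) (fibre y) (rho_F actX \<rho>X F)) \<le> ereal (a * card F)"
  shows "h_sofic G d \<sigma> X actX \<pi> \<rho>X \<rho>Y \<epsilon> \<le> ereal (a + \<kappa>)"
proof -
  have \<epsilon>4: "0 < \<epsilon> / 4" using pos by simp
  obtain Q where Q: "finite Q" "Q \<subseteq> topspace X" "\<And>x. x \<in> topspace X \<Longrightarrow> \<exists>q\<in>Q. \<rho>X q x < \<epsilon> / 4"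
    using pseudometric_net[OF compact psX \<epsilon>4] by metis
  define m where "m = max 1 (card Q)"
  have m: "1 \<le> m" "card Q \<le> m" by (auto simp: m_def)
  define lm where "lm = ln (real m)"
  have lm: "0 \<le> lm" using m by (simp add: lm_def)
  define \<eta> where "\<eta> = min (1/2) (\<kappa> / (8 * (a + 1)))"
  have \<eta>: "0 < \<eta>" "\<eta> \<le> 1/2" "\<eta> \<le> \<kappa> / (8 * (a + 1))"
    unfolding \<eta>_def using pos by (auto intro!: min.cobounded1 min.cobounded2 simp del: distrib_left_numeral)
  define \<zeta> where "\<zeta> = \<kappa> / (8 * (lm + 1))"
  have \<zeta>: "0 < \<zeta>" "\<zeta> * lm \<le> \<kappa> / 8" using pos lm by (auto simp: \<zeta>_def field_simps)
  have cof: "almost_invariant G K \<delta> \<inter> almost_invariant G K' \<delta>' \<noteq> {}" if "K' \<in> fin_subsets G" "0 < \<delta>'" for K' \<delta>'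
  proof -
    have f: "K \<union> K' \<in> fin_subsets G" "finite (K \<union> K')" using K that by (auto simp: fin_subsets_def)
    then have "almost_invariant G (K \<union> K') (min \<delta> \<delta>') \<noteq> {}"
      using amenable pos that unfolding amenable_group_def by simp
    moreover have "almost_invariant G (K \<union> K') (min \<delta> \<delta>') \<subseteq> almost_invariant G K \<delta>"
      "almost_invariant G (K \<union> K') (min \<delta> \<delta>') \<subseteq> almost_invariant G K' \<delta>'"
      using f by (intro almost_invariant_mono; simp)+
    ultimately show ?thesis by blast
  qed
  obtain FF where FF: "finite FF" "FF \<subseteq> almost_invariant G K \<delta> \<inter> fin_subsets G"
    "\<And>L. finite L \<Longrightarrow> L \<subseteq> carrier G \<Longrightarrow> \<Union>FF \<subseteq> L \<Longrightarrow>
      \<forall>\<^sub>F i in sequentially. \<exists>T. quasi_tiling \<eta> (\<sigma> i) (good_centres G (d i) (\<sigma> i) L) T \<and>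
        shape ` T \<subseteq> FF \<and> real (d i) - card (covered (\<sigma> i) T) \<le> \<zeta> * d i"
  proof (rule sofic_quasi_tiling[OF grp sofic cof \<eta>(1,2) \<zeta>(1)], assumption, assumption, goal_cases)
    case (1 FF)
    then show ?case by (intro 1(1))
  qed
  have "\<exists>E \<theta>. finite E \<and> E \<subseteq> carrier G \<and> 0 < \<theta> \<and>
      (\<forall>x0\<in>topspace X. \<exists>P. finite P \<and> P \<subseteq> topspace X \<and> card P \<le> exp (a * card F) \<and>
       (\<forall>x\<in>topspace X. (\<forall>t\<in>E. fibre_dist (actX t x0) (actX t x) \<le> \<theta>) \<longrightarrow>
          (\<exists>p\<in>P. \<forall>s\<in>F. \<rho>X (actX s p) (actX s x) < \<epsilon> / 4)))" if F: "F \<in> FF" for F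
  proof -
    have F': "F \<in> almost_invariant G K \<delta>" "F \<in> fin_subsets G" using F FF(2) by auto
    obtain E \<theta> where "finite E" "E \<subseteq> carrier G" "0 < \<theta>"
      "\<And>x0. x0 \<in> topspace X \<Longrightarrow> \<exists>P. finite P \<and> P \<subseteq> topspace X \<and> card P \<le> exp (a * card F) \<and>
       (\<forall>x\<in>topspace X. (\<forall>t\<in>E. fibre_dist (actX t x0) (actX t x) \<le> \<theta>) \<longrightarrow>
          (\<exists>p\<in>P. \<forall>s\<in>F. \<rho>X (actX s p) (actX s x) < \<epsilon> / 4))"
      using fibre_neighbourhood_net[OF F'(2) \<epsilon>4 N[OF F'(1)]] by metis
    then show ?thesis by (intro exI[of _ E] exI[of _ \<theta>]) simp
  qed
  then obtain EF \<theta>F where EF: "\<And>F. F \<in> FF \<Longrightarrow> finite (EF F)" "\<And>F. F \<in> FF \<Longrightarrow> EF F \<subseteq> carrier G"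
      "\<And>F. F \<in> FF \<Longrightarrow> 0 < \<theta>F F"
      "\<And>F x0. F \<in> FF \<Longrightarrow> x0 \<in> topspace X \<Longrightarrow> \<exists>P. finite P \<and> P \<subseteq> topspace X \<and> card P \<le> exp (a * card F) \<and>
       (\<forall>x\<in>topspace X. (\<forall>t\<in>EF F. fibre_dist (actX t x0) (actX t x) \<le> \<theta>F F) \<longrightarrow>
          (\<exists>p\<in>P. \<forall>s\<in>F. \<rho>X (actX s p) (actX s x) < \<epsilon> / 4))"
    by metis
  define E1 where "E1 = (\<Union>F\<in>FF. EF F)"
  have E1: "finite E1" "E1 \<subseteq> carrier G" using FF(1) EF(1,2) by (auto simp: E1_def)
  define \<theta> where "\<theta> = Min (insert 1 (\<theta>F ` FF)) / 3"
  have \<theta>le: "3 * \<theta> \<le> \<theta>F F" if "F \<in> FF" for F using that FF(1) by (auto simp: \<theta>_def)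
  have \<theta>: "0 < \<theta>" using FF(1) EF(3) by (auto simp: \<theta>_def)
  obtain E2 \<tau>2 where E2: "finite E2" "E2 \<subseteq> carrier G" "0 < \<tau>2"
    "\<And>x x'. x \<in> topspace X \<Longrightarrow> x' \<in> topspace X \<Longrightarrow>
       (\<And>u. u \<in> E2 \<Longrightarrow> \<rho>X (actX u x) (actX u x') \<le> \<tau>2) \<Longrightarrow> fibre_dist x x' \<le> \<theta>"
    using fibre_dist_modulus[OF \<theta>] by metis
  define \<tau> where "\<tau> = min (\<epsilon> / 4) (\<tau>2 / 2)"
  have \<tau>: "0 < \<tau>" "\<tau> \<le> \<epsilon> / 4" "2 * \<tau> \<le> \<tau>2" using E2(3) pos by (auto simp: \<tau>_def)
  define L where "L = insert \<one> (\<Union>FF \<union> E1 \<union> E2 \<union> (E2 <#> E1))"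
  interpret group G by (rule grp)
  have FFfin: "finite F" "F \<subseteq> carrier G" if "F \<in> FF" for F using FF(2) that by (auto simp: fin_subsets_def)
  have "E2 <#> E1 \<subseteq> carrier G" by (rule set_mult_closed[OF E2(2) E1(2)])
  then have L: "finite L" "L \<subseteq> carrier G"
    using FF(1) FFfin E1 E2(1,2) by (auto simp: L_def intro: finite_set_mult)
  have Lsub: "E1 \<subseteq> L" "E2 \<subseteq> L" "\<And>u t. u \<in> E2 \<Longrightarrow> t \<in> E1 \<Longrightarrow> u \<otimes> t \<in> L" "\<And>F. F \<in> FF \<Longrightarrow> F \<subseteq> L"
    by (auto simp: L_def set_mult_def)
  have LK: "L \<in> fin_subsets G" using L by (auto simp: fin_subsets_def L_def)
  have \<kappa>4: "0 < \<kappa> / 4" using pos by simp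
  obtain \<beta>0 where \<beta>0: "0 < \<beta>0"
    "\<And>\<beta> d. \<beta> \<le> \<beta>0 \<Longrightarrow> card {B. B \<subseteq> {1..d} \<and> real (card B) \<le> \<beta> * real d} \<le> exp (\<kappa> / 4 * real d)"
    using card_small_subsets_le[OF \<kappa>4] by metis
  define n where "n = real (card L)"
  have n: "0 \<le> n" by (simp add: n_def)
  define \<beta> where "\<beta> = min \<beta>0 (\<kappa> / (8 * (n + 1) * (lm + 1)))"
  have n1: "0 < 8 * (n + 1) * (lm + 1)" using n lm by (intro mult_pos_pos) auto
  have \<beta>: "0 < \<beta>" "\<beta> \<le> \<beta>0" "\<beta> \<le> \<kappa> / (8 * (n + 1) * (lm + 1))"
    using \<beta>0(1) pos n1 by (auto simp: \<beta>_def)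
  have \<beta>lm: "\<beta> * n * lm \<le> \<kappa> / 8"
  proof -
    have "\<beta> * (8 * (n + 1) * (lm + 1)) \<le> \<kappa>" using \<beta>(3) n1 by (simp add: pos_le_divide_eq)
    moreover have "n * lm \<le> (n + 1) * (lm + 1)" using n lm by (intro mult_mono) auto
    then have "\<beta> * (n * lm) \<le> \<beta> * ((n + 1) * (lm + 1))" using \<beta>(1) by (intro mult_left_mono) auto
    moreover have "\<beta> * (8 * (n + 1) * (lm + 1)) = 8 * (\<beta> * ((n + 1) * (lm + 1)))"
      "\<beta> * n * lm = \<beta> * (n * lm)" by (simp_all only: mult_ac)
    ultimately show ?thesis by linarith
  qed
  define \<delta>' where "\<delta>' = \<tau> * sqrt \<beta> / (n + 1)"
  have \<delta>': "0 < \<delta>'" using \<tau> \<beta> n by (auto simp: \<delta>'_def)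
  have \<delta>'2: "(n + 1) * (n * \<delta>'\<^sup>2) \<le> \<beta> * \<tau>\<^sup>2"
  proof -
    have "(n + 1) * (n * \<delta>'\<^sup>2) \<le> (n + 1) * ((n + 1) * \<delta>'\<^sup>2)"
      using n by (intro mult_left_mono mult_right_mono) auto
    also have "\<dots> = ((n + 1) * \<delta>')\<^sup>2" by (simp add: power2_eq_square algebra_simps)
    also have "(n + 1) * \<delta>' = \<tau> * sqrt \<beta>" using n by (simp add: \<delta>'_def)
    finally show ?thesis using \<beta>(1) by (simp add: power_mult_distrib mult.commute)
  qed
  have "\<forall>\<^sub>F i in sequentially. 1 \<le> d i"
    using sofic by (simp add: sofic_approximation_def filterlim_at_top)
  moreover have "\<forall>\<^sub>F i in sequentially. \<exists>T. quasi_tiling \<eta> (\<sigma> i) (good_centres G (d i) (\<sigma> i) L) T \<and>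
        shape ` T \<subseteq> FF \<and> real (d i) - card (covered (\<sigma> i) T) \<le> \<zeta> * d i"
    using Lsub(4) by (intro FF(3) L) auto
  ultimately have ev: "\<forall>\<^sub>F i in sequentially.
      elog (N_cond (d i) \<pi> \<epsilon> (sofic_Map X actX \<rho>X L \<delta>' (d i) (\<sigma> i)) \<theta> \<rho>X \<rho>Y) / ereal (real (d i)) \<le> ereal (a + \<kappa>)"
  proof eventually_elim
    case (elim i)
    define D where "D = d i"
    have D: "0 < D" using elim by (simp add: D_def)
    obtain T where T: "quasi_tiling \<eta> (\<sigma> i) (good_centres G D (\<sigma> i) L) T"
        "shape ` T \<subseteq> FF" "real D - card (covered (\<sigma> i) T) \<le> \<zeta> * D"
      using elim by (auto simp: D_def)
    have perm: "\<sigma> i s permutes {1..D}" if "s \<in> L" for s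
      using sofic that L(2) by (auto simp: D_def sofic_approximation_def)
    have covD: "covered (\<sigma> i) T \<subseteq> {1..D}"
    proof
      fix v assume "v \<in> covered (\<sigma> i) T"
      then obtain t s where t: "t \<in> T" "s \<in> part t" "v = \<sigma> i s (centre t)"
        by (auto simp: covered_def region_def)
      have "s \<in> L" using quasi_tilingD(5)[OF T(1) t(1)] t T(2) Lsub(4) by blast
      moreover have "centre t \<in> {1..D}" using quasi_tilingD(4)[OF T(1) t(1)] by (auto simp: good_centres_def)
      ultimately show "v \<in> {1..D}" using permutes_in_image[OF perm] t(3) by auto
    qed
    have unc: "card ({1..D} - covered (\<sigma> i) T) \<le> \<zeta> * D"
      using T(3) covD card_mono[OF _ covD] by (simp add: card_Diff_subset finite_subset of_nat_diff)
    define S where "S = (\<Sum>t\<in>T. real (card (shape t)))"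
    have aS: "a * S \<le> (a + \<kappa> / 4) * D"
    proof -
      have "card (covered (\<sigma> i) T) \<le> D" using card_mono[OF _ covD] by simp
      then have SD: "(1 - \<eta>) * S \<le> D" using sum_card_shape_le[OF T(1)] unfolding S_def by linarith
      have S0: "0 \<le> S" unfolding S_def by (intro sum_nonneg) auto
      have "1/2 * S \<le> (1 - \<eta>) * S" using \<eta> S0 by (intro mult_right_mono) auto
      then have S2: "S \<le> 2 * D" using SD by linarith
      have "a * \<eta> \<le> \<kappa> / 8"
      proof -
        have "\<eta> * (8 * (a + 1)) \<le> \<kappa>" using \<eta>(3) pos by (simp add: pos_le_divide_eq)
        moreover have "a * \<eta> \<le> (a + 1) * \<eta>" using \<eta> by (intro mult_right_mono) auto
        ultimately show ?thesis by (simp add: algebra_simps)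
      qed
      then have "a * \<eta> * S \<le> \<kappa> / 8 * (2 * D)" using S2 S0 pos \<eta> by (intro mult_mono) auto
      moreover have "a * ((1 - \<eta>) * S) \<le> a * D" using SD pos by (intro mult_left_mono) auto
      ultimately show ?thesis by (simp add: algebra_simps)
    qed
    have key: "card E \<le> exp ((a + \<kappa>) * D)"
      if E: "finite E" "E \<subseteq> sofic_Map X actX \<rho>X L \<delta>' D (\<sigma> i)"
        "\<And>\<phi> \<phi>'. \<phi> \<in> E \<Longrightarrow> \<phi>' \<in> E \<Longrightarrow> \<phi> \<noteq> \<phi>' \<Longrightarrow>
           rho_infty D fibre_dist \<phi> \<phi>' \<le> \<theta> \<and> \<epsilon> \<le> rho_infty D \<rho>X \<phi> \<phi>'" for E
    proof -
      define \<B> where "\<B> = {B. B \<subseteq> {1..D} \<and> real (card B) \<le> \<beta> * real D}"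
      have fin\<B>: "finite \<B>" by (simp add: \<B>_def)
      have ex\<B>: "exceptional_nbhd D (\<sigma> i) L \<tau> \<phi> \<in> \<B>" if "\<phi> \<in> E" for \<phi>
      proof -
        have "card (exceptional_nbhd D (\<sigma> i) L \<tau> \<phi>) * \<tau>\<^sup>2 \<le> (card L + 1) * (card L * (\<delta>'\<^sup>2 * D))"
          using card_exceptional_nbhd[OF _ L \<tau>(1) perm] E(2) that by auto
        also have "\<dots> = ((n + 1) * (n * \<delta>'\<^sup>2)) * D" by (simp add: n_def mult_ac add_ac)
        also have "\<dots> \<le> (\<beta> * \<tau>\<^sup>2) * D" using \<delta>'2 by (intro mult_right_mono) auto
        finally have "card (exceptional_nbhd D (\<sigma> i) L \<tau> \<phi>) * \<tau>\<^sup>2 \<le> (\<beta> * D) * \<tau>\<^sup>2" by (simp add: mult_ac)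
        then have "card (exceptional_nbhd D (\<sigma> i) L \<tau> \<phi>) \<le> \<beta> * D" using \<tau>(1) by simp
        then show ?thesis by (auto simp: \<B>_def exceptional_nbhd_def exceptional_def)
      qed
      define EB where "EB B = {\<phi>\<in>E. exceptional_nbhd D (\<sigma> i) L \<tau> \<phi> = B}" for B
      have EBle: "card (EB B) \<le> exp ((a + \<kappa> / 4) * D + \<kappa> / 4 * D)" if B: "B \<in> \<B>" for B
      proof -
        have "card (EB B) \<le> exp (a * S) * real m ^ (card ({1..D} - covered (\<sigma> i) T) + card B * card L)"
          unfolding S_def
        proof (rule card_separated_maps_le[where ?E1.0 = E1 and ?E2.0 = E2 and FF = FF and Q = Q and \<theta> = \<theta> and \<tau> = \<tau> and \<epsilon> = \<epsilon>])
          show "\<exists>P. finite P \<and> P \<subseteq> topspace X \<and> card P \<le> exp (a * card F) \<and>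
            (\<forall>x\<in>topspace X. (\<forall>t\<in>E1. fibre_dist (actX t x0) (actX t x) \<le> 3 * \<theta>) \<longrightarrow>
            (\<exists>p\<in>P. \<forall>s\<in>F. \<rho>X (actX s p) (actX s x) < \<epsilon> / 4))" if F: "F \<in> FF" and x0: "x0 \<in> topspace X" for F x0
          proof -
            obtain P where P: "finite P" "P \<subseteq> topspace X" "card P \<le> exp (a * card F)"
              "\<And>x. x \<in> topspace X \<Longrightarrow> (\<And>t. t \<in> EF F \<Longrightarrow> fibre_dist (actX t x0) (actX t x) \<le> \<theta>F F) \<Longrightarrow>
                \<exists>p\<in>P. \<forall>s\<in>F. \<rho>X (actX s p) (actX s x) < \<epsilon> / 4"
              using EF(4)[OF F x0] by metis
            have "\<exists>p\<in>P. \<forall>s\<in>F. \<rho>X (actX s p) (actX s x) < \<epsilon> / 4"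
              if x: "x \<in> topspace X" and le: "\<forall>t\<in>E1. fibre_dist (actX t x0) (actX t x) \<le> 3 * \<theta>" for x
            proof (rule P(4)[OF x])
              fix t assume "t \<in> EF F"
              then have "t \<in> E1" using F by (auto simp: E1_def)
              then show "fibre_dist (actX t x0) (actX t x) \<le> \<theta>F F" using le \<theta>le[OF F] by force
            qed
            then show ?thesis using P(1-3) by blast
          qed
          show "fibre_dist x x' \<le> \<theta>" if "x \<in> topspace X" "x' \<in> topspace X"
            "\<And>u. u \<in> E2 \<Longrightarrow> \<rho>X (actX u x) (actX u x') \<le> 2 * \<tau>" for x x'
            using E2(4)[OF that(1,2)] that(3) \<tau>(3) by (meson order_trans)
          show "finite (EB B)" using E(1) by (simp add: EB_def)
          show "EB B \<subseteq> {1..D} \<rightarrow>\<^sub>E topspace X" using E(2) by (auto simp: EB_def sofic_Map_def)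
          show "rho_infty D fibre_dist \<phi> \<phi>' \<le> \<theta> \<and> \<epsilon> \<le> rho_infty D \<rho>X \<phi> \<phi>'"
            if "\<phi> \<in> EB B" "\<phi>' \<in> EB B" "\<phi> \<noteq> \<phi>'" for \<phi> \<phi>'
            using E(3) that by (simp add: EB_def)
          show "exceptional_nbhd D (\<sigma> i) L \<tau> \<phi> \<subseteq> B" if "\<phi> \<in> EB B" for \<phi> using that by (simp add: EB_def)
          show "B \<subseteq> {1..D}" using B by (simp add: \<B>_def)
        qed (use D L Lsub perm T \<tau> pos Q m \<theta> in auto)
        also have "real m ^ (card ({1..D} - covered (\<sigma> i) T) + card B * card L) =
            exp ((card ({1..D} - covered (\<sigma> i) T) + card B * n) * lm)"
          using m(1) by (simp add: lm_def n_def exp_of_nat_mult flip: of_nat_mult of_nat_add)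
        also have "exp (a * S) * exp ((card ({1..D} - covered (\<sigma> i) T) + card B * n) * lm) =
          exp (a * S + (card ({1..D} - covered (\<sigma> i) T) + card B * n) * lm)" by (simp add: exp_add)
        also have "\<dots> \<le> exp ((a + \<kappa> / 4) * D + \<kappa> / 4 * D)"
        proof -
          have "card B \<le> \<beta> * D" using B by (simp add: \<B>_def)
          then have "(card ({1..D} - covered (\<sigma> i) T) + card B * n) * lm \<le> (\<zeta> * D + \<beta> * D * n) * lm"
            using unc n lm by (intro mult_right_mono add_mono) auto
          also have "\<dots> = \<zeta> * lm * D + \<beta> * n * lm * D" by (simp add: algebra_simps)
          also have "\<dots> \<le> \<kappa> / 8 * D + \<kappa> / 8 * D" using \<zeta>(2) \<beta>lm by (intro add_mono mult_right_mono) auto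
          finally show ?thesis using aS by simp
        qed
        finally show ?thesis .
      qed
      have "E = (\<Union>B\<in>\<B>. EB B)" using ex\<B> by (auto simp: EB_def)
      then have "card E \<le> (\<Sum>B\<in>\<B>. card (EB B))" using card_UN_le[OF fin\<B>] by metis
      then have "real (card E) \<le> real (\<Sum>B\<in>\<B>. card (EB B))" by (rule of_nat_mono)
      also have "\<dots> = (\<Sum>B\<in>\<B>. real (card (EB B)))" by simp
      also have "\<dots> \<le> (\<Sum>B\<in>\<B>. exp ((a + \<kappa> / 4) * D + \<kappa> / 4 * D))" by (intro sum_mono EBle)
      also have "\<dots> = card \<B> * exp ((a + \<kappa> / 4) * D + \<kappa> / 4 * D)" by simp
      also have "\<dots> \<le> exp (\<kappa> / 4 * D) * exp ((a + \<kappa> / 4) * D + \<kappa> / 4 * D)"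
        using \<beta>0(2)[OF \<beta>(2), of D] by (intro mult_right_mono) (auto simp: \<B>_def)
      also have "\<dots> = exp ((a + 3 * \<kappa> / 4) * D)" by (simp flip: exp_add add: algebra_simps)
      also have "\<dots> \<le> exp ((a + \<kappa>) * D)" using pos by (simp add: mult_right_mono)
      finally show ?thesis .
    qed
    have "rho_infty D \<rho>Y (\<pi> \<circ> \<phi>) (\<pi> \<circ> \<phi>') = rho_infty D fibre_dist \<phi> \<phi>'" for \<phi> \<phi>'
      by (simp add: rho_infty_def fibre_dist_def)
    then have "elog (N_cond D \<pi> \<epsilon> (sofic_Map X actX \<rho>X L \<delta>' D (\<sigma> i)) \<theta> \<rho>X \<rho>Y) \<le> ereal ((a + \<kappa>) * D)"
      unfolding N_cond_def elog_max_card_le_iff using key by simp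
    then have "elog (N_cond D \<pi> \<epsilon> (sofic_Map X actX \<rho>X L \<delta>' D (\<sigma> i)) \<theta> \<rho>X \<rho>Y) / ereal D \<le> ereal (a + \<kappa>)"
      using D by (simp add: ereal_divide_le_pos mult.commute)
    then show ?case by (simp add: D_def)
  qed
  have "h_sofic G d \<sigma> X actX \<pi> \<rho>X \<rho>Y \<epsilon> \<le>
      limsup (\<lambda>i. elog (N_cond (d i) \<pi> \<epsilon> (sofic_Map X actX \<rho>X L \<delta>' (d i) (\<sigma> i)) \<theta> \<rho>X \<rho>Y) / ereal (real (d i)))"
    unfolding h_sofic_def using \<theta> \<delta>' LK
    by (intro INF_lower2[of \<theta>] INF_lower2[of L] INF_lower2[of \<delta>']) auto
  also have "\<dots> \<le> ereal (a + \<kappa>)" using ev by (rule Limsup_bounded)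
  finally show ?thesis .
qed

subsection \<open>Lower bound\<close>

lemma separated_on_part:
  assumes E: "finite E" "E \<subseteq> topspace X" and F: "finite F" "F \<subseteq> carrier G" "P \<subseteq> F"
    and sep: "\<And>x x'. x \<in> E \<Longrightarrow> x' \<in> E \<Longrightarrow> x \<noteq> x' \<Longrightarrow> \<exists>s\<in>F. \<epsilon> \<le> \<rho>X (actX s x) (actX s x')"
    and Q: "finite Q" "Q \<subseteq> topspace X" "\<And>x. x \<in> topspace X \<Longrightarrow> \<exists>q\<in>Q. \<rho>X q x < \<epsilon> / 2"
      "1 \<le> m" "card Q \<le> m"
  shows "\<exists>E'. E' \<subseteq> E \<and> card E \<le> card E' * m ^ card (F - P) \<and>
    (\<forall>x\<in>E'. \<forall>x'\<in>E'. x \<noteq> x' \<longrightarrow> (\<exists>s\<in>P. \<epsilon> \<le> \<rho>X (actX s x) (actX s x')))"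
proof (cases "E = {}")
  case False
  obtain nm where nm: "\<And>x. x \<in> topspace X \<Longrightarrow> nm x \<in> Q" "\<And>x. x \<in> topspace X \<Longrightarrow> \<rho>X (nm x) x < \<epsilon> / 2"
    using Q(3) by metis
  have val: "actX s x \<in> topspace X" if "x \<in> E" "s \<in> F" for x s
    using that E(2) F(2) act_closed by blast
  define f where "f x = (\<lambda>s\<in>F - P. nm (actX s x))" for x
  define C where "C = PiE (F - P) (\<lambda>_. Q)"
  have finC: "finite C" unfolding C_def using F(1) Q(1) by (intro finite_PiE) auto
  have fC: "f x \<in> C" if "x \<in> E" for x
    using that val nm(1) by (auto simp: f_def C_def)
  have card_C: "card C \<le> m ^ card (F - P)"
    unfolding C_def using F(1) Q(5) by (simp add: card_PiE power_mono)
  have "C \<noteq> {}" using False fC by auto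
  then obtain b where "card E \<le> card (f -` {b} \<inter> E) * card C"
    using pigeonhole_card[of f E C] fC E(1) finC by auto
  moreover have "f -` {b} \<inter> E = {x\<in>E. f x = b}" by auto
  ultimately have b: "card E \<le> card {x\<in>E. f x = b} * card C" by simp
  show ?thesis
  proof (intro exI[of _ "{x\<in>E. f x = b}"] conjI ballI impI)
    show "card E \<le> card {x\<in>E. f x = b} * m ^ card (F - P)"
      using b card_C by (meson mult_le_mono2 order_trans)
    fix x x' assume x: "x \<in> {x\<in>E. f x = b}" "x' \<in> {x\<in>E. f x = b}" "x \<noteq> x'"
    then obtain s where s: "s \<in> F" "\<epsilon> \<le> \<rho>X (actX s x) (actX s x')" using sep[of x x'] by auto
    have "s \<in> P"
    proof (rule ccontr)
      assume "s \<notin> P"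
      have "f x s = f x' s" using x by simp
      then have eq: "nm (actX s x) = nm (actX s x')" using s(1) \<open>s \<notin> P\<close> by (simp add: f_def)
      have v: "actX s x \<in> topspace X" "actX s x' \<in> topspace X" using val x s(1) by auto
      have q: "nm (actX s x) \<in> topspace X" using nm(1)[OF v(1)] Q(2) by auto
      show False
        using s(2) nm(2)[OF v(1)] nm(2)[OF v(2)] eq rhoX(4)[OF v(1) q v(2)] rhoX(3)[OF q v(1)] by simp
    qed
    then show "\<exists>s\<in>P. \<epsilon> \<le> \<rho>X (actX s x) (actX s x')" using s(2) by auto
  qed auto
qed auto

text \<open>Independent choices, for each tile, of a point of the separated set attached to the tile.\<close>

lemma tile_product_maps:
  fixes \<epsilon> \<theta> \<delta> M :: real
  assumes "0 < d" and L: "L \<subseteq> carrier G" "F0 \<subseteq> L"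
    and perm: "\<And>s. s \<in> L \<Longrightarrow> \<sigma> s permutes {1..d}"
    and T: "quasi_tiling \<eta> \<sigma> (good_centres G d \<sigma> L) T" "\<And>t. t \<in> T \<Longrightarrow> shape t \<subseteq> L"
    and E: "\<And>t. t \<in> T \<Longrightarrow> finite (E t)" "\<And>t. t \<in> T \<Longrightarrow> E t \<subseteq> topspace X"
      "\<And>t x x'. t \<in> T \<Longrightarrow> x \<in> E t \<Longrightarrow> x' \<in> E t \<Longrightarrow> \<pi> x = \<pi> x'"
      "\<And>t x x'. t \<in> T \<Longrightarrow> x \<in> E t \<Longrightarrow> x' \<in> E t \<Longrightarrow> x \<noteq> x' \<Longrightarrow>
         \<exists>s\<in>part t. \<epsilon> \<le> \<rho>X (actX s x) (actX s x')"
    and x0: "x0 \<in> topspace X"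
    and M: "0 \<le> M" "\<And>x y. x \<in> topspace X \<Longrightarrow> y \<in> topspace X \<Longrightarrow> \<rho>X x y \<le> M"
    and bad: "\<And>s. s \<in> F0 \<Longrightarrow>
       M\<^sup>2 * (real (card ({1..d} - covered \<sigma> T)) + (\<Sum>t\<in>T. real (card {u\<in>part t. s \<otimes> u \<notin> part t}))) \<le> \<delta>\<^sup>2 * d"
    and pos: "0 < \<epsilon>" "0 \<le> \<theta>" "0 < \<delta>"
  shows "\<exists>\<E>. finite \<E> \<and> card \<E> = (\<Prod>t\<in>T. card (E t)) \<and> \<E> \<subseteq> sofic_Map X actX \<rho>X F0 \<delta> d \<sigma> \<and>
    (\<forall>\<phi>\<in>\<E>. \<forall>\<phi>'\<in>\<E>. \<phi> \<noteq> \<phi>' \<longrightarrow>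
       rho_infty d \<rho>Y (\<pi> \<circ> \<phi>) (\<pi> \<circ> \<phi>') \<le> \<theta> \<and> \<epsilon> \<le> rho_infty d \<rho>X \<phi> \<phi>')"
proof -
  have finT: "finite T" using quasi_tilingD(1)[OF T(1)] .
  have sL: "s \<in> L" "s \<in> shape t" "s \<in> carrier G" if "t \<in> T" "s \<in> part t" for t s
    using quasi_tilingD(5)[OF T(1) that(1)] T(2)[OF that(1)] that(2) L(1) by auto
  have cen: "centre t \<in> {1..d}" "centre t \<in> good_centres G d \<sigma> L" if "t \<in> T" for t
    using quasi_tilingD(4)[OF T(1) that] by (auto simp: good_centres_def)
  have in_d: "\<sigma> s v \<in> {1..d}" if "s \<in> L" "v \<in> {1..d}" for s v
    using that permutes_in_image[OF perm] by auto
  have "\<exists>t s. t \<in> T \<and> s \<in> part t \<and> v = \<sigma> s (centre t)" if "v \<in> covered \<sigma> T" for v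
    using that by (auto simp: covered_def region_def)
  then obtain tv sv where tv: "\<And>v. v \<in> covered \<sigma> T \<Longrightarrow> tv v \<in> T"
      "\<And>v. v \<in> covered \<sigma> T \<Longrightarrow> sv v \<in> part (tv v)"
      "\<And>v. v \<in> covered \<sigma> T \<Longrightarrow> v = \<sigma> (sv v) (centre (tv v))" by metis
  have cov: "\<sigma> s (centre t) \<in> covered \<sigma> T" if "t \<in> T" "s \<in> part t" for t s
    using that by (auto simp: covered_def region_def)
  have tv_eq: "tv (\<sigma> s (centre t)) = t" "sv (\<sigma> s (centre t)) = s" if t: "t \<in> T" "s \<in> part t" for t s
  proof -
    let ?v = "\<sigma> s (centre t)"
    have "?v \<in> region \<sigma> t" using t by (auto simp: region_def)
    moreover have "?v \<in> region \<sigma> (tv ?v)"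
      unfolding region_def using tv(2,3)[OF cov[OF t]] by blast
    ultimately show 1: "tv ?v = t"
      using quasi_tilingD(2)[OF T(1)] t tv(1)[OF cov[OF t]] unfolding disjoint_family_on_def by blast
    have "sv ?v \<in> part t" "\<sigma> s (centre t) = \<sigma> (sv ?v) (centre t)"
      using tv(2,3)[OF cov[OF t]] 1 by simp_all
    then show "sv ?v = s"
      using inj_onD[OF quasi_tilingD(7)[OF T(1) t(1)]] sL(2)[OF t(1)] t(2) by metis
  qed
  define \<Phi> where "\<Phi> \<xi> = (\<lambda>v\<in>{1..d}. if v \<in> covered \<sigma> T then actX (sv v) (\<xi> (tv v)) else x0)" for \<xi>
  have \<Phi>_tile: "\<Phi> \<xi> (\<sigma> s (centre t)) = actX s (\<xi> t)" if "t \<in> T" "s \<in> part t" for \<xi> s t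
    using that cov tv_eq in_d[OF sL(1) cen(1)] by (simp add: \<Phi>_def)
  have \<Phi>_out: "\<Phi> \<xi> v = x0" if "v \<in> {1..d}" "v \<notin> covered \<sigma> T" for \<xi> v
    using that by (simp add: \<Phi>_def)
  have cov_cases: "\<exists>t s. t \<in> T \<and> s \<in> part t \<and> v = \<sigma> s (centre t)" if "v \<in> covered \<sigma> T" for v
    using tv[OF that] by blast
  have \<xi>X: "\<xi> t \<in> topspace X" if "\<xi> \<in> PiE T E" "t \<in> T" for \<xi> t
    using that E(2) by (meson PiE_mem subsetD)
  have \<Phi>X: "\<Phi> \<xi> v \<in> topspace X" if \<xi>: "\<xi> \<in> PiE T E" and v: "v \<in> {1..d}" for \<xi> v
  proof (cases "v \<in> covered \<sigma> T")
    case True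
    then obtain t s where t: "t \<in> T" "s \<in> part t" "v = \<sigma> s (centre t)" using cov_cases by blast
    show ?thesis unfolding t(3) \<Phi>_tile[OF t(1,2)] using act_closed[OF sL(3)[OF t(1,2)]] \<xi>X[OF \<xi> t(1)] .
  qed (use v x0 \<Phi>_out in auto)
  have sepE: "\<epsilon> \<le> rho_infty d \<rho>X (\<Phi> \<xi>) (\<Phi> \<xi>')"
    if \<xi>: "\<xi> \<in> PiE T E" "\<xi>' \<in> PiE T E" "\<xi> \<noteq> \<xi>'" for \<xi> \<xi>'
  proof -
    obtain t where t: "t \<in> T" "\<xi> t \<noteq> \<xi>' t" using \<xi> PiE_ext by blast
    then obtain s where s: "s \<in> part t" "\<epsilon> \<le> \<rho>X (actX s (\<xi> t)) (actX s (\<xi>' t))"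
      using E(4)[OF t(1) _ _ t(2)] \<xi> by (meson PiE_mem)
    have "\<sigma> s (centre t) \<in> {1..d}" using in_d[OF sL(1)[OF t(1) s(1)] cen(1)[OF t(1)]] .
    then show ?thesis unfolding rho_infty_ge_iff[OF \<open>0 < d\<close>]
      using s(2) \<Phi>_tile[OF t(1) s(1)] by metis
  qed
  have inj: "inj_on \<Phi> (PiE T E)"
  proof (rule inj_onI, rule ccontr)
    fix \<xi> \<xi>' assume \<xi>: "\<xi> \<in> PiE T E" "\<xi>' \<in> PiE T E" "\<Phi> \<xi> = \<Phi> \<xi>'" "\<xi> \<noteq> \<xi>'"
    then have "\<epsilon> \<le> rho_infty d \<rho>X (\<Phi> \<xi>) (\<Phi> \<xi>)" using sepE[OF \<xi>(1,2,4)] by simp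
    then show False using pos(1) rhoX(1) \<Phi>X[OF \<xi>(1)] by (auto simp: rho_infty_ge_iff[OF \<open>0 < d\<close>])
  qed
  have fibE: "rho_infty d \<rho>Y (\<pi> \<circ> \<Phi> \<xi>) (\<pi> \<circ> \<Phi> \<xi>') \<le> \<theta>"
    if \<xi>: "\<xi> \<in> PiE T E" "\<xi>' \<in> PiE T E" for \<xi> \<xi>'
    unfolding rho_infty_le_iff[OF \<open>0 < d\<close>]
  proof
    fix v assume v: "v \<in> {1..d}"
    have "\<pi> (\<Phi> \<xi> v) = \<pi> (\<Phi> \<xi>' v)"
    proof (cases "v \<in> covered \<sigma> T")
      case True
      then obtain t s where t: "t \<in> T" "s \<in> part t" "v = \<sigma> s (centre t)" using cov_cases by blast
      have "\<pi> (\<xi> t) = \<pi> (\<xi>' t)" using E(3)[OF t(1)] \<xi> t(1) by (meson PiE_mem)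
      then show ?thesis unfolding t(3) \<Phi>_tile[OF t(1,2)]
        using \<pi>_act[OF sL(3)[OF t(1,2)] \<xi>X[OF \<xi>(1) t(1)]] \<pi>_act[OF sL(3)[OF t(1,2)] \<xi>X[OF \<xi>(2) t(1)]] by simp
    qed (use v \<Phi>_out in auto)
    then show "\<rho>Y ((\<pi> \<circ> \<Phi> \<xi>) v) ((\<pi> \<circ> \<Phi> \<xi>') v) \<le> \<theta>"
      using continuous_pseudometricD(1)[OF psY \<pi>_closed[OF \<Phi>X[OF \<xi>(2) v]]] pos(2) by simp
  qed
  have "\<Phi> \<xi> \<in> sofic_Map X actX \<rho>X F0 \<delta> d \<sigma>" if \<xi>: "\<xi> \<in> PiE T E" for \<xi>
    unfolding sofic_Map_def
  proof (intro CollectI conjI ballI)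
    show "\<Phi> \<xi> \<in> {1..d} \<rightarrow>\<^sub>E topspace X" using \<Phi>X[OF \<xi>] by (auto simp: \<Phi>_def)
    fix s assume s: "s \<in> F0"
    then have sF: "s \<in> L" "s \<in> carrier G" using L by auto
    let ?g = "\<lambda>v. \<rho>X (actX s (\<Phi> \<xi> v)) ((\<Phi> \<xi> \<circ> \<sigma> s) v)"
    define R where "R = (\<Union>t\<in>T. (\<lambda>u. \<sigma> u (centre t)) ` {u\<in>part t. s \<otimes> u \<notin> part t})"
    define Z where "Z = ({1..d} - covered \<sigma> T) \<union> R"
    have finP: "finite (part t)" if "t \<in> T" for t
      using quasi_tilingD(3,5)[OF T(1) that] finite_subset by blast
    have finZ: "finite Z" unfolding Z_def R_def using finT finP by auto
    have gv: "0 \<le> ?g v" "?g v \<le> M" if "v \<in> {1..d}" for v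
      using rhoX(2) M(2) act_closed[OF sF(2)] \<Phi>X[OF \<xi>] in_d[OF sF(1)] that by auto
    have g0: "?g v = 0" if v: "v \<in> {1..d}" "v \<notin> Z" for v
    proof -
      have "v \<in> covered \<sigma> T" using v by (auto simp: Z_def)
      then obtain t u where t: "t \<in> T" "u \<in> part t" "v = \<sigma> u (centre t)" using cov_cases by blast
      have su: "s \<otimes> u \<in> part t" using v(2) t by (auto simp: Z_def R_def)
      have "\<sigma> s v = \<sigma> (s \<otimes> u) (centre t)"
        using cen(2)[OF t(1)] sF(1) sL(1)[OF t(1,2)] t(3) by (auto simp: good_centres_def)
      then have "(\<Phi> \<xi> \<circ> \<sigma> s) v = actX (s \<otimes> u) (\<xi> t)" using \<Phi>_tile[OF t(1) su] by simp
      also have "\<dots> = actX s (actX u (\<xi> t))" using act_mult[OF sF(2) sL(3)[OF t(1,2)] \<xi>X[OF \<xi> t(1)]] .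
      also have "\<dots> = actX s (\<Phi> \<xi> v)" using \<Phi>_tile[OF t(1,2)] t(3) by simp
      finally show ?thesis using rhoX(1) act_closed[OF sF(2) \<Phi>X[OF \<xi> v(1)]] by simp
    qed
    have "(\<Sum>v\<in>{1..d}. (?g v)\<^sup>2) = (\<Sum>v\<in>{1..d} \<inter> Z. (?g v)\<^sup>2)"
      using g0 by (intro sum.mono_neutral_right) auto
    also have "\<dots> \<le> (\<Sum>v\<in>{1..d} \<inter> Z. M\<^sup>2)" using gv by (intro sum_mono power_mono) auto
    also have "\<dots> = M\<^sup>2 * card ({1..d} \<inter> Z)" by simp
    also have "\<dots> \<le> M\<^sup>2 * (real (card ({1..d} - covered \<sigma> T)) + (\<Sum>t\<in>T. real (card {u\<in>part t. s \<otimes> u \<notin> part t})))"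
    proof (rule mult_left_mono)
      have "card ({1..d} \<inter> Z) \<le> card Z" using finZ by (intro card_mono) auto
      also have "\<dots> \<le> card ({1..d} - covered \<sigma> T) + card R" unfolding Z_def by (rule card_Un_le)
      also have "card R \<le> (\<Sum>t\<in>T. card ((\<lambda>u. \<sigma> u (centre t)) ` {u\<in>part t. s \<otimes> u \<notin> part t}))"
        unfolding R_def by (rule card_UN_le[OF finT])
      also have "\<dots> \<le> (\<Sum>t\<in>T. card {u\<in>part t. s \<otimes> u \<notin> part t})"
        using finP by (intro sum_mono card_image_le) auto
      finally have "card ({1..d} \<inter> Z) \<le> card ({1..d} - covered \<sigma> T) + (\<Sum>t\<in>T. card {u\<in>part t. s \<otimes> u \<notin> part t})" by simp
      then have "real (card ({1..d} \<inter> Z)) \<le> real (card ({1..d} - covered \<sigma> T) + (\<Sum>t\<in>T. card {u\<in>part t. s \<otimes> u \<notin> part t}))"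
        by (rule of_nat_mono)
      then show "real (card ({1..d} \<inter> Z)) \<le> real (card ({1..d} - covered \<sigma> T)) + (\<Sum>t\<in>T. real (card {u\<in>part t. s \<otimes> u \<notin> part t}))"
        by simp
    qed simp
    also have "\<dots> \<le> \<delta>\<^sup>2 * d" using bad[OF s] .
    finally have "1 / real d * (\<Sum>v\<in>{1..d}. (?g v)\<^sup>2) \<le> \<delta>\<^sup>2" using \<open>0 < d\<close> by (simp add: field_simps)
    then show "rho_two d \<rho>X (\<lambda>v. actX s (\<Phi> \<xi> v)) (\<Phi> \<xi> \<circ> \<sigma> s) \<le> \<delta>"
      unfolding rho_two_def using pos(3) by (intro real_le_lsqrt) auto
  qed
  then have "\<Phi> ` PiE T E \<subseteq> sofic_Map X actX \<rho>X F0 \<delta> d \<sigma>" by blast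
  moreover have "finite (\<Phi> ` PiE T E)" using finT E(1) by (intro finite_imageI finite_PiE)
  moreover have "card (\<Phi> ` PiE T E) = (\<Prod>t\<in>T. card (E t))"
    using finT by (simp add: card_image[OF inj] card_PiE)
  moreover have "\<forall>\<phi>\<in>\<Phi> ` PiE T E. \<forall>\<phi>'\<in>\<Phi> ` PiE T E. \<phi> \<noteq> \<phi>' \<longrightarrow>
      rho_infty d \<rho>Y (\<pi> \<circ> \<phi>) (\<pi> \<circ> \<phi>') \<le> \<theta> \<and> \<epsilon> \<le> rho_infty d \<rho>X \<phi> \<phi>'"
  proof (intro ballI impI)
    fix \<phi> \<phi>' assume "\<phi> \<in> \<Phi> ` PiE T E" "\<phi>' \<in> \<Phi> ` PiE T E" "\<phi> \<noteq> \<phi>'"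
    then obtain \<xi> \<xi>' where "\<phi> = \<Phi> \<xi>" "\<phi>' = \<Phi> \<xi>'" "\<xi> \<in> PiE T E" "\<xi>' \<in> PiE T E" "\<xi> \<noteq> \<xi>'" by blast
    then show "rho_infty d \<rho>Y (\<pi> \<circ> \<phi>) (\<pi> \<circ> \<phi>') \<le> \<theta> \<and> \<epsilon> \<le> rho_infty d \<rho>X \<phi> \<phi>'"
      using fibE sepE by simp
  qed
  ultimately show ?thesis by (intro exI[of _ "\<Phi> ` PiE T E"] conjI)
qed

lemma h_sofic_ge:
  fixes a \<epsilon> \<kappa> :: real
  assumes sofic: "sofic_approximation G d \<sigma>" and pos: "0 < \<epsilon>" "0 \<le> a" "0 < \<kappa>"
    and ne: "topspace X \<noteq> {}"
    and N: "\<And>K \<delta>. K \<in> fin_subsets G \<Longrightarrow> 0 < \<delta> \<Longrightarrow> \<exists>F\<in>almost_invariant G K \<delta>. \<exists>y E. finite E \<and>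
       E \<subseteq> fibre y \<and> (\<forall>x\<in>E. \<forall>x'\<in>E. x \<noteq> x' \<longrightarrow> \<epsilon> \<le> rho_F actX \<rho>X F x x') \<and> exp (a * card F) \<le> card E"
  shows "ereal (a - \<kappa>) \<le> h_sofic G d \<sigma> X actX \<pi> \<rho>X \<rho>Y \<epsilon>"
  unfolding h_sofic_def
proof (intro INF_greatest)
  fix \<theta> \<delta> :: real and F0 assume "\<theta> \<in> {0<..}" and F0: "F0 \<in> fin_subsets G" and "\<delta> \<in> {0<..}"
  then have \<theta>: "0 < \<theta>" and \<delta>: "0 < \<delta>" by auto
  obtain x0 where x0: "x0 \<in> topspace X" using ne by blast
  obtain M' where M': "\<And>x y. x \<in> topspace X \<Longrightarrow> y \<in> topspace X \<Longrightarrow> \<rho>X x y \<le> M'"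
    using pseudometric_bounded[OF compact psX] by metis
  define M where "M = max 0 M'"
  have M: "0 \<le> M" "\<And>x y. x \<in> topspace X \<Longrightarrow> y \<in> topspace X \<Longrightarrow> \<rho>X x y \<le> M"
    using M' by (auto simp: M_def intro: le_max_iff_disj[THEN iffD2])
  have \<epsilon>2: "0 < \<epsilon> / 2" using pos by simp
  obtain Q where Q: "finite Q" "Q \<subseteq> topspace X" "\<And>x. x \<in> topspace X \<Longrightarrow> \<exists>q\<in>Q. \<rho>X q x < \<epsilon> / 2"
    using pseudometric_net[OF compact psX \<epsilon>2] by metis
  define m where "m = max 1 (card Q)"
  have m: "1 \<le> m" "card Q \<le> m" by (auto simp: m_def)
  define lm where "lm = ln (real m)"
  have lm: "0 \<le> lm" using m by (simp add: lm_def)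
  obtain \<omega> where \<omega>: "0 < \<omega>" "\<omega> \<le> 1/2" "\<omega> * a \<le> \<kappa> / 2" "\<omega> * (2 * lm) \<le> \<kappa> / 2" "M\<^sup>2 * (5 * \<omega>) \<le> \<delta>\<^sup>2"
  proof -
    have small: "\<exists>w>0. \<forall>w'. 0 < w' \<and> w' \<le> w \<longrightarrow> w' * p \<le> q" if "0 \<le> p" "0 < q" for p q :: real
    proof (intro exI conjI allI impI)
      show "0 < q / (p + 1)" using that by simp
      fix w' assume w': "0 < w' \<and> w' \<le> q / (p + 1)"
      have "w' * p \<le> w' * (p + 1)" using w' that by (intro mult_left_mono) auto
      also have "\<dots> \<le> q" using w' that by (simp add: pos_le_divide_eq)
      finally show "w' * p \<le> q" .
    qed
    obtain w1 w2 w3 where w: "w1 > 0" "w2 > 0" "w3 > 0"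
      "\<And>w'. 0 < w' \<Longrightarrow> w' \<le> w1 \<Longrightarrow> w' * a \<le> \<kappa> / 2"
      "\<And>w'. 0 < w' \<Longrightarrow> w' \<le> w2 \<Longrightarrow> w' * (2 * lm) \<le> \<kappa> / 2"
      "\<And>w'. 0 < w' \<Longrightarrow> w' \<le> w3 \<Longrightarrow> w' * (5 * M\<^sup>2) \<le> \<delta>\<^sup>2"
      using small[of a "\<kappa> / 2"] small[of "2 * lm" "\<kappa> / 2"] small[of "5 * M\<^sup>2" "\<delta>\<^sup>2"] pos lm \<delta> by auto
    define w where "w = min (1/2) (min w1 (min w2 w3))"
    have "0 < w" "w \<le> 1/2" "w \<le> w1" "w \<le> w2" "w \<le> w3"
      unfolding w_def using w(1-3) by linarith+
    then show thesis using w(4)[of w] w(5)[of w] w(6)[of w] by (intro that[of w]) (auto simp: mult_ac)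
  qed
  define \<F> where "\<F> = {F \<in> almost_invariant G F0 \<omega>. \<exists>y E. finite E \<and>
       E \<subseteq> fibre y \<and> (\<forall>x\<in>E. \<forall>x'\<in>E. x \<noteq> x' \<longrightarrow> \<epsilon> \<le> rho_F actX \<rho>X F x x') \<and> exp (a * card F) \<le> card E}"
  have cof: "\<F> \<inter> almost_invariant G K' \<delta>' \<noteq> {}" if K': "K' \<in> fin_subsets G" "0 < \<delta>'" for K' \<delta>'
  proof -
    have f: "F0 \<union> K' \<in> fin_subsets G" "finite (F0 \<union> K')" using F0 that by (auto simp: fin_subsets_def)
    obtain F y E where F: "F \<in> almost_invariant G (F0 \<union> K') (min \<omega> \<delta>')"
      "finite E" "E \<subseteq> fibre y" "\<forall>x\<in>E. \<forall>x'\<in>E. x \<noteq> x' \<longrightarrow> \<epsilon> \<le> rho_F actX \<rho>X F x x'" "exp (a * card F) \<le> card E"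
      using N[OF f(1), of "min \<omega> \<delta>'"] \<omega>(1) K'(2) by auto
    have "almost_invariant G (F0 \<union> K') (min \<omega> \<delta>') \<subseteq> almost_invariant G F0 \<omega>"
      "almost_invariant G (F0 \<union> K') (min \<omega> \<delta>') \<subseteq> almost_invariant G K' \<delta>'"
      using f by (intro almost_invariant_mono; simp)+
    then have "F \<in> \<F>" "F \<in> almost_invariant G K' \<delta>'" using F unfolding \<F>_def by blast+
    then show ?thesis by blast
  qed
  obtain FF where FF: "finite FF" "FF \<subseteq> \<F> \<inter> fin_subsets G"
    "\<And>L. finite L \<Longrightarrow> L \<subseteq> carrier G \<Longrightarrow> \<Union>FF \<subseteq> L \<Longrightarrow>
      \<forall>\<^sub>F i in sequentially. \<exists>T. quasi_tiling \<omega> (\<sigma> i) (good_centres G (d i) (\<sigma> i) L) T \<and>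
        shape ` T \<subseteq> FF \<and> real (d i) - card (covered (\<sigma> i) T) \<le> \<omega> * d i"
  proof (rule sofic_quasi_tiling[OF grp sofic cof \<omega>(1,2,1)], assumption, assumption, goal_cases)
    case (1 FF)
    then show ?case by (intro 1(1))
  qed
  have FF': "F \<in> \<F>" "F \<in> fin_subsets G" if "F \<in> FF" for F using FF(2) that by auto
  have FFfin: "finite F" "F \<noteq> {}" "F \<subseteq> carrier G" "F \<in> fin_subsets G" "F \<in> almost_invariant G F0 \<omega>" if "F \<in> FF" for F
    using FF'[OF that] by (simp_all add: fin_subsets_def \<F>_def)
  define separated where "separated F E y \<longleftrightarrow> finite E \<and> E \<subseteq> fibre y \<and>
      (\<forall>x\<in>E. \<forall>x'\<in>E. x \<noteq> x' \<longrightarrow> \<epsilon> \<le> rho_F actX \<rho>X F x x') \<and> exp (a * card F) \<le> card E" for F E y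
  have "\<exists>E y. separated F E y" if F: "F \<in> FF" for F
    using FF'(1)[OF F] unfolding \<F>_def separated_def by blast
  then obtain EF yF where sep: "\<And>F. F \<in> FF \<Longrightarrow> separated F (EF F) (yF F)" by metis
  have EF: "finite (EF F)" "EF F \<subseteq> fibre (yF F)"
      "\<And>x x'. x \<in> EF F \<Longrightarrow> x' \<in> EF F \<Longrightarrow> x \<noteq> x' \<Longrightarrow> \<exists>s\<in>F. \<epsilon> \<le> \<rho>X (actX s x) (actX s x')"
      "exp (a * card F) \<le> card (EF F)" if F: "F \<in> FF" for F
    using sep[OF F] rho_F_ge_iff[OF FFfin(1,2)[OF F]] by (simp_all add: separated_def)
  define L where "L = \<Union>FF \<union> F0"
  have L: "finite L" "L \<subseteq> carrier G" "F0 \<subseteq> L" "\<Union>FF \<subseteq> L"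
    using FF(1) FFfin F0 by (auto simp: L_def fin_subsets_def)
  have "\<forall>\<^sub>F i in sequentially. 1 \<le> d i"
    using sofic by (simp add: sofic_approximation_def filterlim_at_top)
  moreover note FF(3)[OF L(1,2,4)]
  ultimately have ev: "\<forall>\<^sub>F i in sequentially. ereal (a - \<kappa>) \<le>
      elog (N_cond (d i) \<pi> \<epsilon> (sofic_Map X actX \<rho>X F0 \<delta> (d i) (\<sigma> i)) \<theta> \<rho>X \<rho>Y) / ereal (real (d i))"
  proof eventually_elim
    case (elim i)
    define D where "D = d i"
    have D: "0 < D" using elim by (simp add: D_def)
    obtain T where T: "quasi_tiling \<omega> (\<sigma> i) (good_centres G D (\<sigma> i) L) T"
        "shape ` T \<subseteq> FF" "real D - card (covered (\<sigma> i) T) \<le> \<omega> * D"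
      using elim by (auto simp: D_def)
    have perm: "\<sigma> i s permutes {1..D}" if "s \<in> L" for s
      using sofic that L(2) by (auto simp: D_def sofic_approximation_def)
    have shF: "shape t \<in> FF" if "t \<in> T" for t using T(2) that by auto
    have shL: "shape t \<subseteq> L" if "t \<in> T" for t using shF[OF that] L(4) by auto
    have covD: "covered (\<sigma> i) T \<subseteq> {1..D}"
    proof
      fix v assume "v \<in> covered (\<sigma> i) T"
      then obtain t s where t: "t \<in> T" "s \<in> part t" "v = \<sigma> i s (centre t)"
        by (auto simp: covered_def region_def)
      have "s \<in> L" using quasi_tilingD(5)[OF T(1) t(1)] t shL by blast
      moreover have "centre t \<in> {1..D}" using quasi_tilingD(4)[OF T(1) t(1)] by (auto simp: good_centres_def)
      ultimately show "v \<in> {1..D}" using permutes_in_image[OF perm] t(3) by auto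
    qed
    have unc: "card ({1..D} - covered (\<sigma> i) T) \<le> \<omega> * D"
      using T(3) covD card_mono[OF _ covD] by (simp add: card_Diff_subset finite_subset of_nat_diff)
    define S where "S = (\<Sum>t\<in>T. real (card (shape t)))"
    have S0: "0 \<le> S" unfolding S_def by (intro sum_nonneg) auto
    have S2: "S \<le> 2 * D"
    proof -
      have "card (covered (\<sigma> i) T) \<le> D" using card_mono[OF _ covD] by simp
      then have "(1 - \<omega>) * S \<le> D" using sum_card_shape_le[OF T(1)] unfolding S_def by linarith
      moreover have "1/2 * S \<le> (1 - \<omega>) * S" using \<omega> S0 by (intro mult_right_mono) auto
      ultimately show ?thesis by linarith
    qed
    have fin: "finite (shape t)" "part t \<subseteq> shape t" if "t \<in> T" for t
      using quasi_tilingD(3,5)[OF T(1) that] by auto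
    have lost: "card (shape t - part t) \<le> \<omega> * card (shape t)" if "t \<in> T" for t
      using quasi_tilingD(6)[OF T(1) that] fin[OF that] card_mono[OF fin[OF that]]
      by (simp add: card_Diff_subset finite_subset of_nat_diff algebra_simps)
    have S1: "(1 - \<omega>) * D \<le> S"
    proof -
      have "(1 - \<omega>) * D \<le> card (covered (\<sigma> i) T)" using T(3) by (simp add: algebra_simps)
      also have "\<dots> = (\<Sum>t\<in>T. real (card (part t)))" using card_covered[OF T(1)] by simp
      also have "\<dots> \<le> S" unfolding S_def using fin by (intro sum_mono of_nat_mono card_mono) auto
      finally show ?thesis .
    qed
    have "\<exists>E'. E' \<subseteq> EF (shape t) \<and> card (EF (shape t)) \<le> card E' * m ^ card (shape t - part t) \<and>
      (\<forall>x\<in>E'. \<forall>x'\<in>E'. x \<noteq> x' \<longrightarrow> (\<exists>s\<in>part t. \<epsilon> \<le> \<rho>X (actX s x) (actX s x')))" if t: "t \<in> T" for t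
    proof -
      have "EF (shape t) \<subseteq> topspace X" using EF(2)[OF shF[OF t]] by auto
      then show ?thesis
        using shF[OF t] fin(2)[OF t] FFfin(1,3) EF(1,3) Q m
        by (intro separated_on_part[where Q = Q]) auto
    qed
    then obtain E where E: "\<And>t. t \<in> T \<Longrightarrow> E t \<subseteq> EF (shape t)"
      "\<And>t. t \<in> T \<Longrightarrow> card (EF (shape t)) \<le> card (E t) * m ^ card (shape t - part t)"
      "\<And>t x x'. t \<in> T \<Longrightarrow> x \<in> E t \<Longrightarrow> x' \<in> E t \<Longrightarrow> x \<noteq> x' \<Longrightarrow>
         \<exists>s\<in>part t. \<epsilon> \<le> \<rho>X (actX s x) (actX s x')"
      by metis
    have bad: "M\<^sup>2 * (real (card ({1..D} - covered (\<sigma> i) T)) + (\<Sum>t\<in>T. real (card {u\<in>part t. s \<otimes> u \<notin> part t}))) \<le> \<delta>\<^sup>2 * D"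
      if s: "s \<in> F0" for s
    proof -
      interpret group G by (rule grp)
      have esc: "card {u\<in>part t. s \<otimes> u \<notin> part t} \<le> 2 * \<omega> * card (shape t)" if t: "t \<in> T" for t
      proof -
        have sub: "{u\<in>part t. s \<otimes> u \<notin> part t} \<subseteq>
            {u\<in>shape t. s \<otimes> u \<notin> shape t} \<union> {u\<in>part t. s \<otimes> u \<in> shape t - part t}"
          using fin(2)[OF t] by auto
        have c: "u \<in> carrier G" if "u \<in> shape t" for u using FFfin(3)[OF shF[OF t]] that by auto
        have sc: "s \<in> carrier G" using s F0 by (auto simp: fin_subsets_def)
        have finp: "finite (part t)" using fin[OF t] finite_subset by auto
        have "card {u\<in>part t. s \<otimes> u \<notin> part t} \<le> card ({u\<in>shape t. s \<otimes> u \<notin> shape t} \<union> {u\<in>part t. s \<otimes> u \<in> shape t - part t})"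
          using sub fin[OF t] finp by (intro card_mono) auto
        also have "\<dots> \<le> card {u\<in>shape t. s \<otimes> u \<notin> shape t} + card {u\<in>part t. s \<otimes> u \<in> shape t - part t}"
          by (rule card_Un_le)
        also have "\<dots> \<le> card ((F0 <#> shape t) - shape t) + card (shape t - part t)"
        proof (rule add_mono)
          show "card {u\<in>shape t. s \<otimes> u \<notin> shape t} \<le> card ((F0 <#> shape t) - shape t)"
            by (rule card_escape_le[OF grp F0 s FFfin(4)[OF shF[OF t]]])
          have "inj_on ((\<otimes>) s) {u\<in>part t. s \<otimes> u \<in> shape t - part t}"
          proof (rule inj_onI)
            fix x y assume "x \<in> {u\<in>part t. s \<otimes> u \<in> shape t - part t}"
              "y \<in> {u\<in>part t. s \<otimes> u \<in> shape t - part t}" and eq: "s \<otimes> x = s \<otimes> y"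
            then have "x \<in> carrier G" "y \<in> carrier G" using fin(2)[OF t] c by auto
            then show "x = y" using eq sc by simp
          qed
          then show "card {u\<in>part t. s \<otimes> u \<in> shape t - part t} \<le> card (shape t - part t)"
            using fin(1)[OF t] by (intro card_inj_on_le[of "(\<otimes>) s"]) auto
        qed
        finally have "real (card {u\<in>part t. s \<otimes> u \<notin> part t}) \<le> real (card ((F0 <#> shape t) - shape t)) + real (card (shape t - part t))"
          by simp
        moreover have "real (card ((F0 <#> shape t) - shape t)) \<le> \<omega> * card (shape t)"
          using FFfin(5)[OF shF[OF t]] by (auto simp: almost_invariant_def)
        ultimately show ?thesis using lost[OF t] by linarith
      qed
      have "(\<Sum>t\<in>T. real (card {u\<in>part t. s \<otimes> u \<notin> part t})) \<le> (\<Sum>t\<in>T. 2 * \<omega> * card (shape t))"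
        by (intro sum_mono esc)
      also have "\<dots> = 2 * \<omega> * S" by (simp add: S_def sum_distrib_left)
      also have "\<dots> \<le> 2 * \<omega> * (2 * D)" using S2 \<omega> by (intro mult_left_mono) auto
      finally have "M\<^sup>2 * (real (card ({1..D} - covered (\<sigma> i) T)) + (\<Sum>t\<in>T. real (card {u\<in>part t. s \<otimes> u \<notin> part t})))
          \<le> M\<^sup>2 * (\<omega> * D + 2 * \<omega> * (2 * D))"
        using unc by (intro mult_left_mono add_mono) auto
      also have "\<dots> = M\<^sup>2 * (5 * \<omega>) * D" by (simp add: algebra_simps)
      also have "\<dots> \<le> \<delta>\<^sup>2 * D" using \<omega>(5) by (intro mult_right_mono) auto
      finally show ?thesis .
    qed
    have EX: "E t \<subseteq> topspace X" if "t \<in> T" for t using E(1)[OF that] EF(2)[OF shF[OF that]] by auto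
    have Efin: "finite (E t)" if "t \<in> T" for t using E(1)[OF that] EF(1)[OF shF[OF that]] finite_subset by auto
    have Efib: "\<pi> x = \<pi> x'" if "t \<in> T" "x \<in> E t" "x' \<in> E t" for t x x'
    proof -
      have "x \<in> fibre (yF (shape t))" "x' \<in> fibre (yF (shape t))"
        using E(1)[OF that(1)] EF(2)[OF shF[OF that(1)]] that(2,3) by blast+
      then show ?thesis by simp
    qed
    have "\<exists>\<E>. finite \<E> \<and> card \<E> = (\<Prod>t\<in>T. card (E t)) \<and> \<E> \<subseteq> sofic_Map X actX \<rho>X F0 \<delta> D (\<sigma> i) \<and>
      (\<forall>\<phi>\<in>\<E>. \<forall>\<phi>'\<in>\<E>. \<phi> \<noteq> \<phi>' \<longrightarrow>
        rho_infty D \<rho>Y (\<pi> \<circ> \<phi>) (\<pi> \<circ> \<phi>') \<le> \<theta> \<and> \<epsilon> \<le> rho_infty D \<rho>X \<phi> \<phi>')"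
      by (rule tile_product_maps[OF D L(2,3) perm T(1) shL Efin EX Efib E(3) x0 M bad pos(1) less_imp_le[OF \<theta>] \<delta>])
    then obtain \<E> where \<E>: "finite \<E>" "card \<E> = (\<Prod>t\<in>T. card (E t))" "\<E> \<subseteq> sofic_Map X actX \<rho>X F0 \<delta> D (\<sigma> i)"
      "\<forall>\<phi>\<in>\<E>. \<forall>\<phi>'\<in>\<E>. \<phi> \<noteq> \<phi>' \<longrightarrow>
        rho_infty D \<rho>Y (\<pi> \<circ> \<phi>) (\<pi> \<circ> \<phi>') \<le> \<theta> \<and> \<epsilon> \<le> rho_infty D \<rho>X \<phi> \<phi>'"
      by (elim exE conjE)
    have factor_ge: "exp ((a - \<omega> * lm) * card (shape t)) \<le> card (E t)" if t: "t \<in> T" for t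
    proof -
      have "exp (a * card (shape t)) \<le> card (EF (shape t))" using EF(4)[OF shF[OF t]] .
      also have "\<dots> \<le> real (card (E t) * m ^ card (shape t - part t))" using E(2)[OF t] by (rule of_nat_mono)
      also have "\<dots> = card (E t) * exp (card (shape t - part t) * lm)"
        using m(1) by (simp add: lm_def exp_of_nat_mult)
      also have "\<dots> \<le> card (E t) * exp (\<omega> * card (shape t) * lm)"
        using lost[OF t] lm by (intro mult_left_mono) (auto intro: mult_right_mono)
      finally have "exp (a * card (shape t)) * exp (- (\<omega> * card (shape t) * lm)) \<le> card (E t)"
        by (simp add: exp_minus field_simps)
      then show ?thesis by (simp flip: exp_add add: algebra_simps)
    qed
    have "(a - \<kappa>) * D \<le> (a - \<omega> * lm) * S"
    proof -
      have "\<omega> * lm * S \<le> \<omega> * lm * (2 * D)" using S2 \<omega>(1) lm by (intro mult_left_mono) auto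
      also have "\<dots> = \<omega> * (2 * lm) * D" by simp
      also have "\<dots> \<le> \<kappa> / 2 * D" using \<omega>(4) by (intro mult_right_mono) auto
      finally have 1: "\<omega> * lm * S \<le> \<kappa> / 2 * D" .
      have "a * ((1 - \<omega>) * D) \<le> a * S" using S1 pos(2) by (intro mult_left_mono) auto
      moreover have "\<omega> * a * D \<le> \<kappa> / 2 * D" using \<omega>(3) by (intro mult_right_mono) auto
      ultimately show ?thesis using 1 by (simp add: algebra_simps)
    qed
    then have "exp ((a - \<kappa>) * D) \<le> exp ((a - \<omega> * lm) * S)" by simp
    also have "\<dots> = (\<Prod>t\<in>T. exp ((a - \<omega> * lm) * card (shape t)))"
      unfolding S_def sum_distrib_left using quasi_tilingD(1)[OF T(1)] by (rule exp_sum)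
    also have "\<dots> \<le> (\<Prod>t\<in>T. real (card (E t)))" using factor_ge by (intro prod_mono) auto
    also have "\<dots> = card \<E>" using \<E>(2) by simp
    finally have "ereal ((a - \<kappa>) * D) \<le> elog (N_cond D \<pi> \<epsilon> (sofic_Map X actX \<rho>X F0 \<delta> D (\<sigma> i)) \<theta> \<rho>X \<rho>Y)"
      unfolding N_cond_def using \<E> by (intro elog_max_card_ge) auto
    then have "ereal (a - \<kappa>) \<le> elog (N_cond D \<pi> \<epsilon> (sofic_Map X actX \<rho>X F0 \<delta> D (\<sigma> i)) \<theta> \<rho>X \<rho>Y) / ereal D"
      using D by (simp add: ereal_le_divide_pos mult.commute)
    then show ?case by (simp add: D_def)
  qed
  then show "ereal (a - \<kappa>) \<le>
      limsup (\<lambda>i. elog (N_cond (d i) \<pi> \<epsilon> (sofic_Map X actX \<rho>X F0 \<delta> (d i) (\<sigma> i)) \<theta> \<rho>X \<rho>Y) / ereal (real (d i)))"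
    by (intro le_Limsup) auto
qed

end

subsection \<open>Comparison of the limits\<close>

lemma eventually_ln_inverse_ge: "\<forall>\<^sub>F \<epsilon> in at_right (0::real). B \<le> ln (1 / \<epsilon>)"
proof -
  have "B \<le> ln (1 / \<epsilon>)" if "0 < \<epsilon>" "\<epsilon> < exp (- B)" for \<epsilon> :: real
  proof -
    have "ln \<epsilon> < ln (exp (- B))" using that by (subst ln_less_cancel_iff) auto
    then show ?thesis using that by (simp add: ln_div)
  qed
  then show ?thesis
    unfolding eventually_at_right_field by (intro exI[of _ "exp (- B)"]) auto
qed

lemma eventually_ln_inverse_pos: "\<forall>\<^sub>F \<epsilon> in at_right (0::real). 0 < ln (1 / \<epsilon>)"
  using eventually_ln_inverse_ge[of 1] by eventually_elim simp

lemma Liminf_log_rescale: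
  fixes f :: "real \<Rightarrow> ereal"
  assumes f: "\<And>\<epsilon>. 0 < \<epsilon> \<Longrightarrow> 0 \<le> f \<epsilon>"
  shows "Liminf (at_right 0) (\<lambda>\<epsilon>. f (\<epsilon> / 4) / ereal (ln (1 / \<epsilon>)))
    \<le> Liminf (at_right 0) (\<lambda>\<epsilon>. f \<epsilon> / ereal (ln (1 / \<epsilon>)))" (is "?A \<le> ?B")
proof (rule ccontr)
  assume "\<not> ?A \<le> ?B"
  then have less: "?B < ?A" by simp
  then obtain c where c: "?B < ereal c" "ereal c < ?A" using ereal_dense2 by blast
  then obtain b where b: "?B < ereal b" "ereal b < ereal c" using ereal_dense2 by blast
  have pos: "\<forall>\<^sub>F \<epsilon> in at_right (0::real). 0 < \<epsilon>" by (simp add: eventually_at_right_less)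
  have "\<forall>\<^sub>F \<epsilon> in at_right 0. 0 \<le> f \<epsilon> / ereal (ln (1 / \<epsilon>))"
    using pos eventually_ln_inverse_pos by eventually_elim (use f in \<open>simp del: ln_div\<close>)
  then have "0 \<le> ?B" by (rule Liminf_bounded)
  then have bc: "0 < b" "b < c" using b by (auto simp: zero_ereal_def dest: le_less_trans)
  have "\<forall>\<^sub>F \<epsilon> in at_right 0. ereal c < f (\<epsilon> / 4) / ereal (ln (1 / \<epsilon>))"
    using c(2) by (rule less_LiminfD)
  then obtain e where e: "0 < e" "\<And>\<epsilon>. 0 < \<epsilon> \<Longrightarrow> \<epsilon> < e \<Longrightarrow> ereal c < f (\<epsilon> / 4) / ereal (ln (1 / \<epsilon>))"
    unfolding eventually_at_right_field by auto
  have small: "\<forall>\<^sub>F \<epsilon> in at_right (0::real). \<epsilon> < min (e / 4) (1 / 4)"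
    unfolding eventually_at_right_field using e(1) by (intro exI[of _ "min (e / 4) (1 / 4)"]) auto
  have "\<forall>\<^sub>F \<epsilon> in at_right 0. ereal b \<le> f \<epsilon> / ereal (ln (1 / \<epsilon>))"
    using pos small eventually_ln_inverse_ge[of "c * ln 4 / (c - b)"] eventually_ln_inverse_pos
  proof eventually_elim
    case (elim \<epsilon>)
    have l4: "ln (1 / (4 * \<epsilon>)) = ln (1 / \<epsilon>) - ln 4" using elim(1) by (simp add: ln_div ln_mult)
    have lpos: "0 < ln (1 / (4 * \<epsilon>))" using elim(1,2) by (intro ln_gt_zero) (auto simp: field_simps)
    have "ereal c < f (4 * \<epsilon> / 4) / ereal (ln (1 / (4 * \<epsilon>)))" using elim(1,2) by (intro e(2)) auto
    then have "ereal c \<le> f \<epsilon> / ereal (ln (1 / (4 * \<epsilon>)))" by simp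
    then have "ereal (ln (1 / (4 * \<epsilon>)) * c) \<le> f \<epsilon>"
      using lpos by (subst (asm) ereal_le_divide_pos) auto
    moreover have "c * ln 4 \<le> (c - b) * ln (1 / \<epsilon>)"
      using elim(3) bc by (simp add: pos_divide_le_eq mult.commute)
    then have "ln (1 / \<epsilon>) * b \<le> ln (1 / (4 * \<epsilon>)) * c" unfolding l4 by (simp add: algebra_simps)
    ultimately have "ereal (ln (1 / \<epsilon>) * b) \<le> f \<epsilon>" by (meson ereal_less_eq(3) order_trans)
    then show ?case using elim(4) by (subst ereal_le_divide_pos) auto
  qed
  then have "ereal b \<le> ?B" by (rule Liminf_bounded)
  then show False using b(1) by simp
qed

context factor_setting
begin

definition h_cond :: "real \<Rightarrow> ereal" where
  "h_cond \<epsilon> = limsup_fin G (\<lambda>F.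
     (SUP y\<in>topspace Y. elog (N_sep \<epsilon> (fibre y) (rho_F actX \<rho>X F))) / ereal (real (card F)))"

lemma card_fin_subsets_pos: "F \<in> almost_invariant G K \<delta> \<Longrightarrow> 0 < card F"
  by (auto simp: almost_invariant_def fin_subsets_def card_gt_0_iff)

lemma fibre_nonempty:
  assumes "y \<in> topspace Y"
  shows "fibre y \<noteq> {}"
proof -
  have "y \<in> \<pi> ` topspace X" using factor assms by (simp add: factor_map_def)
  then show ?thesis by (auto simp del: null_topspace_iff_trivial)
qed

lemma topspace_empty_iff: "topspace Y = {} \<longleftrightarrow> topspace X = {}"
  using factor unfolding factor_map_def by blast

lemma h_cond_nonneg:
  assumes "amenable_group G" "topspace X \<noteq> {}"
  shows "0 \<le> h_cond \<epsilon>"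
  unfolding h_cond_def limsup_fin_def
proof (intro INF_greatest)
  fix K \<delta> assume K: "K \<in> fin_subsets G" "\<delta> \<in> {0::real<..}"
  then obtain F where F: "F \<in> almost_invariant G K \<delta>"
    using assms(1) unfolding amenable_group_def by auto
  obtain y where y: "y \<in> topspace Y" using assms(2) topspace_empty_iff by blast
  obtain x where x: "x \<in> fibre y" using fibre_nonempty[OF y] by blast
  have "ereal 0 \<le> elog (N_sep \<epsilon> (fibre y) (rho_F actX \<rho>X F))"
    unfolding N_sep_def using x by (intro elog_max_card_ge[of "{x}"]) auto
  also have "\<dots> \<le> (SUP y\<in>topspace Y. elog (N_sep \<epsilon> (fibre y) (rho_F actX \<rho>X F)))"
    using y by (intro SUP_upper)
  finally have "0 \<le> (SUP y\<in>topspace Y. elog (N_sep \<epsilon> (fibre y) (rho_F actX \<rho>X F))) / ereal (real (card F))"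
    by (intro zero_le_divide_ereal) (auto simp: zero_ereal_def)
  also have "\<dots> \<le> (SUP F\<in>almost_invariant G K \<delta>. (SUP y\<in>topspace Y. elog (N_sep \<epsilon> (fibre y) (rho_F actX \<rho>X F))) / ereal (real (card F)))"
    using F by (intro SUP_upper)
  finally show "0 \<le> (SUP F\<in>almost_invariant G K \<delta>. (SUP y\<in>topspace Y. elog (N_sep \<epsilon> (fibre y) (rho_F actX \<rho>X F))) / ereal (real (card F)))" .
qed

lemma h_sofic_le_h_cond:
  assumes "sofic_approximation G d \<sigma>" "amenable_group G" "topspace X \<noteq> {}" "0 < \<epsilon>"
  shows "h_sofic G d \<sigma> X actX \<pi> \<rho>X \<rho>Y \<epsilon> \<le> h_cond (\<epsilon> / 4)"
proof (rule ccontr)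
  let ?h = "h_sofic G d \<sigma> X actX \<pi> \<rho>X \<rho>Y \<epsilon>"
  assume "\<not> ?h \<le> h_cond (\<epsilon> / 4)"
  then have "h_cond (\<epsilon> / 4) < ?h" by simp
  then obtain c where c: "h_cond (\<epsilon> / 4) < ereal c" "ereal c < ?h" using ereal_dense2 by blast
  then obtain b where b: "h_cond (\<epsilon> / 4) < ereal b" "ereal b < ereal c" using ereal_dense2 by blast
  have b0: "0 \<le> b" using h_cond_nonneg[OF assms(2,3), of "\<epsilon> / 4"] b(1)
    by (metis ereal_less_eq(5) less_imp_le order_trans)
  obtain K \<delta> where K: "K \<in> fin_subsets G" "0 < \<delta>"
    "(SUP F\<in>almost_invariant G K \<delta>. (SUP y\<in>topspace Y. elog (N_sep (\<epsilon> / 4) (fibre y) (rho_F actX \<rho>X F))) / ereal (real (card F))) < ereal b"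
    using b(1) unfolding h_cond_def limsup_fin_def INF_less_iff by auto
  have "elog (N_sep (\<epsilon> / 4) (fibre y) (rho_F actX \<rho>X F)) \<le> ereal (b * card F)"
    if F: "F \<in> almost_invariant G K \<delta>" and y: "y \<in> topspace Y" for F y
  proof -
    have "(SUP y\<in>topspace Y. elog (N_sep (\<epsilon> / 4) (fibre y) (rho_F actX \<rho>X F))) / ereal (real (card F)) \<le> ereal b"
      by (rule order_trans[OF SUP_upper[OF F] less_imp_le[OF K(3)]])
    then have "(SUP y\<in>topspace Y. elog (N_sep (\<epsilon> / 4) (fibre y) (rho_F actX \<rho>X F))) \<le> ereal (real (card F)) * ereal b"
      using card_fin_subsets_pos[OF F] by (subst (asm) ereal_divide_le_pos) auto
    also have "ereal (real (card F)) * ereal b = ereal (b * card F)" by (simp add: mult.commute)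
    finally show ?thesis by (rule order_trans[OF SUP_upper[OF y]])
  qed
  then have "?h \<le> ereal (b + (c - b))"
    using b b0 K by (intro h_sofic_le[OF assms(1,2,4) b0 K(2) _ K(1)]) auto
  then show False using c(2) by simp
qed

lemma h_cond_le_h_sofic:
  assumes "sofic_approximation G d \<sigma>" "amenable_group G" "topspace X \<noteq> {}" "0 < \<epsilon>"
  shows "h_cond \<epsilon> \<le> h_sofic G d \<sigma> X actX \<pi> \<rho>X \<rho>Y \<epsilon>"
proof (rule ccontr)
  let ?h = "h_sofic G d \<sigma> X actX \<pi> \<rho>X \<rho>Y \<epsilon>"
  assume "\<not> h_cond \<epsilon> \<le> ?h"
  then have "?h < h_cond \<epsilon>" by simp
  then obtain b where b: "?h < ereal b" "ereal b < h_cond \<epsilon>" using ereal_dense2 by blast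
  then obtain c where c: "?h < ereal c" "ereal c < ereal b" using ereal_dense2 by blast
  have N: "\<exists>F\<in>almost_invariant G K \<delta>. \<exists>y E. finite E \<and>
       E \<subseteq> fibre y \<and> (\<forall>x\<in>E. \<forall>x'\<in>E. x \<noteq> x' \<longrightarrow> \<epsilon> \<le> rho_F actX \<rho>X F x x') \<and> exp (max b 0 * card F) \<le> card E"
    if K: "K \<in> fin_subsets G" "0 < \<delta>" for K \<delta>
  proof (cases "b \<le> 0")
    case True
    obtain F where F: "F \<in> almost_invariant G K \<delta>"
      using assms(2) K unfolding amenable_group_def by auto
    obtain x where x: "x \<in> topspace X" using assms(3) by blast
    show ?thesis
      using True x by (intro bexI[OF _ F] exI[of _ "\<pi> x"] exI[of _ "{x}"]) (auto simp: max_def)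
  next
    case False
    have "ereal b < (SUP F\<in>almost_invariant G K \<delta>. (SUP y\<in>topspace Y. elog (N_sep \<epsilon> (fibre y) (rho_F actX \<rho>X F))) / ereal (real (card F)))"
      using b(2) K unfolding h_cond_def limsup_fin_def
      by (elim less_le_trans) (intro INF_lower2[of K] INF_lower2[of \<delta>], auto)
    then obtain F where F: "F \<in> almost_invariant G K \<delta>"
      "ereal b < (SUP y\<in>topspace Y. elog (N_sep \<epsilon> (fibre y) (rho_F actX \<rho>X F))) / ereal (real (card F))"
      unfolding less_SUP_iff by auto
    then have "ereal (real (card F)) * ereal b < (SUP y\<in>topspace Y. elog (N_sep \<epsilon> (fibre y) (rho_F actX \<rho>X F)))"
      using card_fin_subsets_pos[OF F(1)] by (subst (asm) ereal_less_divide_pos) auto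
    then obtain y where y: "ereal (b * card F) < elog (N_sep \<epsilon> (fibre y) (rho_F actX \<rho>X F))"
      unfolding less_SUP_iff by (auto simp: mult.commute)
    from less_elog_max_card[OF this[unfolded N_sep_def]]
    obtain E where "finite E" "E \<subseteq> fibre y" "\<forall>x\<in>E. \<forall>x'\<in>E. x \<noteq> x' \<longrightarrow> \<epsilon> \<le> rho_F actX \<rho>X F x x'"
      "exp (b * card F) < card E"
      by (elim exE conjE)
    then show ?thesis
      using False by (intro bexI[OF _ F(1)] exI[of _ y] exI[of _ E]) (auto simp: max_def)
  qed
  have "ereal (max b 0 - (max b 0 - c)) \<le> ?h"
    using c by (intro h_sofic_ge[OF assms(1,4) _ _ assms(3) N]) auto
  then show False using c(1) by simp
qed

lemma mdim_cond_eq: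
  "mdim_cond G X actX Y \<pi> \<rho>X = Liminf (at_right 0) (\<lambda>\<epsilon>. h_cond \<epsilon> / ereal (ln (1 / \<epsilon>)))"
  by (simp add: mdim_cond_def h_cond_def)

lemma mdim_sofic_eq_mdim_cond_nonempty:
  assumes "sofic_approximation G d \<sigma>" "amenable_group G" "topspace X \<noteq> {}"
  shows "mdim_sofic G d \<sigma> X actX \<pi> \<rho>X \<rho>Y = mdim_cond G X actX Y \<pi> \<rho>X"
  unfolding mdim_sofic_def mdim_cond_eq
proof (rule antisym)
  let ?h = "h_sofic G d \<sigma> X actX \<pi> \<rho>X \<rho>Y"
  have pos: "\<forall>\<^sub>F \<epsilon> in at_right (0::real). 0 < \<epsilon>" by (simp add: eventually_at_right_less)
  have "Liminf (at_right 0) (\<lambda>\<epsilon>. ?h \<epsilon> / ereal (ln (1 / \<epsilon>)))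
      \<le> Liminf (at_right 0) (\<lambda>\<epsilon>. h_cond (\<epsilon> / 4) / ereal (ln (1 / \<epsilon>)))"
    using pos eventually_ln_inverse_pos
    by (intro Liminf_mono, eventually_elim)
      (intro ereal_divide_right_mono h_sofic_le_h_cond assms; simp)
  also have "\<dots> \<le> Liminf (at_right 0) (\<lambda>\<epsilon>. h_cond \<epsilon> / ereal (ln (1 / \<epsilon>)))"
    by (intro Liminf_log_rescale h_cond_nonneg assms)
  finally show "Liminf (at_right 0) (\<lambda>\<epsilon>. ?h \<epsilon> / ereal (ln (1 / \<epsilon>)))
      \<le> Liminf (at_right 0) (\<lambda>\<epsilon>. h_cond \<epsilon> / ereal (ln (1 / \<epsilon>)))" .
  show "Liminf (at_right 0) (\<lambda>\<epsilon>. h_cond \<epsilon> / ereal (ln (1 / \<epsilon>)))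
      \<le> Liminf (at_right 0) (\<lambda>\<epsilon>. ?h \<epsilon> / ereal (ln (1 / \<epsilon>)))"
    using pos eventually_ln_inverse_pos
    by (intro Liminf_mono, eventually_elim)
      (intro ereal_divide_right_mono h_cond_le_h_sofic assms; simp)
qed

lemma Liminf_MInfty_div_ln:
  assumes "\<And>\<epsilon>. h \<epsilon> = - \<infinity>"
  shows "Liminf (at_right 0) (\<lambda>\<epsilon>. h \<epsilon> / ereal (ln (1 / \<epsilon>))) = - \<infinity>"
proof -
  have "\<forall>\<^sub>F \<epsilon> in at_right 0. h \<epsilon> / ereal (ln (1 / \<epsilon>)) = - \<infinity>"
    using eventually_ln_inverse_pos by eventually_elim (simp add: assms)
  then show ?thesis by (simp add: Liminf_eq Liminf_const)
qed

lemma mdim_sofic_eq_mdim_cond_empty: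
  assumes "sofic_approximation G d \<sigma>" "topspace X = {}"
  shows "mdim_sofic G d \<sigma> X actX \<pi> \<rho>X \<rho>Y = mdim_cond G X actX Y \<pi> \<rho>X"
proof -
  interpret group G by (rule grp)
  have K: "{\<one>} \<in> fin_subsets G" by (simp add: fin_subsets_def)
  have "h_cond \<epsilon> = - \<infinity>" for \<epsilon>
  proof -
    have "h_cond \<epsilon> \<le> (SUP F\<in>almost_invariant G {\<one>} 1. (SUP y\<in>topspace Y. elog (N_sep \<epsilon> (fibre y) (rho_F actX \<rho>X F))) / ereal (real (card F)))"
      unfolding h_cond_def limsup_fin_def using K by (intro INF_lower2[of "{\<one>}"] INF_lower2[of 1]) auto
    also have "\<dots> \<le> - \<infinity>"
      proof (rule SUP_least)
      fix F assume "F \<in> almost_invariant G {\<one>} 1"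
      moreover have "topspace Y = {}" using topspace_empty_iff assms(2) by blast
      ultimately show "(SUP y\<in>topspace Y. elog (N_sep \<epsilon> (fibre y) (rho_F actX \<rho>X F))) / ereal (real (card F)) \<le> - \<infinity>"
        using card_fin_subsets_pos by (simp del: null_topspace_iff_trivial add: bot_ereal_def)
    qed
    finally show ?thesis by simp
  qed
  moreover have "h_sofic G d \<sigma> X actX \<pi> \<rho>X \<rho>Y \<epsilon> = - \<infinity>" for \<epsilon>
  proof -
    have "\<forall>\<^sub>F i in sequentially. 1 \<le> d i"
      using assms(1) by (simp add: sofic_approximation_def filterlim_at_top)
    then have "\<forall>\<^sub>F i in sequentially.
        elog (N_cond (d i) \<pi> \<epsilon> (sofic_Map X actX \<rho>X {\<one>} 1 (d i) (\<sigma> i)) 1 \<rho>X \<rho>Y) / ereal (real (d i)) \<le> - \<infinity>"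
    proof eventually_elim
      case (elim i)
      have "sofic_Map X actX \<rho>X {\<one>} 1 (d i) (\<sigma> i) = {}"
        using elim assms(2) by (auto simp: sofic_Map_def PiE_eq_empty_iff)
      then have "elog (N_cond (d i) \<pi> \<epsilon> (sofic_Map X actX \<rho>X {\<one>} 1 (d i) (\<sigma> i)) 1 \<rho>X \<rho>Y) \<le> ereal c" for c
        unfolding N_cond_def elog_max_card_le_iff by simp
      then have "elog (N_cond (d i) \<pi> \<epsilon> (sofic_Map X actX \<rho>X {\<one>} 1 (d i) (\<sigma> i)) 1 \<rho>X \<rho>Y) = - \<infinity>"
        by (rule ereal_bot)
      then show ?case using elim by simp
    qed
    then have "limsup (\<lambda>i. elog (N_cond (d i) \<pi> \<epsilon> (sofic_Map X actX \<rho>X {\<one>} 1 (d i) (\<sigma> i)) 1 \<rho>X \<rho>Y) / ereal (real (d i))) \<le> - \<infinity>"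
      by (rule Limsup_bounded)
    moreover have "h_sofic G d \<sigma> X actX \<pi> \<rho>X \<rho>Y \<epsilon> \<le>
        limsup (\<lambda>i. elog (N_cond (d i) \<pi> \<epsilon> (sofic_Map X actX \<rho>X {\<one>} 1 (d i) (\<sigma> i)) 1 \<rho>X \<rho>Y) / ereal (real (d i)))"
      unfolding h_sofic_def using K
      by (intro INF_lower2[of 1] INF_lower2[of "{\<one>}"] INF_lower2[of 1]) auto
    ultimately show ?thesis by simp
  qed
  ultimately show ?thesis by (simp add: mdim_sofic_def mdim_cond_eq Liminf_MInfty_div_ln)
qed

end

theorem theorem6p9:
  fixes G :: "('g, 'm) monoid_scheme"
    and d :: "nat \<Rightarrow> nat" and \<sigma> :: "nat \<Rightarrow> 'g \<Rightarrow> nat \<Rightarrow> nat"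
    and X :: "'x topology" and actX :: "'g \<Rightarrow> 'x \<Rightarrow> 'x"
    and Y :: "'y topology" and actY :: "'g \<Rightarrow> 'y \<Rightarrow> 'y"
    and \<pi> :: "'x \<Rightarrow> 'y"
    and \<rho>X :: "'x \<Rightarrow> 'x \<Rightarrow> real" and \<rho>Y :: "'y \<Rightarrow> 'y \<Rightarrow> real"
  assumes "group G" and "countable (carrier G)" and "amenable_group G"
    and "sofic_approximation G d \<sigma>"
    and "dynamical_system G X actX" and "dynamical_system G Y actY"
    and "factor_map G X actX Y actY \<pi>"
    and "continuous_pseudometric X \<rho>X" and "dynamically_generating G X actX \<rho>X"
    and "continuous_pseudometric Y \<rho>Y" and "dynamically_generating G Y actY \<rho>Y"
  shows "mdim_sofic G d \<sigma> X actX \<pi> \<rho>X \<rho>Y = mdim_cond G X actX Y \<pi> \<rho>X"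
proof -
  interpret factor_setting G X actX Y actY \<pi> \<rho>X \<rho>Y
    using assms by (intro factor_setting.intro)
  show ?thesis
    using mdim_sofic_eq_mdim_cond_nonempty[OF assms(4,3)] mdim_sofic_eq_mdim_cond_empty[OF assms(4)]
    by metis
qed

end
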